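(* Consider the SI-ADMM algorithm described in the context. Suppose that: (1) the problem has a KKT point; (2) $Q$ and $\hat P=P+\rho A^TA$ are symmetric with $\hat P\succ0$ and $Q\succ0$; (3) $f$ and $g$ are strongly convex with constants $\mu_f$ and $\sigma_g$ respectively, and are continuously differentiable with Lipschitz continuous gradients with constants $L_f$ and $L_g$ respectively; (4) the matrix $[A\ \ B]$ has full row rank; (5) the moment assumption holds: with $w^x=\nabla_x\tilde f(x,\xi)-\nabla_xf(x)$ and $w^y=\nabla_y\tilde g(y,\xi)-\nabla_yg(y)$, there are constants $v_1^x,v_2^x,v_1^y,v_2^y$ such that for all $x\in\mathbb{R}^n$, $y\in\mathbb{R}^m$: $\mathbb{E}[w^x]=0$, $\mathbb{E}[w^y]=0$, $\mathbb{E}[\|w^x\|^2]\le v_1^x\|x\|^2+v_2^x$ and $\mathbb{E}[\|w^y\|^2]\le v_1^y\|y\|^2+v_2^y$; (6) if $P\ne0$ then $(2-\gamma)P\succ(\gamma-1)\rho A^TA$, and if $P=0$ then $\gamma=1$. Let $u^*=(x^*;y^*;\lambda^* )$ denote the KKT point, which is unique under these assumptions. Suppose further that $T_{k+1}^y\ge K_y$ and $T_{k+1}^x\ge K_x$ for all $k\ge0$, that $$\sum_{k=0}^\infty\frac1{T_{k+1}^y}<\infty,\qquad\sum_{k=0}^\infty\frac1{T_{k+1}^x}<\infty,$$ and that $\mathbb{E}[\|u_0-u^*\|_G^2]<\infty$. Then $\|u_k-u^*\|_G^2\to0$ almost surely as $k\to\infty$.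
   Context: Problem: $\min_{x\in\mathbb{R}^n,y\in\mathbb{R}^m}\ f(x)+g(y)$ subject to $Ax+By=b$, where $f(x)=\mathbb{E}[\tilde f(x,\xi)]$, $g(y)=\mathbb{E}[\tilde g(y,\xi)]$, $\xi$ is a random vector in $\mathbb{R}^d$ with range $\Xi$, $\tilde f(\cdot,\xi)$ and $\tilde g(\cdot,\xi)$ are convex for every $\xi\in\Xi$, $A\in\mathbb{R}^{p\times n}$, $B\in\mathbb{R}^{p\times m}$, $b\in\mathbb{R}^p$. A KKT point is a triple $u^*=(x^*;y^*;\lambda^* )$ with $A^T\lambda^*\in\partial f(x^* )$, $B^T\lambda^*\in\partial g(y^* )$, $Ax^*+By^*=b$. Augmented Lagrangian: $\mathcal{L}_\rho(x,y,\lambda)=f(x)+g(y)-\lambda^T(Ax+By-b)+\frac\rho2\|Ax+By-b\|^2$. Let $\tilde{\mathcal{L}}_1(x,y,\lambda,\xi)$ be the same expression with $f(x)$ replaced by $\tilde f(x,\xi)$, and $\tilde{\mathcal{L}}_2(x,y,\lambda,\xi)$ the same expression with $g(y)$ replaced by $\tilde g(y,\xi)$. SI-ADMM algorithm: fix matrices $P\in\mathbb{R}^{n\times n}$, $Q\in\mathbb{R}^{m\times m}$, positive scalars $\rho,\gamma,\gamma_x,\gamma_y$, positive integers $T_{k+1}^x,T_{k+1}^y$ ($k\ge0$), and an initial point $u_0=(x_0;y_0;\lambda_0)$ independent of the samples below. For $k=0,1,2,\dots$: set $y_{k,1}=y_k$ and, for $j=1,\dots,T_{k+1}^y-1$, $y_{k,j+1}=y_{k,j}-\frac{\gamma_y}{j}\left[\nabla_y\tilde{\mathcal{L}}_2(x_k,y_{k,j},\lambda_k,\xi^y_{k,j})+Q(y_{k,j}-y_k)\right]$;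 let $y_{k+1}=y_{k,T_{k+1}^y}$; set $x_{k,1}=x_k$ and, for $j=1,\dots,T_{k+1}^x-1$, $x_{k,j+1}=x_{k,j}-\frac{\gamma_x}{j}\left[\nabla_x\tilde{\mathcal{L}}_1(x_{k,j},y_{k+1},\lambda_k,\xi^x_{k,j})+P(x_{k,j}-x_k)\right]$; let $x_{k+1}=x_{k,T_{k+1}^x}$; $\lambda_{k+1}=\lambda_k-\gamma\rho(Ax_{k+1}+By_{k+1}-b)$. The samples $\{\xi^y_{k,j},\xi^x_{k,j}\}$ are i.i.d. copies of $\xi$. Write $u_k=(x_k;y_k;\lambda_k)$. Notation: $\hat P=P+\rho A^TA$; $G$ is the block-diagonal matrix with blocks $\hat P$, $Q$, $\frac1{\rho\gamma}I_p$; $\|z\|_M^2=z^TMz$. Constants: $c_y$ and $L_y$ are, respectively, a strong convexity constant in $y$ of $\mathcal{L}_\rho(x,y,\lambda)+\frac12\|y-z\|_Q^2$ and a Lipschitz constant in $y$ of its $y$-gradient, both independent of $x,y,\lambda,z$; $c_x$ and $L_x$ are, respectively, a strong convexity constant in $x$ of $\mathcal{L}_\rho(x,y,\lambda)+\frac12\|x-z\|_P^2$ and a Lipschitz constant in $x$ of its $x$-gradient, both independent of $x,y,\lambda,z$. It is assumed that $2c_x\gamma_x>1$ and $2c_y\gamma_y>1$. Fix $R>0$ and set $M_y=L_y^2+v_1^y(1+\frac1R)$, $K_y=\left\lceil\frac{\gamma_y^2M_y}{2c_y\gamma_y-1}\right\rceil+1$, $M_x=L_x^2+v_1^x(1+\frac1R)$,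 $K_x=\left\lceil\frac{\gamma_x^2M_x}{2c_x\gamma_x-1}\right\rceil+1$. *)

theory Defs
  imports "HOL-Probability.Probability"
begin

definition gradient :: "('a::real_inner \<Rightarrow> real) \<Rightarrow> 'a \<Rightarrow> 'a" where
  "gradient F x = (THE D. GDERIV F x :> D)"

definition subdifferential :: "('a::real_inner \<Rightarrow> real) \<Rightarrow> 'a \<Rightarrow> 'a set" where
  "subdifferential F x = {s. \<forall>z. F z \<ge> F x + s \<bullet> (z - x)}"

definition strongly_convex :: "real \<Rightarrow> ('a::real_normed_vector \<Rightarrow> real) \<Rightarrow> bool" where
  "strongly_convex c F \<longleftrightarrow> c > 0 \<and>
     (\<forall>x z. \<forall>t\<in>{0..1}. F (t *\<^sub>R x + (1 - t) *\<^sub>R z)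
        \<le> t * F x + (1 - t) * F z - c / 2 * t * (1 - t) * (norm (x - z))\<^sup>2)"

definition continuously_differentiable :: "('a::real_inner \<Rightarrow> real) \<Rightarrow> bool" where
  "continuously_differentiable F \<longleftrightarrow>
     (\<forall>x. F differentiable (at x)) \<and> continuous_on UNIV (gradient F)"

definition positive_definite :: "real^'n^'n \<Rightarrow> bool" where
  "positive_definite M \<longleftrightarrow> transpose M = M \<and> (\<forall>z. z \<noteq> 0 \<longrightarrow> z \<bullet> (M *v z) > 0)"

definition loewner_greater :: "real^'n^'n \<Rightarrow> real^'n^'n \<Rightarrow> bool" where
  "loewner_greater M N \<longleftrightarrow> positive_definite (M - N)"

(* The squared weighted norm takes the action of the matrix rather than the matrix itself, so that
   it also applies to triples (x, y, lam), on which block-diagonal matrices act as linear maps. *)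
definition wnorm2 :: "('a::real_inner \<Rightarrow> 'a) \<Rightarrow> 'a \<Rightarrow> real" where
  "wnorm2 M z = z \<bullet> M z"

definition block_diag3 ::
  "real^'n^'n \<Rightarrow> real^'m^'m \<Rightarrow> real^'p^'p
    \<Rightarrow> (real^'n) \<times> (real^'m) \<times> (real^'p) \<Rightarrow> (real^'n) \<times> (real^'m) \<times> (real^'p)" where
  "block_diag3 M1 M2 M3 = (\<lambda>(x, y, l). (M1 *v x, M2 *v y, M3 *v l))"

definition hcat :: "real^'n^'p \<Rightarrow> real^'m^'p \<Rightarrow> real^('n + 'm)^'p" where
  "hcat A B = (\<chi> i j. case j of Inl k \<Rightarrow> A $ i $ k | Inr k \<Rightarrow> B $ i $ k)"

definition P_hat :: "real \<Rightarrow> real^'n^'p \<Rightarrow> real^'n^'n \<Rightarrow> real^'n^'n" where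
  "P_hat \<rho> A P = P + \<rho> *\<^sub>R (transpose A ** A)"

definition G_op ::
  "real \<Rightarrow> real \<Rightarrow> real^'n^'p \<Rightarrow> real^'n^'n \<Rightarrow> real^'m^'m
    \<Rightarrow> (real^'n) \<times> (real^'m) \<times> (real^'p) \<Rightarrow> (real^'n) \<times> (real^'m) \<times> (real^'p)" where
  "G_op \<rho> \<gamma> A P Q = block_diag3 (P_hat \<rho> A P) Q ((1 / (\<rho> * \<gamma>)) *\<^sub>R mat 1)"

(* The sampled Lagrangians are obtained by passing a sampled objective for f or for g. *)
definition aug_lagrangian ::
  "real \<Rightarrow> real^'n^'p \<Rightarrow> real^'m^'p \<Rightarrow> real^'p \<Rightarrow> (real^'n \<Rightarrow> real) \<Rightarrow> (real^'m \<Rightarrow> real)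
    \<Rightarrow> real^'n \<Rightarrow> real^'m \<Rightarrow> real^'p \<Rightarrow> real" where
  "aug_lagrangian \<rho> A B b f g x y l =
     f x + g y - l \<bullet> (A *v x + B *v y - b) + \<rho> / 2 * (norm (A *v x + B *v y - b))\<^sup>2"

definition kkt_point ::
  "real^'n^'p \<Rightarrow> real^'m^'p \<Rightarrow> real^'p \<Rightarrow> (real^'n \<Rightarrow> real) \<Rightarrow> (real^'m \<Rightarrow> real)
    \<Rightarrow> (real^'n) \<times> (real^'m) \<times> (real^'p) \<Rightarrow> bool" where
  "kkt_point A B b f g = (\<lambda>(x, y, l).
     transpose A *v l \<in> subdifferential f x \<and>
     transpose B *v l \<in> subdifferential g y \<and>
     A *v x + B *v y = b)"

definition grad_noise ::
  "(real^'n \<Rightarrow> 'd \<Rightarrow> real) \<Rightarrow> (real^'n \<Rightarrow> real) \<Rightarrow> real^'n \<Rightarrow> 'd \<Rightarrow> real^'n" where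
  "grad_noise F f x s = gradient (\<lambda>z. F z s) x - gradient f x"

(* In a Bochner integral a non-integrable function gets the value 0, hence the integrability
   conditions. *)
definition moment_condition ::
  "'w measure \<Rightarrow> ('w \<Rightarrow> 'd) \<Rightarrow> (real^'n \<Rightarrow> 'd \<Rightarrow> real) \<Rightarrow> (real^'n \<Rightarrow> real)
    \<Rightarrow> real \<Rightarrow> real \<Rightarrow> bool" where
  "moment_condition M \<xi> F f v1 v2 \<longleftrightarrow> (\<forall>x.
     integrable M (\<lambda>\<omega>. grad_noise F f x (\<xi> \<omega>)) \<and>
     (\<integral>\<omega>. grad_noise F f x (\<xi> \<omega>) \<partial>M) = 0 \<and>
     integrable M (\<lambda>\<omega>. (norm (grad_noise F f x (\<xi> \<omega>)))\<^sup>2) \<and>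
     (\<integral>\<omega>. (norm (grad_noise F f x (\<xi> \<omega>)))\<^sup>2 \<partial>M) \<le> v1 * (norm x)\<^sup>2 + v2)"

definition M_const :: "real \<Rightarrow> real \<Rightarrow> real \<Rightarrow> real" where
  "M_const L v1 R = L\<^sup>2 + v1 * (1 + 1 / R)"

definition K_const :: "real \<Rightarrow> real \<Rightarrow> real \<Rightarrow> int" where
  "K_const step c Mc = \<lceil>step\<^sup>2 * Mc / (2 * c * step - 1)\<rceil> + 1"

(* The y-samples and x-samples drawn by the algorithm, collected into one family: stage k draws
   samples with inner index j = 1, ..., T (k+1) - 1. *)
definition sample_index ::
  "(nat \<Rightarrow> nat) \<Rightarrow> (nat \<Rightarrow> nat) \<Rightarrow> (nat \<times> nat + nat \<times> nat) set" where
  "sample_index Ty Tx =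
     {(k, j). 1 \<le> j \<and> j < Ty (Suc k)} <+> {(k, j). 1 \<le> j \<and> j < Tx (Suc k)}"

definition sample_family ::
  "(nat \<Rightarrow> nat \<Rightarrow> 'w \<Rightarrow> 'd) \<Rightarrow> (nat \<Rightarrow> nat \<Rightarrow> 'w \<Rightarrow> 'd) \<Rightarrow> nat \<times> nat + nat \<times> nat \<Rightarrow> 'w \<Rightarrow> 'd" where
  "sample_family \<xi>y \<xi>x = case_sum (\<lambda>(k, j). \<xi>y k j) (\<lambda>(k, j). \<xi>x k j)"

definition iid_copies ::
  "'w measure \<Rightarrow> ('w \<Rightarrow> 'd::topological_space) \<Rightarrow> 'd set \<Rightarrow> ('i \<Rightarrow> 'w \<Rightarrow> 'd) \<Rightarrow> 'i set \<Rightarrow> bool" where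
  "iid_copies M \<xi> \<Xi> S I \<longleftrightarrow>
     prob_space.indep_vars M (\<lambda>_. borel) S I \<and>
     (\<forall>i\<in>I. distr M borel (S i) = distr M borel \<xi> \<and> S i ` space M \<subseteq> \<Xi>)"

(* Independence of X from the whole family S; the library's indep_var needs both variables to have
   the same value type, so it is expressed via the generated sigma-algebras. *)
definition indep_of_family ::
  "'w measure \<Rightarrow> ('w \<Rightarrow> 'u::topological_space) \<Rightarrow> ('i \<Rightarrow> 'w \<Rightarrow> 'd::topological_space) \<Rightarrow> 'i set \<Rightarrow> bool" where
  "indep_of_family M X S I \<longleftrightarrow>
     prob_space.indep_set M
       (sets (vimage_algebra (space M) X borel))
       (sets (vimage_algebra (space M) (\<lambda>\<omega>. \<lambda>i\<in>I. S i \<omega>) (Pi\<^sub>M I (\<lambda>_. borel))))"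

(* The algorithm along one sample path: sy, sx are the realized samples and yi, xi the inner
   iterates; the inner index starts at 1, so the values at j = 0 are irrelevant. *)
definition si_admm_path ::
  "real^'n^'p \<Rightarrow> real^'m^'p \<Rightarrow> real^'p \<Rightarrow> real^'n^'n \<Rightarrow> real^'m^'m
    \<Rightarrow> (real^'n \<Rightarrow> real) \<Rightarrow> (real^'m \<Rightarrow> real)
    \<Rightarrow> (real^'n \<Rightarrow> 'd \<Rightarrow> real) \<Rightarrow> (real^'m \<Rightarrow> 'd \<Rightarrow> real)
    \<Rightarrow> real \<Rightarrow> real \<Rightarrow> real \<Rightarrow> real \<Rightarrow> (nat \<Rightarrow> nat) \<Rightarrow> (nat \<Rightarrow> nat)
    \<Rightarrow> (nat \<Rightarrow> nat \<Rightarrow> 'd) \<Rightarrow> (nat \<Rightarrow> nat \<Rightarrow> 'd)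
    \<Rightarrow> (nat \<Rightarrow> nat \<Rightarrow> real^'m) \<Rightarrow> (nat \<Rightarrow> nat \<Rightarrow> real^'n)
    \<Rightarrow> (nat \<Rightarrow> real^'n) \<Rightarrow> (nat \<Rightarrow> real^'m) \<Rightarrow> (nat \<Rightarrow> real^'p) \<Rightarrow> bool" where
  "si_admm_path A B b P Q f g ft gt \<rho> \<gamma> \<gamma>x \<gamma>y Tx Ty sx sy yi xi x y lam \<longleftrightarrow> (\<forall>k.
     yi k 1 = y k \<and>
     (\<forall>j. 1 \<le> j \<and> j < Ty (Suc k) \<longrightarrow>
        yi k (Suc j) = yi k j - (\<gamma>y / real j) *\<^sub>R
          (gradient (\<lambda>v. aug_lagrangian \<rho> A B b f (\<lambda>w. gt w (sy k j)) (x k) v (lam k)) (yi k j)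
            + Q *v (yi k j - y k))) \<and>
     y (Suc k) = yi k (Ty (Suc k)) \<and>
     xi k 1 = x k \<and>
     (\<forall>j. 1 \<le> j \<and> j < Tx (Suc k) \<longrightarrow>
        xi k (Suc j) = xi k j - (\<gamma>x / real j) *\<^sub>R
          (gradient (\<lambda>v. aug_lagrangian \<rho> A B b (\<lambda>w. ft w (sx k j)) g v (y (Suc k)) (lam k)) (xi k j)
            + P *v (xi k j - x k))) \<and>
     x (Suc k) = xi k (Tx (Suc k)) \<and>
     lam (Suc k) = lam k - (\<gamma> * \<rho>) *\<^sub>R (A *v x (Suc k) + B *v y (Suc k) - b))"

end

theory Submission
  imports Defs
begin

text \<open>
  Let a(k) be the squared G-distance of the k-th iterate to the KKT point. The theorem rests on the
  recursion
    a(k+1) \<le> q a(k) + C (|ex|^2 + |ey|^2)   with a fixed q < 1,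
  in which ex and ey are the gradients of the two block subproblems at the points actually returned
  by the inner loops, that is, the amounts by which the exact optimality conditions are missed
  (\<open>admm_inexact_step_contraction\<close>). Strong convexity turns the optimality conditions
  into a descent estimate for a(k). That estimate bounds the primal distances and the primal steps;
  the Lipschitz gradients and the full row rank of [A B] then also bound the distance of the new
  multiplier, so the decrease is at least a fixed fraction of a(k+1). With ex = ey = 0 and a second
  KKT point as a stationary iterate the same recursion gives uniqueness.

  Each inner loop is a stochastic approximation scheme with step sizes \<open>\<gamma> / j\<close> for
  the zero of a strongly monotone Lipschitz map. As 2 c \<open>\<gamma>\<close> > 1, its mean square error
  after T samples is of order 1 / T, with a constant proportional to 1 + E |u(k)|^2, because the
  variance of the noise may grow with the square of the iterate
  (\<open>stochastic_approximation_residual\<close>, \<open>block_stage\<close>). Taking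
  expectations in the recursion, d(k) = E a(k) satisfies
    d(k+1) \<le> q d(k) + e(k) (1 + d(k))
  with e(k) a multiple of the sum of the reciprocal sample sizes. Since the e(k) are summable, so are
  the d(k) (\<open>summable_perturbed_contraction\<close>). By monotone convergence the series of the
  a(k) then has finite expectation, hence converges almost surely, and its terms tend to 0.

  Only unconditional expectations occur. A sample is independent of the sigma-algebra generated by
  the initial point and the earlier samples, so the joint law of the current iterate and the sample
  is a product, and Fubini lets the noise be averaged with the iterate held fixed
  (\<open>expected_square_noisy_step\<close>). This needs the sampled gradients to be jointly
  measurable in the point and the sample, which follows from measurability in the sample and
  differentiability in the point (\<open>borel_measurable_sampled_gradient\<close>).
\<close>

section \<open>Gradients and strong convexity\<close>

lemma GDERIV_unique:
  fixes F :: "'a::real_inner \<Rightarrow> real"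
  assumes "GDERIV F x :> D" "GDERIV F x :> E"
  shows "D = E"
proof -
  have "(\<lambda>h. h \<bullet> D) = (\<lambda>h. h \<bullet> E)"
    using assms unfolding gderiv_def by (rule has_derivative_unique)
  then have "(D - E) \<bullet> (D - E) = 0"
    by (metis inner_diff_right right_minus_eq)
  then show ?thesis by simp
qed

lemma gradient_eqI: "GDERIV F x :> D \<Longrightarrow> gradient F x = D"
  unfolding gradient_def by (rule the_equality) (auto intro: GDERIV_unique)

lemma GDERIV_gradient:
  fixes F :: "'a::euclidean_space \<Rightarrow> real"
  assumes "F differentiable (at x)"
  shows "GDERIV F x :> gradient F x"
proof -
  obtain F' where F': "(F has_derivative F') (at x)"
    using assms by (auto simp: differentiable_def)
  then interpret bounded_linear F' by (rule has_derivative_bounded_linear)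
  have "F' h = h \<bullet> (\<Sum>b\<in>Basis. F' b *\<^sub>R b)" for h
  proof -
    have "F' h = F' (\<Sum>b\<in>Basis. (h \<bullet> b) *\<^sub>R b)" by (simp add: euclidean_representation)
    also have "\<dots> = (\<Sum>b\<in>Basis. (h \<bullet> b) * F' b)" by (simp add: sum scaleR)
    finally show ?thesis by (simp add: inner_sum_right mult.commute)
  qed
  then have "F' = (\<lambda>h. h \<bullet> (\<Sum>b\<in>Basis. F' b *\<^sub>R b))" by (rule ext)
  with F' have "GDERIV F x :> (\<Sum>b\<in>Basis. F' b *\<^sub>R b)"
    unfolding gderiv_def by metis
  then show ?thesis using gradient_eqI by metis
qed

lemma GDERIV_directional:
  fixes F :: "'a::real_inner \<Rightarrow> real"
  assumes "GDERIV F x :> D"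
  shows "((\<lambda>t. (F (x + t *\<^sub>R h) - F x) / t) \<longlongrightarrow> h \<bullet> D) (at 0)"
proof -
  have "((\<lambda>t. F (x + t *\<^sub>R h)) has_derivative (\<lambda>t. (t *\<^sub>R h) \<bullet> D)) (at 0)"
    using assms unfolding gderiv_def
    by (intro has_derivative_compose[where f="\<lambda>t. x + t *\<^sub>R h" and g=F])
       (auto intro!: derivative_eq_intros)
  then have "DERIV (\<lambda>t. F (x + t *\<^sub>R h)) 0 :> h \<bullet> D"
    by (simp add: has_field_derivative_def mult_commute_abs)
  then show ?thesis by (simp add: DERIV_def)
qed

text \<open>If s is a subgradient at x, then x minimizes F minus the linear function with slope s, so the
  gradient of the difference vanishes there.\<close>

lemma subdifferential_gradient:
  fixes F :: "'a::euclidean_space \<Rightarrow> real"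
  assumes "F differentiable (at x)" "s \<in> subdifferential F x"
  shows "gradient F x = s"
proof -
  have "GDERIV (\<lambda>z. F z - s \<bullet> z) x :> gradient F x - s"
    unfolding gderiv_def inner_diff_right
    using GDERIV_gradient[OF assms(1)] unfolding gderiv_def
    by (auto intro!: derivative_eq_intros simp: inner_commute)
  then have "((\<lambda>z. F z - s \<bullet> z) has_derivative (\<lambda>h. h \<bullet> (gradient F x - s))) (at x)"
    by (simp only: gderiv_def)
  then have "(\<lambda>h. h \<bullet> (gradient F x - s)) = (\<lambda>h. 0)"
    by (rule differential_zero_maxmin[of x UNIV, rotated 2])
       (use assms(2) in \<open>auto simp: subdifferential_def inner_diff_right algebra_simps\<close>)
  then have "(gradient F x - s) \<bullet> (gradient F x - s) = 0" by metis
  then show ?thesis by simp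
qed

text \<open>The defining inequality at \<open>t x + (1 - t) z\<close>, divided by t, bounds a difference quotient
  of F at z in the direction x - z; let t tend to 0.\<close>

lemma strongly_convex_gradient_inequality:
  fixes F :: "'a::euclidean_space \<Rightarrow> real"
  assumes "strongly_convex c F" "F differentiable (at z)"
  shows "(x - z) \<bullet> gradient F z \<le> F x - F z - c / 2 * (norm (x - z))\<^sup>2"
proof (rule tendsto_le)
  show "((\<lambda>t. (F (z + t *\<^sub>R (x - z)) - F z) / t) \<longlongrightarrow> (x - z) \<bullet> gradient F z) (at_right 0)"
    by (rule tendsto_within_subset[OF GDERIV_directional[OF GDERIV_gradient[OF assms(2)]]]) simp
  have "((\<lambda>t. F x - F z - c / 2 * (1 - t) * (norm (x - z))\<^sup>2) \<longlongrightarrow>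
     F x - F z - c / 2 * (1 - 0) * (norm (x - z))\<^sup>2) (at_right 0)"
    by (intro tendsto_intros)
  then show "((\<lambda>t. F x - F z - c / 2 * (1 - t) * (norm (x - z))\<^sup>2) \<longlongrightarrow>
     F x - F z - c / 2 * (norm (x - z))\<^sup>2) (at_right 0)" by simp
  have "(F (z + t *\<^sub>R (x - z)) - F z) / t \<le> F x - F z - c / 2 * (1 - t) * (norm (x - z))\<^sup>2"
    if t: "0 < t" "t < 1" for t
  proof -
    have "F (t *\<^sub>R x + (1 - t) *\<^sub>R z) \<le> t * F x + (1 - t) * F z - c / 2 * t * (1 - t) * (norm (x - z))\<^sup>2"
      using assms(1) t by (auto simp: strongly_convex_def)
    moreover have "t *\<^sub>R x + (1 - t) *\<^sub>R z = z + t *\<^sub>R (x - z)" by (simp add: algebra_simps)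
    ultimately have "F (z + t *\<^sub>R (x - z)) - F z \<le> t * (F x - F z - c / 2 * (1 - t) * (norm (x - z))\<^sup>2)"
      by (simp add: algebra_simps)
    then show ?thesis using t by (simp add: divide_le_eq mult.commute)
  qed
  then show "\<forall>\<^sub>F t in at_right 0. (F (z + t *\<^sub>R (x - z)) - F z) / t \<le> F x - F z - c / 2 * (1 - t) * (norm (x - z))\<^sup>2"
    by (auto simp: eventually_at_right_field intro!: exI[of _ 1])
qed simp

lemma strongly_convex_gradient_monotone:
  fixes F :: "'a::euclidean_space \<Rightarrow> real"
  assumes sc: "strongly_convex c F" and d: "\<And>z. F differentiable (at z)"
  shows "c * (norm (x - z))\<^sup>2 \<le> (x - z) \<bullet> (gradient F x - gradient F z)"
  using strongly_convex_gradient_inequality[OF sc d, of x z]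
    strongly_convex_gradient_inequality[OF sc d, of z x]
  by (simp add: inner_diff_left inner_diff_right norm_minus_commute)

section \<open>Zeros of strongly monotone Lipschitz maps\<close>

lemma strongly_monotone_step:
  fixes a h :: "'a::real_inner"
  assumes "c * (norm a)\<^sup>2 \<le> a \<bullet> h" "norm h \<le> L * norm a" "t \<ge> 0"
  shows "(norm (a - t *\<^sub>R h))\<^sup>2 \<le> (1 - 2 * t * c + t\<^sup>2 * L\<^sup>2) * (norm a)\<^sup>2"
proof -
  have "(norm h)\<^sup>2 \<le> (L * norm a)\<^sup>2" using assms(2) by (intro power_mono) auto
  then have "t\<^sup>2 * (norm h)\<^sup>2 \<le> t\<^sup>2 * (L * norm a)\<^sup>2" by (rule mult_left_mono) simp
  moreover have "2 * t * (c * (norm a)\<^sup>2) \<le> 2 * t * (a \<bullet> h)"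
    using assms by (intro mult_left_mono) auto
  moreover have "(norm (a - t *\<^sub>R h))\<^sup>2 = (norm a)\<^sup>2 - 2 * t * (a \<bullet> h) + t\<^sup>2 * (norm h)\<^sup>2"
    unfolding power2_norm_eq_inner
    by (simp add: inner_diff_left inner_diff_right inner_commute power2_eq_square algebra_simps)
  ultimately show ?thesis by (simp add: algebra_simps power_mult_distrib)
qed

text \<open>For small t > 0 the map that sends u to \<open>u - t H u\<close> is a contraction by the previous
  lemma, and its fixed point is the zero of H.\<close>

lemma strongly_monotone_has_zero:
  fixes H :: "'a::euclidean_space \<Rightarrow> 'a"
  assumes c: "c > 0" and mono: "\<And>u v. c * (norm (u - v))\<^sup>2 \<le> (u - v) \<bullet> (H u - H v)"
    and lip: "\<And>u v. norm (H u - H v) \<le> L * norm (u - v)"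
  shows "\<exists>z. H z = 0"
proof -
  define L' where "L' = \<bar>L\<bar> + c"
  have L': "L' > 0" "c \<le> L'" "L \<le> L'" using c by (auto simp: L'_def)
  \<comment> \<open>This t minimizes the factor \<open>1 - 2 t c + t^2 L'^2\<close>; enlarging L to L' makes L' positive
    and at least c, so that the factor lies in [0, 1).\<close>
  define t where "t = c / L'\<^sup>2"
  have t: "t > 0" using c L' by (simp add: t_def)
  define q where "q = 1 - c\<^sup>2 / L'\<^sup>2"
  have "c\<^sup>2 \<le> L'\<^sup>2" using c L' by (intro power_mono) auto
  then have q: "0 \<le> q" "q < 1" using c L' by (auto simp: q_def field_simps)
  have qt: "1 - 2 * t * c + t\<^sup>2 * L'\<^sup>2 = q"
    using L' by (simp add: q_def t_def field_simps power2_eq_square)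
  have "dist (u - t *\<^sub>R H u) (v - t *\<^sub>R H v) \<le> sqrt q * dist u v" for u v
  proof -
    have "norm (H u - H v) \<le> L' * norm (u - v)"
      using lip[of u v] mult_right_mono[OF L'(3), of "norm (u - v)"] by simp
    then have "(norm ((u - v) - t *\<^sub>R (H u - H v)))\<^sup>2 \<le> q * (norm (u - v))\<^sup>2"
      using strongly_monotone_step[OF mono, of u v L' t] t qt by simp
    then have "norm ((u - v) - t *\<^sub>R (H u - H v)) \<le> sqrt (q * (norm (u - v))\<^sup>2)"
      by (rule real_le_rsqrt)
    then show ?thesis by (simp add: dist_norm real_sqrt_mult algebra_simps)
  qed
  moreover have "0 \<le> sqrt q" "sqrt q < 1" using q by auto
  ultimately obtain z where "z - t *\<^sub>R H z = z"
    using banach_fix_type[of "sqrt q" "\<lambda>u. u - t *\<^sub>R H u"] by blast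
  then show ?thesis using t by auto
qed

text \<open>Lipschitz dependence of the zero on a parameter is what makes it measurable, and of at most linear
  growth, as a function of the random parameter.\<close>

lemma strongly_monotone_zero_lipschitz:
  fixes H :: "'p::real_normed_vector \<Rightarrow> 'a::real_inner \<Rightarrow> 'a"
  assumes c: "c > 0" and mono: "\<And>p u v. c * (norm (u - v))\<^sup>2 \<le> (u - v) \<bullet> (H p u - H p v)"
    and lip: "\<And>p p' u. norm (H p u - H p' u) \<le> Lp * norm (p - p')"
    and z: "\<And>p. H p (z p) = 0"
  shows "norm (z p - z p') \<le> Lp / c * norm (p - p')"
proof (cases "z p = z p'")
  case True
  then show ?thesis using lip[of p "z p" p'] z[of p] z[of p'] c by simp
next
  case False
  let ?d = "z p - z p'"
  have "c * (norm ?d)\<^sup>2 \<le> ?d \<bullet> (H p (z p) - H p (z p'))" by (rule mono)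
  also have "\<dots> = ?d \<bullet> (H p' (z p') - H p (z p'))" by (simp add: z)
  also have "\<dots> \<le> norm ?d * norm (H p' (z p') - H p (z p'))" by (rule norm_cauchy_schwarz)
  also have "\<dots> \<le> norm ?d * (Lp * norm (p - p'))"
    using lip[of p' "z p'" p] by (intro mult_left_mono) (auto simp: norm_minus_commute)
  finally have "norm ?d * (c * norm ?d) \<le> norm ?d * (Lp * norm (p - p'))"
    by (simp add: power2_eq_square algebra_simps)
  then have "c * norm ?d \<le> Lp * norm (p - p')" using False by simp
  then show ?thesis using c by (simp add: field_simps)
qed

section \<open>Scalar recursions\<close>

text \<open>The mean square errors of a stochastic approximation scheme with steps \<open>\<gamma> / j\<close>
  satisfy such a recursion. From some index J on the factor of b(j) is at most
  \<open>1 - (1 + \<epsilon>) / j\<close> with \<open>\<epsilon> > 0\<close>, and the surplus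
  \<open>\<epsilon>\<close> is what makes a bound of the form B / j reproduce itself; a factor 1 - 1 / j
  would only give a bound of order log j / j. Before J a crude geometric bound suffices, as
  only finitely many indices are concerned.\<close>

lemma decreasing_step_recursion:
  fixes c \<gamma> m :: real
  assumes step: "2 * c * \<gamma> > 1" and m: "m \<ge> 0"
  obtains C where "C \<ge> 0" "\<And>D b T. D \<ge> 0 \<Longrightarrow> (\<And>j. (b j :: real) \<ge> 0) \<Longrightarrow> T \<ge> 1 \<Longrightarrow>
     (\<And>j. 1 \<le> j \<Longrightarrow> j < T \<Longrightarrow>
        b (Suc j) \<le> (1 - 2 * (\<gamma> / real j) * c + (\<gamma> / real j)\<^sup>2 * m) * b j + (\<gamma> / real j)\<^sup>2 * D) \<Longrightarrow>
     b T \<le> C * (b 1 + D) / real T"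
proof -
  define \<epsilon> where "\<epsilon> = (2 * c * \<gamma> - 1) / 2"
  have eps: "\<epsilon> > 0" using step by (simp add: \<epsilon>_def)
  obtain J :: nat where J: "real J \<ge> 1 + \<epsilon> + \<gamma>\<^sup>2 * m / \<epsilon>" "J \<ge> 1"
  proof -
    obtain n :: nat where "real n \<ge> 1 + \<epsilon> + \<gamma>\<^sup>2 * m / \<epsilon>" using real_arch_simple by blast
    then show ?thesis using that[of "max n 1"] by auto
  qed
  define q where "q = 1 + 2 * \<bar>\<gamma>\<bar> * \<bar>c\<bar> + \<gamma>\<^sup>2 * m + \<gamma>\<^sup>2"
  have q: "q \<ge> 1" using m by (simp add: q_def)
  define C where "C = real J * q ^ J + \<gamma>\<^sup>2 / \<epsilon>"
  have C0: "C \<ge> 0" using q eps by (simp add: C_def)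
  have main: "b T \<le> C * (b 1 + D) / real T"
    if D: "D \<ge> 0" and b: "\<And>j. b j \<ge> 0" and T: "T \<ge> 1"
      and rec: "\<And>j. 1 \<le> j \<Longrightarrow> j < T \<Longrightarrow>
        b (Suc j) \<le> (1 - 2 * (\<gamma> / real j) * c + (\<gamma> / real j)\<^sup>2 * m) * b j + (\<gamma> / real j)\<^sup>2 * D"
    for D T and b :: "nat \<Rightarrow> real"
  proof -
    have bD: "b 1 + D \<ge> 0" using D b[of 1] by simp
    have crude: "b j + D \<le> q ^ j * (b 1 + D)" if "1 \<le> j" "j \<le> T" for j
      using that
    proof (induction j rule: nat_induct_at_least)
      case base
      then show ?case using q bD mult_right_mono[of 1 q "b 1 + D"] by simp
    next
      case (Suc n)
      have n: "1 \<le> n" "n < T" using Suc by auto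
      have g: "(\<gamma> / real n)\<^sup>2 \<le> \<gamma>\<^sup>2"
      proof -
        have "\<bar>\<gamma> / real n\<bar> \<le> \<bar>\<gamma>\<bar>" using n mult_left_mono[of 1 "real n" "\<bar>\<gamma>\<bar>"] by (simp add: field_simps)
        then show ?thesis by (simp only: abs_le_square_iff)
      qed
      have "2 * (\<gamma> / real n) * c \<ge> - (2 * \<bar>\<gamma>\<bar> * \<bar>c\<bar>)"
      proof -
        have "\<bar>2 * (\<gamma> / real n) * c\<bar> = 2 * (\<bar>\<gamma>\<bar> / real n) * \<bar>c\<bar>"
          by (simp add: abs_mult)
        also have "\<dots> \<le> 2 * \<bar>\<gamma>\<bar> * \<bar>c\<bar>"
          using n mult_left_mono[of 1 "real n" "\<bar>\<gamma>\<bar>"]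
          by (intro mult_right_mono mult_left_mono) (auto simp: field_simps)
        finally show ?thesis by linarith
      qed
      then have "1 - 2 * (\<gamma> / real n) * c + (\<gamma> / real n)\<^sup>2 * m \<le> q - \<gamma>\<^sup>2"
        using mult_right_mono[OF g m] by (simp add: q_def)
      then have "b (Suc n) + D \<le> (q - \<gamma>\<^sup>2) * b n + \<gamma>\<^sup>2 * D + D"
        using rec[OF n] mult_right_mono[OF _ b[of n]] mult_right_mono[OF g D]
        by (smt (verit))
      also have "\<dots> \<le> q * (b n + D)"
        using D b[of n] m by (auto simp: q_def algebra_simps intro!: add_nonneg_nonneg mult_nonneg_nonneg)
      also have "\<dots> \<le> q * (q ^ n * (b 1 + D))" using Suc n q by (intro mult_left_mono) auto
      finally show ?case by (simp add: mult.assoc)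
    qed
    have CJ: "real J * (q ^ J * (b 1 + D)) \<le> C * (b 1 + D)"
    proof -
      have "0 \<le> \<gamma>\<^sup>2 / \<epsilon> * (b 1 + D)" using bD eps by simp
      then show ?thesis by (simp add: C_def algebra_simps)
    qed
    have "b j \<le> C * (b 1 + D) / real j" if "1 \<le> j" "j \<le> T" for j
    proof (cases "j \<le> J")
      case True
      have "real j * b j \<le> real J * (q ^ J * (b 1 + D))"
      proof (rule mult_mono)
        have "b j \<le> q ^ j * (b 1 + D)" using crude[OF that] D by simp
        also have "\<dots> \<le> q ^ J * (b 1 + D)"
          using True q bD by (intro mult_right_mono power_increasing) auto
        finally show "b j \<le> q ^ J * (b 1 + D)" .
      qed (use True b in auto)
      also note CJ
      finally show ?thesis using that by (simp add: field_simps)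
    next
      case False
      then have "J \<le> j" by simp
      then show ?thesis using that(2)
      proof (induction j rule: dec_induct)
        case base
        have "real J * b J \<le> real J * (q ^ J * (b 1 + D))"
          using crude[of J] base J D by (intro mult_left_mono) auto
        also note CJ
        finally show ?case using J by (simp add: field_simps)
      next
        case (step n)
        have n: "1 \<le> n" "n < T" "J \<le> n" using step J by auto
        define r where "r = real n"
        have r: "r \<ge> 1" "r \<ge> 1 + \<epsilon> + \<gamma>\<^sup>2 * m / \<epsilon>" using n J by (auto simp: r_def)
        have "\<gamma>\<^sup>2 * m / \<epsilon> \<le> r" using r eps by simp
        \<comment> \<open>The choice of J: the second-order term costs at most half of the excess of 2 c \<open>\<gamma>\<close> over 1.\<close>
        then have gm: "\<gamma>\<^sup>2 * m / r \<le> \<epsilon>" using r eps by (simp add: field_simps)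
        have fac: "1 - 2 * (\<gamma> / r) * c + (\<gamma> / r)\<^sup>2 * m \<le> 1 - (1 + \<epsilon>) / r"
        proof -
          have "(\<gamma> / r)\<^sup>2 * m = (\<gamma>\<^sup>2 * m / r) / r" by (simp add: power2_eq_square)
          also have "\<dots> \<le> \<epsilon> / r" using gm r by (intro divide_right_mono) auto
          finally have "(\<gamma> / r)\<^sup>2 * m \<le> \<epsilon> / r" .
          moreover have "2 * (\<gamma> / r) * c = (1 + \<epsilon>) / r + \<epsilon> / r"
          proof -
            have "2 * (\<gamma> / r) * c = (2 * c * \<gamma>) / r" by simp
            also have "2 * c * \<gamma> = (1 + \<epsilon>) + \<epsilon>" by (simp add: \<epsilon>_def)
            finally show ?thesis by (simp only: add_divide_distrib)
          qed
          ultimately show ?thesis by linarith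
        qed
        have fac0: "1 - (1 + \<epsilon>) / r \<ge> 0"
        proof -
          have "\<gamma>\<^sup>2 * m / \<epsilon> \<ge> 0" using m eps by simp
          then show ?thesis using r by (simp add: field_simps)
        qed
        define B where "B = C * (b 1 + D)"
        have BD: "\<gamma>\<^sup>2 * D \<le> \<epsilon> * B"
        proof -
          have "\<gamma>\<^sup>2 * D = \<epsilon> * (\<gamma>\<^sup>2 / \<epsilon>) * D" using eps by simp
          also have "\<dots> \<le> \<epsilon> * C * D"
            using eps D q by (intro mult_right_mono mult_left_mono) (auto simp: C_def)
          also have "\<dots> \<le> \<epsilon> * B"
            using eps C0 D b[of 1] by (auto simp: B_def algebra_simps)
          finally show ?thesis .
        qed
        have B0: "B \<ge> 0" using C0 bD by (simp add: B_def)
        have "b (Suc n) \<le> (1 - (1 + \<epsilon>) / r) * b n + (\<gamma> / r)\<^sup>2 * D"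
          using rec[OF n(1,2)] mult_right_mono[OF fac b[of n]] by (simp add: r_def)
        also have "\<dots> \<le> (1 - (1 + \<epsilon>) / r) * (B / r) + (\<gamma> / r)\<^sup>2 * D"
          using step n fac0 by (intro add_right_mono mult_left_mono) (auto simp: r_def B_def)
        also have "\<dots> \<le> (1 - (1 + \<epsilon>) / r) * (B / r) + \<epsilon> * B / r\<^sup>2"
          using divide_right_mono[OF BD, of "r\<^sup>2"] by (simp add: power_divide)
        also have "\<dots> = B * (r - 1) / r\<^sup>2"
          using r by (simp add: field_simps power2_eq_square)
        also have "\<dots> \<le> B / (r + 1)"
        proof -
          have "B * ((r - 1) * (r + 1)) \<le> B * r\<^sup>2"
            using B0 by (intro mult_left_mono) (auto simp: algebra_simps power2_eq_square)
          then show ?thesis using r by (simp add: field_simps)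
        qed
        finally show ?case by (simp add: r_def B_def add.commute)
      qed
    qed
    then show ?thesis using T by simp
  qed
  show ?thesis by (rule that[OF C0 main])
qed

text \<open>Eventually q + e(k) is below some q' < 1. Summing the recursion then bounds every partial sum of d
  by q' times itself plus a constant.\<close>

lemma summable_perturbed_contraction:
  fixes d e :: "nat \<Rightarrow> real"
  assumes d: "\<And>k. d k \<ge> 0" and e: "\<And>k. e k \<ge> 0" "summable e" and q: "q < 1"
    and rec: "\<And>k. d (Suc k) \<le> q * d k + e k * (1 + d k)"
  shows "summable d"
proof -
  define q' where "q' = (max q 0 + 1) / 2"
  have q': "q < q'" "0 < q'" "q' < 1" using q by (auto simp: q'_def)
  have "e \<longlonglongrightarrow> 0" by (rule summable_LIMSEQ_zero[OF e(2)])
  then have "\<forall>\<^sub>F k in sequentially. e k < q' - q"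
    by (rule order_tendstoD) (use q' in auto)
  then obtain N where N: "\<And>k. k \<ge> N \<Longrightarrow> e k < q' - q" by (auto simp: eventually_sequentially)
  have rec': "d (Suc k) \<le> q' * d k + e k" if "k \<ge> N" for k
    using rec[of k] mult_right_mono[of "q + e k" q' "d k"] N[OF that] d[of k]
    by (simp add: algebra_simps)
  define B where "B = (d N + suminf e) / (1 - q')"
  have "(\<Sum>k<n. d (k + N)) \<le> B" for n
  proof -
    have E: "(\<Sum>k<n. e (k + N)) \<le> suminf e"
    proof -
      have "(\<Sum>k<n. e (k + N)) = sum e ((\<lambda>k. k + N) ` {..<n})"
        by (subst sum.reindex) (auto simp: inj_on_def)
      also have "\<dots> \<le> suminf e" using e by (intro sum_le_suminf) auto
      finally show ?thesis .
    qed
    have "(\<Sum>k<n. d (k + N)) \<le> (\<Sum>k<Suc n. d (k + N))" using d by simp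
    also have "\<dots> = d N + (\<Sum>k<n. d (Suc (k + N)))"
      by (subst sum.lessThan_Suc_shift) simp
    also have "\<dots> \<le> d N + (\<Sum>k<n. q' * d (k + N) + e (k + N))"
      by (intro add_left_mono sum_mono rec') simp
    also have "\<dots> \<le> d N + q' * (\<Sum>k<n. d (k + N)) + suminf e"
      using E by (simp add: sum.distrib sum_distrib_left)
    finally show ?thesis using q' by (simp add: B_def field_simps)
  qed
  then have "summable (\<lambda>k. d (k + N))"
    by (intro summableI_nonneg_bounded[where x=B]) (auto simp: d)
  then show ?thesis by (simp add: summable_iff_shift)
qed

section \<open>Contraction of an inexact step\<close>

text \<open>The quadratic form attains a positive minimum on the compact unit sphere and is homogeneous of
  degree two.\<close>

lemma positive_form_lower_bound:
  fixes G :: "'a::euclidean_space \<Rightarrow> 'a"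
  assumes "linear G" "\<And>z. z \<noteq> 0 \<Longrightarrow> z \<bullet> G z > 0"
  obtains m where "m > 0" "\<And>z. m * (norm z)\<^sup>2 \<le> z \<bullet> G z"
proof -
  have cont: "continuous_on S G" for S
    using assms(1) by (simp add: linear_continuous_on linear_conv_bounded_linear)
  have "\<exists>u\<in>sphere 0 1. \<forall>v\<in>sphere 0 1. u \<bullet> G u \<le> v \<bullet> G (v::'a)"
  proof (rule continuous_attains_inf)
    obtain w :: 'a where "w \<in> Basis" using nonempty_Basis by blast
    then show "sphere (0::'a) 1 \<noteq> {}" by (auto intro!: exI[of _ w])
  qed (auto intro!: continuous_intros cont)
  then obtain u :: 'a where u: "norm u = 1" "\<And>v. norm v = 1 \<Longrightarrow> u \<bullet> G u \<le> v \<bullet> G v"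
    by (auto simp: dist_norm)
  have "(u \<bullet> G u) * (norm z)\<^sup>2 \<le> z \<bullet> G z" for z
  proof (cases "z = 0")
    case True
    then show ?thesis using assms(1) by (simp add: linear_0)
  next
    case False
    let ?v = "(1 / norm z) *\<^sub>R z"
    have "G ?v = (1 / norm z) *\<^sub>R G z" using assms(1) by (rule linear_scale)
    then have eq: "?v \<bullet> G ?v = (z \<bullet> G z) / (norm z)\<^sup>2" by (simp add: power2_eq_square)
    have "u \<bullet> G u \<le> ?v \<bullet> G ?v" using False by (intro u) simp
    then have "u \<bullet> G u \<le> (z \<bullet> G z) / (norm z)\<^sup>2" unfolding eq .
    then show ?thesis using False by (simp add: field_simps)
  qed
  moreover have "u \<bullet> G u > 0" using u by (intro assms) auto
  ultimately show ?thesis using that by blast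
qed

lemma linear_form_upper_bound:
  fixes G :: "'a::euclidean_space \<Rightarrow> 'a"
  assumes "linear G"
  obtains K where "K > 0" "\<And>z. z \<bullet> G z \<le> K * (norm z)\<^sup>2"
proof -
  obtain K where K: "K > 0" "\<And>z. norm (G z) \<le> norm z * K"
    using assms bounded_linear.pos_bounded[of G] by (auto simp: linear_conv_bounded_linear)
  have "z \<bullet> G z \<le> K * (norm z)\<^sup>2" for z
  proof -
    have "z \<bullet> G z \<le> norm z * norm (G z)" by (rule norm_cauchy_schwarz)
    also have "\<dots> \<le> norm z * (norm z * K)" by (intro mult_left_mono K) simp
    finally show ?thesis by (simp add: power2_eq_square mult_ac)
  qed
  with K(1) show ?thesis using that by blast
qed

lemma matrix_norm_bound:
  fixes A :: "real^'n^'m"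
  obtains K where "K > 0" "\<And>z. (norm (A *v z))\<^sup>2 \<le> K * (norm z)\<^sup>2"
proof -
  obtain K where K: "K > 0" "\<And>z. norm (A *v z) \<le> norm z * K"
    using bounded_linear.pos_bounded[OF matrix_vector_mul_bounded_linear[of A]] by blast
  have "(norm (A *v z))\<^sup>2 \<le> K\<^sup>2 * (norm z)\<^sup>2" for z
    using power_mono[OF K(2)[of z], of 2] by (simp add: power_mult_distrib mult.commute)
  with K(1) show ?thesis using that[of "K\<^sup>2"] by simp
qed

lemma norm_sum_sq_le:
  fixes u v :: "'a::real_inner"
  shows "(norm (u + v))\<^sup>2 \<le> 2 * (norm u)\<^sup>2 + 2 * (norm v)\<^sup>2"
proof -
  have "0 \<le> (norm (u - v))\<^sup>2" by simp
  then show ?thesis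
    unfolding power2_norm_eq_inner by (simp add: inner_add inner_diff inner_commute)
qed

lemma norm_diff_sq_le:
  fixes u v :: "'a::real_inner"
  shows "(norm (u - v))\<^sup>2 \<le> 2 * (norm u)\<^sup>2 + 2 * (norm v)\<^sup>2"
  using norm_sum_sq_le[of u "- v"] by simp

lemma inner_le_weighted_squares:
  fixes u v :: "'a::real_inner"
  assumes "t > 0"
  shows "2 * (u \<bullet> v) \<le> t * (norm u)\<^sup>2 + (norm v)\<^sup>2 / t"
proof -
  have "0 \<le> t * (norm (u - (1 / t) *\<^sub>R v))\<^sup>2" using assms by simp
  also have "\<dots> = t * (norm u)\<^sup>2 + (norm v)\<^sup>2 / t - 2 * (u \<bullet> v)"
    using assms unfolding power2_norm_eq_inner
    by (simp add: inner_diff inner_commute field_simps)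
  finally show ?thesis by simp
qed

lemma inner_transpose:
  fixes A :: "real^'n^'m"
  shows "u \<bullet> (transpose A *v v) = (A *v u) \<bullet> v" "u \<bullet> (v v* A) = (A *v u) \<bullet> v"
  by (metis dot_lmul_matrix inner_commute transpose_matrix_vector)+

lemma P_hat_mult: "P_hat \<rho> A P *v z = P *v z + \<rho> *\<^sub>R (transpose A *v (A *v z))"
  unfolding P_hat_def
  by (simp add: matrix_vector_mult_add_rdistrib scaleR_matrix_vector_assoc matrix_vector_mul_assoc)

lemma wnorm2_G_op:
  "wnorm2 (G_op \<rho> \<gamma> A P Q) (x, y, l) =
     x \<bullet> (P_hat \<rho> A P *v x) + y \<bullet> (Q *v y) + (l \<bullet> l) / (\<rho> * \<gamma>)"
  by (simp add: wnorm2_def G_op_def block_diag3_def scaleR_matrix_vector_assoc[symmetric])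

lemma linear_G_op: "linear (G_op \<rho> \<gamma> A P Q)"
  by (rule linearI)
     (auto simp: G_op_def block_diag3_def matrix_vector_right_distrib matrix_vector_mult_scaleR
        scaleR_matrix_vector_assoc[symmetric] algebra_simps)

text \<open>Full row rank makes the transpose of [A B] injective, so the squared norm of its value at v, which is
  the right-hand side, is a positive definite quadratic form of v.\<close>

lemma hcat_full_row_rank_bound:
  fixes A :: "real^'n^'p" and B :: "real^'m^'p"
  assumes "rank (hcat A B) = CARD('p)"
  obtains \<kappa> where "\<kappa> > 0"
    "\<And>v. \<kappa> * (norm v)\<^sup>2 \<le> (norm (transpose A *v v))\<^sup>2 + (norm (transpose B *v v))\<^sup>2"
proof -
  have inj: "inj ((*v) (transpose (hcat A B)))"
    using assms by (simp add: full_rank_injective[symmetric] rank_transpose)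
  have cols: "(transpose (hcat A B) *v v) $ Inl i = (transpose A *v v) $ i"
    "(transpose (hcat A B) *v v) $ Inr j = (transpose B *v v) $ j" for v i j
    by (simp_all add: matrix_vector_mult_def transpose_def hcat_def)
  define G where "G v = A *v (transpose A *v v) + B *v (transpose B *v v)" for v :: "real^'p"
  have "linear G"
    by (rule linearI)
      (auto simp: G_def matrix_vector_right_distrib matrix_vector_mult_scaleR algebra_simps)
  have form: "v \<bullet> G v = (norm (transpose A *v v))\<^sup>2 + (norm (transpose B *v v))\<^sup>2" for v
    using inner_transpose(1)[of "transpose A *v v" A v] inner_transpose(1)[of "transpose B *v v" B v]
    by (simp add: G_def power2_norm_eq_inner inner_add_right inner_commute)
  have "v \<bullet> G v > 0" if "v \<noteq> 0" for v
  proof (rule ccontr)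
    assume "\<not> v \<bullet> G v > 0"
    then have "(norm (transpose A *v v))\<^sup>2 + (norm (transpose B *v v))\<^sup>2 \<le> 0"
      by (simp only: form not_less)
    then have "transpose A *v v = 0" "transpose B *v v = 0"
      by (auto simp: sum_power2_le_zero_iff)
    then have "transpose (hcat A B) *v v = transpose (hcat A B) *v 0"
      unfolding vec_eq_iff using cols[of v] by (metis matrix_vector_mult_0_right old.sum.exhaust zero_index)
    then show False using inj that by (simp only: inj_eq)
  qed
  from positive_form_lower_bound[OF \<open>linear G\<close> this] show ?thesis
    using that unfolding form by blast
qed

text \<open>The optimality conditions at the new point, minus those at the KKT point, are tested with the
  primal errors and added; monotonicity of the gradients bounds the result from below. The terms
  that involve the steps x' - x and y' - y and the multiplier update are then rewritten by the
  polarization identity as differences of squared norms. The x-block carries the matrix P + rho A^T A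
  rather than P because the y-block is solved with the old x: replacing A x by A x' there leaves
  the cross term between B (y' - ys) and A (x' - x), which B (y' - ys) = r - A (x' - xs) splits into the
  missing part of that norm and the term with r on the left-hand side.\<close>

lemma admm_energy_inequality:
  fixes A :: "real^'n^'p" and B :: "real^'m^'p" and F :: "real^'n \<Rightarrow> real^'n" and G :: "real^'m \<Rightarrow> real^'m"
  assumes pos: "\<rho> > 0" "\<gamma> > 0"
    and symm: "transpose (P_hat \<rho> A P) = P_hat \<rho> A P" "transpose Q = Q"
    and F: "\<And>u v. \<mu> * (norm (u - v))\<^sup>2 \<le> (u - v) \<bullet> (F u - F v)"
    and G: "\<And>u v. \<sigma> * (norm (u - v))\<^sup>2 \<le> (u - v) \<bullet> (G u - G v)"
    and opt: "F xs = transpose A *v ls" "G ys = transpose B *v ls" "A *v xs + B *v ys = b"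
    and r: "r = A *v x' + B *v y' - b"
    and ex: "ex = F x' - transpose A *v l + \<rho> *\<^sub>R (transpose A *v r) + P *v (x' - x)"
    and ey: "ey = G y' - transpose B *v l + \<rho> *\<^sub>R (transpose B *v (A *v x + B *v y' - b)) + Q *v (y' - y)"
    and l': "l' = l - (\<gamma> * \<rho>) *\<^sub>R r"
  shows "2 * \<mu> * (norm (x' - xs))\<^sup>2 + 2 * \<sigma> * (norm (y' - ys))\<^sup>2
      + (x' - x) \<bullet> (P_hat \<rho> A P *v (x' - x)) + (y' - y) \<bullet> (Q *v (y' - y))
      + (2 - \<gamma>) * \<rho> * (norm r)\<^sup>2 - 2 * \<rho> * (r \<bullet> (A *v (x' - x)))
    \<le> wnorm2 (G_op \<rho> \<gamma> A P Q) ((x, y, l) - (xs, ys, ls))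
      - wnorm2 (G_op \<rho> \<gamma> A P Q) ((x', y', l') - (xs, ys, ls))
      + 2 * ((x' - xs) \<bullet> ex) + 2 * ((y' - ys) \<bullet> ey)"
proof -
  define dx dy le p s where "dx = x' - xs" and "dy = y' - ys" and "le = l - ls"
    and "p = x' - x" and "s = y' - y"
  let ?P = "P_hat \<rho> A P"
  have r': "r = A *v dx + B *v dy"
    by (simp add: r dx_def dy_def opt(3)[symmetric] matrix_vector_mult_diff_distrib)
  have Fd: "F x' - F xs = transpose A *v le - \<rho> *\<^sub>R (transpose A *v r) - P *v p + ex"
    by (simp add: ex opt le_def p_def matrix_vector_mult_diff_distrib algebra_simps)
  have "A *v x + B *v y' - b = r - A *v p"
    by (simp add: r p_def matrix_vector_mult_diff_distrib)
  then have ey': "ey = G y' - transpose B *v l + \<rho> *\<^sub>R (transpose B *v (r - A *v p)) + Q *v s"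
    by (simp only: ey s_def)
  have Gd: "G y' - G ys = transpose B *v le - \<rho> *\<^sub>R (transpose B *v r)
      + \<rho> *\<^sub>R (transpose B *v (A *v p)) - Q *v s + ey"
    by (simp add: ey' opt le_def matrix_vector_mult_diff_distrib algebra_simps)
  have Pp: "dx \<bullet> (?P *v p) = dx \<bullet> (P *v p) + \<rho> * ((A *v dx) \<bullet> (A *v p))"
    by (simp add: P_hat_mult inner_add_right inner_transpose)
  have 1: "\<mu> * (norm dx)\<^sup>2 \<le> (A *v dx) \<bullet> le - \<rho> * ((A *v dx) \<bullet> r) - dx \<bullet> (P *v p) + dx \<bullet> ex"
    using F[of x' xs] unfolding Fd
    by (simp add: dx_def[symmetric] inner_add_right inner_diff_right inner_transpose)
  have 2: "\<sigma> * (norm dy)\<^sup>2 \<le> (B *v dy) \<bullet> le - \<rho> * ((B *v dy) \<bullet> r)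
      + \<rho> * ((B *v dy) \<bullet> (A *v p)) - dy \<bullet> (Q *v s) + dy \<bullet> ey"
    using G[of y' ys] unfolding Gd
    by (simp add: dy_def[symmetric] inner_add_right inner_diff_right inner_transpose)
  have rl: "r \<bullet> v = (A *v dx) \<bullet> v + (B *v dy) \<bullet> v" for v by (simp add: r' inner_add_left)
  have main: "\<mu> * (norm dx)\<^sup>2 + \<sigma> * (norm dy)\<^sup>2 \<le> r \<bullet> le - \<rho> * (r \<bullet> r) + \<rho> * (r \<bullet> (A *v p))
      - dx \<bullet> (?P *v p) - dy \<bullet> (Q *v s) + dx \<bullet> ex + dy \<bullet> ey"
    using 1 2 unfolding Pp rl[of le] rl[of r] rl[of "A *v p"] by (simp add: algebra_simps)
  have sw: "v \<bullet> (?P *v u) = u \<bullet> (?P *v v)" for u v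
    using inner_transpose(1)[of v ?P u] by (simp add: symm inner_commute)
  have sq: "v \<bullet> (Q *v u) = u \<bullet> (Q *v v)" for u v
    using inner_transpose(1)[of v Q u] by (simp add: symm inner_commute)
  have old: "(x, y, l) - (xs, ys, ls) = (dx - p, dy - s, le)"
    by (simp add: dx_def dy_def p_def s_def le_def)
  have new: "(x', y', l') - (xs, ys, ls) = (dx, dy, le - (\<gamma> * \<rho>) *\<^sub>R r)"
    by (simp add: dx_def dy_def le_def l')
  have dual: "(le \<bullet> le) / (\<rho> * \<gamma>) - ((le - (\<gamma> * \<rho>) *\<^sub>R r) \<bullet> (le - (\<gamma> * \<rho>) *\<^sub>R r)) / (\<rho> * \<gamma>)
      = 2 * (r \<bullet> le) - \<gamma> * \<rho> * (r \<bullet> r)"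
    using pos by (simp add: inner_diff inner_commute field_simps)
  have "wnorm2 (G_op \<rho> \<gamma> A P Q) (dx - p, dy - s, le)
      - wnorm2 (G_op \<rho> \<gamma> A P Q) (dx, dy, le - (\<gamma> * \<rho>) *\<^sub>R r)
      = - 2 * (dx \<bullet> (?P *v p)) + p \<bullet> (?P *v p) - 2 * (dy \<bullet> (Q *v s)) + s \<bullet> (Q *v s)
        + (2 * (r \<bullet> le) - \<gamma> * \<rho> * (r \<bullet> r))"
    unfolding wnorm2_G_op dual[symmetric]
    by (simp add: matrix_vector_mult_diff_distrib inner_diff_left inner_diff_right sw[of dx p] sq[of dy s])
  then show ?thesis using main
    unfolding old new dx_def[symmetric] dy_def[symmetric] p_def[symmetric] s_def[symmetric]
    by (simp add: power2_norm_eq_inner[of r] algebra_simps)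
qed

text \<open>Completing the square in r shows that the form on the right-hand side is nonnegative. A second,
  cruder estimate bounds it below by a multiple of |p|^2 minus a large multiple of |r|^2. Scaling
  the second estimate by a small factor, which nonnegativity permits, makes the coefficient of |r|^2
  as small as desired. The comparison of the matrices enters only through
  the nonnegativity, where equality is harmless: this covers P = 0 with \<open>\<gamma> = 1\<close>.\<close>

lemma step_form_lower_bound:
  fixes A :: "real^'n^'p" and H :: "real^'n^'n"
  assumes pos: "\<rho> > 0" "\<gamma> < 2" and m: "m > 0" "\<And>z. m * (norm z)\<^sup>2 \<le> z \<bullet> (H *v z)"
    and dom: "\<And>z. \<rho> * (norm (A *v z))\<^sup>2 \<le> (2 - \<gamma>) * (z \<bullet> (H *v z))"
    and \<nu>: "\<nu> > 0"
  obtains \<theta> where "\<theta> > 0"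
    "\<And>p r. \<theta> * (norm p)\<^sup>2 - \<nu> * (norm r)\<^sup>2
        \<le> p \<bullet> (H *v p) + (2 - \<gamma>) * \<rho> * (norm r)\<^sup>2 - 2 * \<rho> * (r \<bullet> (A *v p))"
proof -
  obtain KA where KA: "KA > 0" "\<And>z. (norm (A *v z))\<^sup>2 \<le> KA * (norm z)\<^sup>2"
    using matrix_norm_bound by blast
  define C where "C = 2 * \<rho>\<^sup>2 * KA / m"
  have C: "C > 0" using pos KA m by (simp add: C_def)
  define t where "t = min 1 (\<nu> / C)"
  have t: "0 < t" "t \<le> 1" "t * C \<le> \<nu>" using C \<nu> by (auto simp: t_def min_def field_simps)
  have "t * (m / 2) * (norm p)\<^sup>2 - \<nu> * (norm r)\<^sup>2
        \<le> p \<bullet> (H *v p) + (2 - \<gamma>) * \<rho> * (norm r)\<^sup>2 - 2 * \<rho> * (r \<bullet> (A *v p))" for p r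
  proof -
    define E where "E = p \<bullet> (H *v p) + (2 - \<gamma>) * \<rho> * (norm r)\<^sup>2 - 2 * \<rho> * (r \<bullet> (A *v p))"
    have nonneg: "0 \<le> E"
    proof -
      have "2 * (r \<bullet> (A *v p)) \<le> (2 - \<gamma>) * (norm r)\<^sup>2 + (norm (A *v p))\<^sup>2 / (2 - \<gamma>)"
        using pos by (intro inner_le_weighted_squares) simp
      then have "\<rho> * (2 * (r \<bullet> (A *v p))) \<le> \<rho> * ((2 - \<gamma>) * (norm r)\<^sup>2 + (norm (A *v p))\<^sup>2 / (2 - \<gamma>))"
        using pos by (intro mult_left_mono) auto
      moreover have "\<rho> * ((norm (A *v p))\<^sup>2 / (2 - \<gamma>)) \<le> p \<bullet> (H *v p)"
        using dom[of p] pos by (simp add: field_simps)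
      ultimately show ?thesis by (simp add: E_def algebra_simps)
    qed
    have "m / 2 * (norm p)\<^sup>2 - C * (norm r)\<^sup>2 \<le> E"
    proof -
      define k where "k = m / (2 * \<rho> * KA)"
      have k: "k > 0" using m pos KA by (simp add: k_def)
      have "2 * ((A *v p) \<bullet> r) \<le> k * (norm (A *v p))\<^sup>2 + (norm r)\<^sup>2 / k"
        by (rule inner_le_weighted_squares[OF k])
      also have "\<dots> \<le> k * (KA * (norm p)\<^sup>2) + (norm r)\<^sup>2 / k"
        using k by (intro add_right_mono mult_left_mono KA) auto
      finally have "\<rho> * (2 * ((A *v p) \<bullet> r)) \<le> \<rho> * (k * (KA * (norm p)\<^sup>2) + (norm r)\<^sup>2 / k)"
        using pos by (intro mult_left_mono) auto
      also have "\<dots> = m / 2 * (norm p)\<^sup>2 + C * (norm r)\<^sup>2"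
        using pos KA m by (simp add: k_def C_def field_simps power2_eq_square)
      finally have "2 * \<rho> * (r \<bullet> (A *v p)) \<le> m / 2 * (norm p)\<^sup>2 + C * (norm r)\<^sup>2"
        by (simp add: inner_commute)
      moreover have "0 \<le> (2 - \<gamma>) * \<rho> * (norm r)\<^sup>2" using pos by simp
      ultimately show ?thesis using m(2)[of p] by (simp add: E_def)
    qed
    then have "t * (m / 2 * (norm p)\<^sup>2 - C * (norm r)\<^sup>2) \<le> t * E"
      using t by (intro mult_left_mono) auto
    also have "\<dots> \<le> E" using t nonneg by (simp add: mult_left_le_one_le)
    finally have "t * (m / 2) * (norm p)\<^sup>2 - t * C * (norm r)\<^sup>2 \<le> E" by (simp add: algebra_simps)
    moreover have "t * C * (norm r)\<^sup>2 \<le> \<nu> * (norm r)\<^sup>2" using t by (intro mult_right_mono) auto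
    ultimately show ?thesis by (simp add: E_def)
  qed
  then show ?thesis using that[of "t * (m / 2)"] t m by auto
qed

text \<open>Up to a multiple of the constraint residual r, the error of the new multiplier is mapped by the
  transposes of A and B to differences of gradients plus terms in the steps and residuals. The full
  row rank recovers the error from these two images.\<close>

lemma admm_multiplier_bound:
  fixes A :: "real^'n^'p" and B :: "real^'m^'p" and F :: "real^'n \<Rightarrow> real^'n" and G :: "real^'m \<Rightarrow> real^'m"
  assumes F: "\<And>u v. norm (F u - F v) \<le> Lf * norm (u - v)"
    and G: "\<And>u v. norm (G u - G v) \<le> Lg * norm (u - v)"
    and rank: "rank (hcat A B) = CARD('p)"
    and opt: "F xs = transpose A *v ls" "G ys = transpose B *v ls" "A *v xs + B *v ys = b"
  obtains C where "C > 0" "\<And>x y l x' y' l' r ex ey.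
     r = A *v x' + B *v y' - b \<Longrightarrow>
     ex = F x' - transpose A *v l + \<rho> *\<^sub>R (transpose A *v r) + P *v (x' - x) \<Longrightarrow>
     ey = G y' - transpose B *v l + \<rho> *\<^sub>R (transpose B *v (A *v x + B *v y' - b)) + Q *v (y' - y) \<Longrightarrow>
     l' = l - (\<gamma> * \<rho>) *\<^sub>R r \<Longrightarrow>
     (norm (l' - ls))\<^sup>2 \<le> C * ((norm (x' - xs))\<^sup>2 + (norm (y' - ys))\<^sup>2
        + (norm (x' - x))\<^sup>2 + (norm (y' - y))\<^sup>2 + (norm ex)\<^sup>2 + (norm ey)\<^sup>2)"
proof -
  obtain \<kappa> where \<kappa>: "\<kappa> > 0"
    "\<And>v. \<kappa> * (norm v)\<^sup>2 \<le> (norm (transpose A *v v))\<^sup>2 + (norm (transpose B *v v))\<^sup>2"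
    using hcat_full_row_rank_bound[OF rank] by blast
  obtain KA where KA: "KA > 0" "\<And>z. (norm (A *v z))\<^sup>2 \<le> KA * (norm z)\<^sup>2"
    using matrix_norm_bound by blast
  obtain KB where KB: "KB > 0" "\<And>z. (norm (B *v z))\<^sup>2 \<le> KB * (norm z)\<^sup>2"
    using matrix_norm_bound by blast
  obtain KT where KT: "KT > 0" "\<And>z. (norm (transpose B *v z))\<^sup>2 \<le> KT * (norm z)\<^sup>2"
    using matrix_norm_bound by blast
  obtain KP where KP: "KP > 0" "\<And>z. (norm (P *v z))\<^sup>2 \<le> KP * (norm z)\<^sup>2"
    using matrix_norm_bound by blast
  obtain KQ where KQ: "KQ > 0" "\<And>z. (norm (Q *v z))\<^sup>2 \<le> KQ * (norm z)\<^sup>2"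
    using matrix_norm_bound by blast
  define k where "k = ((1 - \<gamma>) * \<rho>)\<^sup>2"
  have k: "k \<ge> 0" by (simp add: k_def)
  define W where "W = 1 + Lf\<^sup>2 + Lg\<^sup>2 + KP + \<rho>\<^sup>2 * KT * KA + KQ"
  have nn: "0 \<le> \<rho>\<^sup>2 * KT * KA" using KT KA by simp
  have W: "W \<ge> 1" "Lf\<^sup>2 \<le> W" "Lg\<^sup>2 \<le> W" "KP + \<rho>\<^sup>2 * KT * KA \<le> W" "KQ \<le> W"
    using KP KQ nn by (auto simp: W_def)
  define C where "C = 2 * (4 * W / \<kappa>) + 2 * k * (2 * KA + 2 * KB)"
  have "C > 0" using W \<kappa> k KA KB by (simp add: C_def add_pos_nonneg)
  moreover have "(norm (l' - ls))\<^sup>2 \<le> C * ((norm (x' - xs))\<^sup>2 + (norm (y' - ys))\<^sup>2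
        + (norm (x' - x))\<^sup>2 + (norm (y' - y))\<^sup>2 + (norm ex)\<^sup>2 + (norm ey)\<^sup>2)"
    if r: "r = A *v x' + B *v y' - b"
      and ex: "ex = F x' - transpose A *v l + \<rho> *\<^sub>R (transpose A *v r) + P *v (x' - x)"
      and ey: "ey = G y' - transpose B *v l + \<rho> *\<^sub>R (transpose B *v (A *v x + B *v y' - b)) + Q *v (y' - y)"
      and l': "l' = l - (\<gamma> * \<rho>) *\<^sub>R r"
    for x y l x' y' l' r ex ey
  proof -
    define dx dy p s where "dx = x' - xs" and "dy = y' - ys" and "p = x' - x" and "s = y' - y"
    define N where "N = (norm dx)\<^sup>2 + (norm dy)\<^sup>2 + (norm p)\<^sup>2 + (norm s)\<^sup>2 + (norm ex)\<^sup>2 + (norm ey)\<^sup>2"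
    have r': "r = A *v dx + B *v dy"
      by (simp add: r dx_def dy_def opt(3)[symmetric] matrix_vector_mult_diff_distrib)
    \<comment> \<open>The error of the multiplier that a full step (\<open>\<gamma> = 1\<close>) would produce; it is the one
      that the optimality conditions determine.\<close>
    define lt where "lt = l - ls - \<rho> *\<^sub>R r"
    have At: "transpose A *v lt = (F x' - F xs - ex) + P *v p"
      by (simp add: lt_def ex opt p_def matrix_vector_mult_diff_distrib
          matrix_vector_mult_scaleR algebra_simps)
    have "A *v x + B *v y' - b = r - A *v p"
      by (simp add: r p_def matrix_vector_mult_diff_distrib)
    then have ey': "ey = G y' - transpose B *v l + \<rho> *\<^sub>R (transpose B *v (r - A *v p)) + Q *v s"
      by (simp only: ey s_def)
    have Bt: "transpose B *v lt = (G y' - G ys - ey) + (Q *v s - \<rho> *\<^sub>R (transpose B *v (A *v p)))"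
      by (simp add: lt_def ey' opt matrix_vector_mult_diff_distrib
          matrix_vector_mult_scaleR algebra_simps)
    have Fd: "(norm (F x' - F xs))\<^sup>2 \<le> Lf\<^sup>2 * (norm dx)\<^sup>2"
      using power_mono[OF F[of x' xs], of 2] by (simp add: dx_def power_mult_distrib)
    have Gd: "(norm (G y' - G ys))\<^sup>2 \<le> Lg\<^sup>2 * (norm dy)\<^sup>2"
      using power_mono[OF G[of y' ys], of 2] by (simp add: dy_def power_mult_distrib)
    have BA: "(norm (\<rho> *\<^sub>R (transpose B *v (A *v p))))\<^sup>2 \<le> \<rho>\<^sup>2 * KT * KA * (norm p)\<^sup>2"
    proof -
      have "(norm (transpose B *v (A *v p)))\<^sup>2 \<le> KT * (KA * (norm p)\<^sup>2)"
        by (rule order_trans[OF KT(2) mult_left_mono[OF KA(2)]]) (use KT(1) in simp)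
      from mult_left_mono[OF this, of "\<rho>\<^sup>2"] show ?thesis by (simp add: power_mult_distrib mult.assoc)
    qed
    have A_bd: "(norm (transpose A *v lt))\<^sup>2 \<le> 4 * (Lf\<^sup>2 * (norm dx)\<^sup>2) + 4 * (norm ex)\<^sup>2 + 2 * (KP * (norm p)\<^sup>2)"
      unfolding At using norm_sum_sq_le[of "F x' - F xs - ex" "P *v p"]
        norm_diff_sq_le[of "F x' - F xs" ex] Fd KP(2)[of p] by simp
    have B_bd: "(norm (transpose B *v lt))\<^sup>2 \<le> 4 * (Lg\<^sup>2 * (norm dy)\<^sup>2) + 4 * (norm ey)\<^sup>2
        + 4 * (KQ * (norm s)\<^sup>2) + 4 * (\<rho>\<^sup>2 * KT * KA * (norm p)\<^sup>2)"
      unfolding Bt using norm_sum_sq_le[of "G y' - G ys - ey" "Q *v s - \<rho> *\<^sub>R (transpose B *v (A *v p))"]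
        norm_diff_sq_le[of "G y' - G ys" ey] Gd KQ(2)[of s]
        norm_diff_sq_le[of "Q *v s" "\<rho> *\<^sub>R (transpose B *v (A *v p))"] BA by linarith
    have bd: "Lf\<^sup>2 * (norm dx)\<^sup>2 \<le> W * (norm dx)\<^sup>2"
      "(KP + \<rho>\<^sup>2 * KT * KA) * (norm p)\<^sup>2 \<le> W * (norm p)\<^sup>2"
      "Lg\<^sup>2 * (norm dy)\<^sup>2 \<le> W * (norm dy)\<^sup>2" "KQ * (norm s)\<^sup>2 \<le> W * (norm s)\<^sup>2"
      using W by (auto intro!: mult_right_mono)
    have W1: "(norm ex)\<^sup>2 \<le> W * (norm ex)\<^sup>2" "(norm ey)\<^sup>2 \<le> W * (norm ey)\<^sup>2"
      using W by (auto simp: mult_le_cancel_right1)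
    have six: "4 * a1 + 4 * a2 + 4 * a3 + 4 * a4 + 4 * a5 + 4 * a6
        \<le> 4 * b1 + 4 * b2 + 4 * b3 + 4 * b4 + 4 * b5 + 4 * b6"
      if "a1 \<le> b1" "a2 \<le> b2" "a3 \<le> b3" "a4 \<le> b4" "a5 \<le> b5" "a6 \<le> b6"
      for a1 a2 a3 a4 a5 a6 b1 b2 b3 b4 b5 b6 :: real
      using that by linarith
    have "\<kappa> * (norm lt)\<^sup>2 \<le> 4 * (Lf\<^sup>2 * (norm dx)\<^sup>2) + 4 * (norm ex)\<^sup>2
        + 4 * ((KP + \<rho>\<^sup>2 * KT * KA) * (norm p)\<^sup>2)
        + 4 * (Lg\<^sup>2 * (norm dy)\<^sup>2) + 4 * (norm ey)\<^sup>2 + 4 * (KQ * (norm s)\<^sup>2)"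
    proof -
      have "2 * (KP * (norm p)\<^sup>2) + 4 * (\<rho>\<^sup>2 * KT * KA * (norm p)\<^sup>2)
          \<le> 4 * ((KP + \<rho>\<^sup>2 * KT * KA) * (norm p)\<^sup>2)"
        using KP by (simp add: distrib_right)
      note * = this
      have "k \<le> a1 + a2 + g + b1 + b2 + b3"
        if "k \<le> a + b" "a \<le> a1 + a2 + a3" "b \<le> b1 + b2 + b3 + b4" "a3 + b4 \<le> g"
        for k a b a1 a2 a3 b1 b2 b3 b4 g :: real
        using that by linarith
      from this[OF \<kappa>(2) A_bd B_bd *] show ?thesis .
    qed
    also have "\<dots> \<le> 4 * (W * (norm dx)\<^sup>2) + 4 * (W * (norm ex)\<^sup>2) + 4 * (W * (norm p)\<^sup>2)
        + 4 * (W * (norm dy)\<^sup>2) + 4 * (W * (norm ey)\<^sup>2) + 4 * (W * (norm s)\<^sup>2)"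
      by (rule six[OF bd(1) W1(1) bd(2) bd(3) W1(2) bd(4)])
    also have "\<dots> = 4 * W * N" by (simp add: N_def algebra_simps)
    finally have "(norm lt)\<^sup>2 * \<kappa> \<le> 4 * W * N" by (simp only: mult.commute)
    then have lt_bd: "(norm lt)\<^sup>2 \<le> 4 * W / \<kappa> * N"
      using \<kappa>(1) by (simp only: pos_le_divide_eq[symmetric] times_divide_eq_left)
    have r_bd: "(norm r)\<^sup>2 \<le> (2 * KA + 2 * KB) * N"
    proof -
      have "(norm r)\<^sup>2 \<le> 2 * (KA * (norm dx)\<^sup>2) + 2 * (KB * (norm dy)\<^sup>2)"
        unfolding r' using norm_sum_sq_le[of "A *v dx" "B *v dy"] KA(2)[of dx] KB(2)[of dy] by simp
      also have "\<dots> \<le> 2 * (KA * N) + 2 * (KB * N)"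
        using KA(1) KB(1) by (intro add_mono mult_left_mono) (auto simp: N_def)
      finally show ?thesis by (simp add: algebra_simps)
    qed
    have "l' - ls = lt + ((1 - \<gamma>) * \<rho>) *\<^sub>R r" by (simp add: l' lt_def algebra_simps)
    then have "(norm (l' - ls))\<^sup>2 \<le> 2 * (norm lt)\<^sup>2 + 2 * (k * (norm r)\<^sup>2)"
      using norm_sum_sq_le[of lt "((1 - \<gamma>) * \<rho>) *\<^sub>R r"] by (simp add: k_def power_mult_distrib)
    also have "\<dots> \<le> 2 * (4 * W / \<kappa> * N) + 2 * (k * ((2 * KA + 2 * KB) * N))"
      by (intro add_mono mult_left_mono lt_bd r_bd k) auto
    also have "\<dots> = C * N" by (simp add: C_def algebra_simps)
    finally show ?thesis by (simp add: N_def dx_def dy_def p_def s_def)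
  qed
  ultimately show ?thesis by (rule that)
qed

text \<open>The energy inequality bounds the decrease of the squared G-distance below by the primal errors
  and the primal steps, apart from the residuals, which Young's inequality absorbs. By the
  multiplier bound these quantities dominate the whole new squared G-distance.\<close>

lemma admm_inexact_step_contraction:
  fixes A :: "real^'n^'p" and B :: "real^'m^'p" and F :: "real^'n \<Rightarrow> real^'n" and G :: "real^'m \<Rightarrow> real^'m"
  assumes pos: "\<rho> > 0" "\<gamma> > 0" "\<gamma> < 2" "\<mu> > 0" "\<sigma> > 0"
    and posdef: "positive_definite (P_hat \<rho> A P)" "positive_definite Q"
    and dom: "\<And>z. \<rho> * (norm (A *v z))\<^sup>2 \<le> (2 - \<gamma>) * (z \<bullet> (P_hat \<rho> A P *v z))"
    and F: "\<And>u v. \<mu> * (norm (u - v))\<^sup>2 \<le> (u - v) \<bullet> (F u - F v)"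
      "\<And>u v. norm (F u - F v) \<le> Lf * norm (u - v)"
    and G: "\<And>u v. \<sigma> * (norm (u - v))\<^sup>2 \<le> (u - v) \<bullet> (G u - G v)"
      "\<And>u v. norm (G u - G v) \<le> Lg * norm (u - v)"
    and rank: "rank (hcat A B) = CARD('p)"
    and opt: "F xs = transpose A *v ls" "G ys = transpose B *v ls" "A *v xs + B *v ys = b"
  obtains q C where "0 \<le> q" "q < 1" "C \<ge> 0" "\<And>x y l x' y' l' r ex ey.
     r = A *v x' + B *v y' - b \<Longrightarrow>
     ex = F x' - transpose A *v l + \<rho> *\<^sub>R (transpose A *v r) + P *v (x' - x) \<Longrightarrow>
     ey = G y' - transpose B *v l + \<rho> *\<^sub>R (transpose B *v (A *v x + B *v y' - b)) + Q *v (y' - y) \<Longrightarrow>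
     l' = l - (\<gamma> * \<rho>) *\<^sub>R r \<Longrightarrow>
     wnorm2 (G_op \<rho> \<gamma> A P Q) ((x', y', l') - (xs, ys, ls))
       \<le> q * wnorm2 (G_op \<rho> \<gamma> A P Q) ((x, y, l) - (xs, ys, ls)) + C * ((norm ex)\<^sup>2 + (norm ey)\<^sup>2)"
proof -
  let ?P = "P_hat \<rho> A P"
  have symm: "transpose ?P = ?P" "transpose Q = Q" using posdef by (auto simp: positive_definite_def)
  obtain mP where mP: "mP > 0" "\<And>z. mP * (norm z)\<^sup>2 \<le> z \<bullet> (?P *v z)"
    using positive_form_lower_bound[OF matrix_vector_mul_linear[of ?P]] posdef(1)
    unfolding positive_definite_def by blast
  obtain mQ where mQ: "mQ > 0" "\<And>z. mQ * (norm z)\<^sup>2 \<le> z \<bullet> (Q *v z)"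
    using positive_form_lower_bound[OF matrix_vector_mul_linear[of Q]] posdef(2)
    unfolding positive_definite_def by blast
  obtain KA where KA: "KA > 0" "\<And>z. (norm (A *v z))\<^sup>2 \<le> KA * (norm z)\<^sup>2"
    using matrix_norm_bound by blast
  obtain KB where KB: "KB > 0" "\<And>z. (norm (B *v z))\<^sup>2 \<le> KB * (norm z)\<^sup>2"
    using matrix_norm_bound by blast
  obtain KG where KG: "KG > 0" "\<And>z. z \<bullet> G_op \<rho> \<gamma> A P Q z \<le> KG * (norm z)\<^sup>2"
    using linear_form_upper_bound[OF linear_G_op] by blast
  obtain CL where CL: "CL > 0" "\<And>x y l x' y' l' r ex ey.
     r = A *v x' + B *v y' - b \<Longrightarrow>
     ex = F x' - transpose A *v l + \<rho> *\<^sub>R (transpose A *v r) + P *v (x' - x) \<Longrightarrow>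
     ey = G y' - transpose B *v l + \<rho> *\<^sub>R (transpose B *v (A *v x + B *v y' - b)) + Q *v (y' - y) \<Longrightarrow>
     l' = l - (\<gamma> * \<rho>) *\<^sub>R r \<Longrightarrow>
     (norm (l' - ls))\<^sup>2 \<le> CL * ((norm (x' - xs))\<^sup>2 + (norm (y' - ys))\<^sup>2
        + (norm (x' - x))\<^sup>2 + (norm (y' - y))\<^sup>2 + (norm ex)\<^sup>2 + (norm ey)\<^sup>2)"
    by (rule admm_multiplier_bound[OF F(2) G(2) rank opt]) blast
  define \<nu> where "\<nu> = min \<mu> \<sigma>"
  have \<nu>: "\<nu> > 0" "\<nu> \<le> \<mu>" "\<nu> \<le> \<sigma>" using pos by (auto simp: \<nu>_def)
  \<comment> \<open>As r = A dx + B dy, the weight w makes w |r|^2 at most \<open>\<nu>\<close> (|dx|^2 + |dy|^2), at most half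
    of what strong convexity provides.\<close>
  define w where "w = \<nu> / (2 * KA + 2 * KB)"
  have w: "w > 0" "w * (2 * KA + 2 * KB) = \<nu>" using \<nu> KA KB by (auto simp: w_def)
  obtain \<theta> where \<theta>: "\<theta> > 0" "\<And>p r. \<theta> * (norm p)\<^sup>2 - w * (norm r)\<^sup>2
        \<le> p \<bullet> (?P *v p) + (2 - \<gamma>) * \<rho> * (norm r)\<^sup>2 - 2 * \<rho> * (r \<bullet> (A *v p))"
    using step_form_lower_bound[OF pos(1,3) mP dom w(1)] by blast
  define \<delta> where "\<delta> = min (\<nu> / 2) (min \<theta> mQ)"
  have \<delta>: "\<delta> > 0" "\<delta> \<le> \<nu> / 2" "\<delta> \<le> \<theta>" "\<delta> \<le> mQ" using \<nu> \<theta> mQ by (auto simp: \<delta>_def)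
  define K where "K = KG * (1 + CL)"
  have K: "K > 0" using KG CL by (simp add: K_def)
  show ?thesis
  proof (rule that[of "K / (K + \<delta>)" "(K * (2 / \<nu>) + K * \<delta>) / (K + \<delta>)"])
    show "0 \<le> K / (K + \<delta>)" "K / (K + \<delta>) < 1" "(K * (2 / \<nu>) + K * \<delta>) / (K + \<delta>) \<ge> 0"
      using K \<delta> \<nu> by auto
    fix x y l x' y' l' r ex ey
    assume r: "r = A *v x' + B *v y' - b"
      and ex: "ex = F x' - transpose A *v l + \<rho> *\<^sub>R (transpose A *v r) + P *v (x' - x)"
      and ey: "ey = G y' - transpose B *v l + \<rho> *\<^sub>R (transpose B *v (A *v x + B *v y' - b)) + Q *v (y' - y)"
      and l': "l' = l - (\<gamma> * \<rho>) *\<^sub>R r"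
    define dx dy p s where "dx = x' - xs" and "dy = y' - ys" and "p = x' - x" and "s = y' - y"
    define a where "a = wnorm2 (G_op \<rho> \<gamma> A P Q) ((x, y, l) - (xs, ys, ls))"
    define a' where "a' = wnorm2 (G_op \<rho> \<gamma> A P Q) ((x', y', l') - (xs, ys, ls))"
    define N where "N = (norm dx)\<^sup>2 + (norm dy)\<^sup>2 + (norm p)\<^sup>2 + (norm s)\<^sup>2"
    define e where "e = (norm ex)\<^sup>2 + (norm ey)\<^sup>2"
    have energy: "2 * \<mu> * (norm dx)\<^sup>2 + 2 * \<sigma> * (norm dy)\<^sup>2 + p \<bullet> (?P *v p) + s \<bullet> (Q *v s)
      + (2 - \<gamma>) * \<rho> * (norm r)\<^sup>2 - 2 * \<rho> * (r \<bullet> (A *v p)) \<le> a - a' + 2 * (dx \<bullet> ex) + 2 * (dy \<bullet> ey)"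
      unfolding dx_def dy_def p_def s_def a_def a'_def
      by (rule admm_energy_inequality[OF pos(1,2) symm F(1) G(1) opt r ex ey l'])
    have r': "r = A *v dx + B *v dy"
      by (simp add: r dx_def dy_def opt(3)[symmetric] matrix_vector_mult_diff_distrib)
    have "w * (norm r)\<^sup>2 \<le> \<nu> * ((norm dx)\<^sup>2 + (norm dy)\<^sup>2)"
    proof -
      have "(norm r)\<^sup>2 \<le> 2 * (KA * (norm dx)\<^sup>2) + 2 * (KB * (norm dy)\<^sup>2)"
        unfolding r' using norm_sum_sq_le[of "A *v dx" "B *v dy"] KA(2)[of dx] KB(2)[of dy] by simp
      also have "\<dots> \<le> (2 * KA + 2 * KB) * ((norm dx)\<^sup>2 + (norm dy)\<^sup>2)"
        using KA KB by (simp add: algebra_simps)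
      finally show ?thesis using mult_left_mono[of _ _ w] w by (metis less_imp_le mult.assoc)
    qed
    moreover have "2 * (dx \<bullet> ex) \<le> \<nu> / 2 * (norm dx)\<^sup>2 + 2 / \<nu> * (norm ex)\<^sup>2"
      using inner_le_weighted_squares[of "\<nu> / 2" dx ex] \<nu> by (simp add: field_simps)
    moreover have "2 * (dy \<bullet> ey) \<le> \<nu> / 2 * (norm dy)\<^sup>2 + 2 / \<nu> * (norm ey)\<^sup>2"
      using inner_le_weighted_squares[of "\<nu> / 2" dy ey] \<nu> by (simp add: field_simps)
    moreover have "\<nu> * (norm dx)\<^sup>2 \<le> \<mu> * (norm dx)\<^sup>2" "\<nu> * (norm dy)\<^sup>2 \<le> \<sigma> * (norm dy)\<^sup>2"
      using \<nu> by (auto intro: mult_right_mono)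
    ultimately have "\<nu> / 2 * (norm dx)\<^sup>2 + \<nu> / 2 * (norm dy)\<^sup>2 + \<theta> * (norm p)\<^sup>2 + mQ * (norm s)\<^sup>2
        \<le> a - a' + 2 / \<nu> * e"
      using energy \<theta>(2)[of p r] mQ(2)[of s] unfolding e_def distrib_left by linarith
    moreover have "\<delta> * N \<le> \<nu> / 2 * (norm dx)\<^sup>2 + \<nu> / 2 * (norm dy)\<^sup>2 + \<theta> * (norm p)\<^sup>2 + mQ * (norm s)\<^sup>2"
      unfolding N_def distrib_left using \<delta> by (intro add_mono mult_right_mono) auto
    ultimately have descent: "\<delta> * N \<le> a - a' + 2 / \<nu> * e" by linarith
    have "a' \<le> KG * ((norm dx)\<^sup>2 + (norm dy)\<^sup>2 + (norm (l' - ls))\<^sup>2)"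
    proof -
      have "(norm ((x', y', l') - (xs, ys, ls)))\<^sup>2 = (norm dx)\<^sup>2 + (norm dy)\<^sup>2 + (norm (l' - ls))\<^sup>2"
        by (simp add: norm_Pair dx_def dy_def)
      then show ?thesis using KG(2)[of "(x', y', l') - (xs, ys, ls)"] by (simp add: a'_def wnorm2_def)
    qed
    also have "\<dots> \<le> KG * ((N + e) + CL * (N + e))"
    proof (rule mult_left_mono[OF add_mono])
      show "(norm dx)\<^sup>2 + (norm dy)\<^sup>2 \<le> N + e" by (simp add: N_def e_def)
      show "(norm (l' - ls))\<^sup>2 \<le> CL * (N + e)"
        using CL(2)[OF r ex ey l'] by (simp add: N_def e_def dx_def dy_def p_def s_def algebra_simps)
    qed (use KG in simp)
    also have "\<dots> = K * (N + e)" by (simp add: K_def algebra_simps)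
    finally have "\<delta> * a' \<le> \<delta> * (K * (N + e))" using \<delta> by (intro mult_left_mono) auto
    also have "\<dots> = K * (\<delta> * N) + K * \<delta> * e" by (simp add: algebra_simps)
    also have "\<dots> \<le> K * (a - a' + 2 / \<nu> * e) + K * \<delta> * e"
      using K descent by (intro add_right_mono mult_left_mono) auto
    finally have "(K + \<delta>) * a' \<le> K * a + (K * (2 / \<nu>) + K * \<delta>) * e" by (simp add: algebra_simps)
    then have "a' \<le> (K * a + (K * (2 / \<nu>) + K * \<delta>) * e) / (K + \<delta>)"
      using K \<delta> by (simp add: pos_le_divide_eq mult.commute)
    then show "a' \<le> K / (K + \<delta>) * a + (K * (2 / \<nu>) + K * \<delta>) / (K + \<delta>) * e"
      by (simp only: add_divide_distrib[of "K * a"] times_divide_eq_left)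
  qed
qed

section \<open>Joint measurability of sampled gradients\<close>

text \<open>Coordinatewise rounding down to a multiple of \<open>2^(-n)\<close>.\<close>

definition grid_point :: "nat \<Rightarrow> 'a::euclidean_space \<Rightarrow> 'a" where
  "grid_point n z = (\<Sum>b\<in>Basis. (of_int \<lfloor>2 ^ n * (z \<bullet> b)\<rfloor> / 2 ^ n) *\<^sub>R b)"

lemma grid_point_tendsto: "(\<lambda>n. grid_point n z) \<longlonglongrightarrow> (z::'a::euclidean_space)"
proof -
  have "(\<lambda>n. of_int \<lfloor>2 ^ n * t\<rfloor> / 2 ^ n) \<longlonglongrightarrow> (t::real)" for t
  proof (rule tendsto_sandwich)
    have "(\<lambda>n. t - (1/2) ^ n) \<longlonglongrightarrow> t - 0"
      by (intro tendsto_intros LIMSEQ_power_zero) simp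
    then show "(\<lambda>n. t - (1/2) ^ n) \<longlonglongrightarrow> t" by simp
    have "t - (1/2) ^ n \<le> of_int \<lfloor>2 ^ n * t\<rfloor> / 2 ^ n" for n
    proof -
      have "t - (1/2) ^ n = (2 ^ n * t - 1) / 2 ^ n" by (simp add: diff_divide_distrib power_one_over)
      also have "\<dots> \<le> of_int \<lfloor>2 ^ n * t\<rfloor> / 2 ^ n"
        using real_of_int_floor_add_one_ge[of "2 ^ n * t"] by (intro divide_right_mono) auto
      finally show ?thesis .
    qed
    then show "\<forall>\<^sub>F n in sequentially. t - (1/2) ^ n \<le> of_int \<lfloor>2 ^ n * t\<rfloor> / 2 ^ n" by simp
    have "of_int \<lfloor>2 ^ n * t\<rfloor> / 2 ^ n \<le> t" for n
      using of_int_floor_le[of "2 ^ n * t"] by (simp add: field_simps)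
    then show "\<forall>\<^sub>F n in sequentially. of_int \<lfloor>2 ^ n * t\<rfloor> / 2 ^ n \<le> t" by simp
  qed simp
  then have "(\<lambda>n. grid_point n z) \<longlonglongrightarrow> (\<Sum>b\<in>Basis. (z \<bullet> b) *\<^sub>R b)"
    unfolding grid_point_def by (intro tendsto_intros)
  then show ?thesis by (simp add: euclidean_representation)
qed

lemma borel_measurable_grid_point: "grid_point n \<in> borel_measurable (borel :: 'a::euclidean_space measure)"
  unfolding grid_point_def[abs_def] by measurable

lemma countable_range_grid_point: "countable (range (grid_point n :: 'a::euclidean_space \<Rightarrow> 'a))"
proof -
  have "range (grid_point n :: 'a \<Rightarrow> 'a) \<subseteq>
      (\<lambda>k. \<Sum>b\<in>Basis. (of_int (k b) / 2 ^ n) *\<^sub>R b) ` (PiE Basis (\<lambda>_. UNIV :: int set))"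
  proof
    fix v assume "v \<in> range (grid_point n :: 'a \<Rightarrow> 'a)"
    then obtain z where v: "v = grid_point n z" by auto
    show "v \<in> (\<lambda>k. \<Sum>b\<in>Basis. (of_int (k b) / 2 ^ n) *\<^sub>R b) ` (PiE Basis (\<lambda>_. UNIV :: int set))"
      by (rule image_eqI[of _ _ "restrict (\<lambda>b. \<lfloor>2 ^ n * (z \<bullet> b)\<rfloor>) Basis"]) (auto simp: v grid_point_def)
  qed
  then show ?thesis by (rule countable_subset) (intro countable_image countable_PiE, auto)
qed

text \<open>Composing F with the rounding in its first argument gives a function that is jointly measurable
  because the rounding takes countably many values; continuity in the first argument makes F the
  limit of these functions.\<close>

lemma borel_measurable_caratheodory:
  fixes F :: "'a::euclidean_space \<Rightarrow> 's \<Rightarrow> real"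
  assumes meas: "\<And>z. F z \<in> borel_measurable N"
    and cont: "\<And>s. s \<in> space N \<Longrightarrow> continuous_on UNIV (\<lambda>z. F z s)"
  shows "(\<lambda>(z, s). F z s) \<in> borel_measurable (borel \<Otimes>\<^sub>M N)"
proof (rule borel_measurable_LIMSEQ_real)
  fix n
  have "grid_point n \<in> measurable borel (count_space (range (grid_point n :: 'a \<Rightarrow> 'a)))"
  proof (rule measurable_count_space_eq_countable[THEN iffD2, rotated])
    show "countable (range (grid_point n :: 'a \<Rightarrow> 'a))" by (rule countable_range_grid_point)
  next
    have "(grid_point n :: 'a \<Rightarrow> 'a) -` {a} \<inter> space borel \<in> sets borel" for a
      by (rule measurable_sets[OF borel_measurable_grid_point]) simp
    then show "(grid_point n :: 'a \<Rightarrow> 'a) \<in> space borel \<rightarrow> range (grid_point n) \<and>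
        (\<forall>a\<in>range (grid_point n). (grid_point n :: 'a \<Rightarrow> 'a) -` {a} \<inter> space borel \<in> sets borel)" by auto
  qed
  then have "(\<lambda>p. F (grid_point n (fst p)) (snd p)) \<in> borel_measurable (borel \<Otimes>\<^sub>M N)"
    by (rule measurable_compose_countable'[where f="\<lambda>z p. F z (snd p)" and I="range (grid_point n)",
          OF measurable_compose[OF measurable_snd meas] measurable_compose[OF measurable_fst]
            countable_range_grid_point])
  then show "(\<lambda>(z, s). F (grid_point n z) s) \<in> borel_measurable (borel \<Otimes>\<^sub>M N)"
    by (simp add: case_prod_unfold)
next
  fix p :: "'a \<times> 's" assume "p \<in> space (borel \<Otimes>\<^sub>M N)"
  then obtain z s where p: "p = (z, s)" "s \<in> space N" by (auto simp: space_pair_measure)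
  have "isCont (\<lambda>z. F z s) z" using cont[OF p(2)] by (simp add: continuous_on_eq_continuous_at)
  from isCont_tendsto_compose[OF this grid_point_tendsto]
  show "(\<lambda>n. (\<lambda>(z, s). F (grid_point n z) s) p) \<longlonglongrightarrow> (\<lambda>(z, s). F z s) p" by (simp add: p)
qed

text \<open>Each coordinate of the gradient is a limit of difference quotients along a fixed sequence, and F
  itself is jointly measurable as it is continuous in the point.\<close>

lemma borel_measurable_sampled_gradient:
  fixes F :: "'a::euclidean_space \<Rightarrow> 's \<Rightarrow> real"
  assumes meas: "\<And>z. F z \<in> borel_measurable N"
    and diff: "\<And>s z. s \<in> space N \<Longrightarrow> (\<lambda>z. F z s) differentiable (at z)"
  shows "(\<lambda>(z, s). gradient (\<lambda>z. F z s) z) \<in> borel_measurable (borel \<Otimes>\<^sub>M N)"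
proof (subst borel_measurable_euclidean_space, intro ballI)
  fix h :: 'a
  have joint: "(\<lambda>(z, s). F z s) \<in> borel_measurable (borel \<Otimes>\<^sub>M N)"
    using meas by (rule borel_measurable_caratheodory)
      (auto intro!: differentiable_imp_continuous_on simp: differentiable_on_def diff)
  show "(\<lambda>p. (case p of (z, s) \<Rightarrow> gradient (\<lambda>z. F z s) z) \<bullet> h) \<in> borel_measurable (borel \<Otimes>\<^sub>M N)"
  proof (rule borel_measurable_LIMSEQ_real)
    fix n
    have shifted: "(\<lambda>p. F (fst p + (1 / real (Suc n)) *\<^sub>R h) (snd p)) \<in> borel_measurable (borel \<Otimes>\<^sub>M N)"
    proof -
      have "(\<lambda>p. fst p + (1 / real (Suc n)) *\<^sub>R h) \<in> borel_measurable (borel \<Otimes>\<^sub>M N)"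
        by (intro borel_measurable_add borel_measurable_const measurable_fst)
      from measurable_compose[OF measurable_Pair[OF this measurable_snd] joint]
      show ?thesis by (simp only: prod.case)
    qed
    have "(\<lambda>p. F (fst p) (snd p)) \<in> borel_measurable (borel \<Otimes>\<^sub>M N)"
      using joint by (simp add: case_prod_unfold)
    from borel_measurable_divide[OF borel_measurable_diff[OF shifted this] borel_measurable_const]
    show "(\<lambda>p. (F (fst p + (1 / real (Suc n)) *\<^sub>R h) (snd p) - F (fst p) (snd p)) / (1 / real (Suc n)))
        \<in> borel_measurable (borel \<Otimes>\<^sub>M N)" .
  next
    fix p :: "'a \<times> 's" assume "p \<in> space (borel \<Otimes>\<^sub>M N)"
    then obtain z s where p: "p = (z, s)" "s \<in> space N" by (auto simp: space_pair_measure)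
    have "(\<lambda>n. 1 / real (Suc n)) \<longlonglongrightarrow> 0" by (rule LIMSEQ_Suc) (rule lim_1_over_n)
    then have "filterlim (\<lambda>n. 1 / real (Suc n)) (at 0) sequentially"
      by (auto simp: filterlim_at)
    from filterlim_compose[OF GDERIV_directional[OF GDERIV_gradient[OF diff[OF p(2)]]] this]
    show "(\<lambda>n. (F (fst p + (1 / real (Suc n)) *\<^sub>R h) (snd p) - F (fst p) (snd p)) / (1 / real (Suc n)))
        \<longlonglongrightarrow> (case p of (z, s) \<Rightarrow> gradient (\<lambda>z. F z s) z) \<bullet> h"
      by (simp add: p inner_commute)
  qed
qed

section \<open>Independence from the past\<close>

lemma (in prob_space) distr_pair_indep:
  assumes sub: "subalgebra M F" and Y: "Y \<in> measurable F N1" and S: "S \<in> measurable M N2"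
    and indep: "indep_set (sets F) (sets (vimage_algebra (space M) S N2))"
  shows "distr M N1 Y \<Otimes>\<^sub>M distr M N2 S = distr M (N1 \<Otimes>\<^sub>M N2) (\<lambda>\<omega>. (Y \<omega>, S \<omega>))"
proof (rule pair_measure_eqI)
  have Y': "Y \<in> measurable M N1" using sub Y by (rule measurable_from_subalg)
  show "sigma_finite_measure (distr M N1 Y)" "sigma_finite_measure (distr M N2 S)"
    using prob_space_distr[OF Y'] prob_space_distr[OF S]
    by (auto intro: prob_space_imp_sigma_finite)
  show "sets (distr M N1 Y \<Otimes>\<^sub>M distr M N2 S) = sets (distr M (N1 \<Otimes>\<^sub>M N2) (\<lambda>\<omega>. (Y \<omega>, S \<omega>)))"
    by (simp cong: sets_pair_measure_cong)
  fix A B assume "A \<in> sets (distr M N1 Y)" "B \<in> sets (distr M N2 S)"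
  then have AB: "A \<in> sets N1" "B \<in> sets N2" by auto
  have "Y -` A \<inter> space M \<in> sets F"
    using measurable_sets[OF Y AB(1)] sub by (simp add: subalgebra_def)
  moreover have "S -` B \<inter> space M \<in> sets (vimage_algebra (space M) S N2)"
    using AB(2) by (rule in_vimage_algebra)
  ultimately have "prob ((Y -` A \<inter> space M) \<inter> (S -` B \<inter> space M))
      = prob (Y -` A \<inter> space M) * prob (S -` B \<inter> space M)"
    using indep unfolding indep_sets2_eq by blast
  moreover have "(\<lambda>\<omega>. (Y \<omega>, S \<omega>)) -` (A \<times> B) \<inter> space M = (Y -` A \<inter> space M) \<inter> (S -` B \<inter> space M)"
    by auto
  ultimately show "emeasure (distr M N1 Y) A * emeasure (distr M N2 S) B =
      emeasure (distr M (N1 \<Otimes>\<^sub>M N2) (\<lambda>\<omega>. (Y \<omega>, S \<omega>))) (A \<times> B)"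
    using AB Y' S measurable_Pair[OF Y' S]
    by (simp add: emeasure_distr emeasure_eq_measure ennreal_mult)
qed

text \<open>Fubini for the product law of an F-measurable variable and an independent sample. The inner
  integral may be taken over any copy of the sample.\<close>

lemma (in prob_space) nn_integral_indep_pair:
  assumes sub: "subalgebra M F" and Y: "Y \<in> measurable F N1" and S: "S \<in> measurable M N2"
    and indep: "indep_set (sets F) (sets (vimage_algebra (space M) S N2))"
    and copy: "\<xi> \<in> measurable M N2" "distr M N2 S = distr M N2 \<xi>"
    and h: "h \<in> borel_measurable (N1 \<Otimes>\<^sub>M N2)"
  shows "(\<integral>\<^sup>+\<omega>. h (Y \<omega>, S \<omega>) \<partial>M) = (\<integral>\<^sup>+\<omega>. (\<integral>\<^sup>+\<omega>'. h (Y \<omega>, \<xi> \<omega>') \<partial>M) \<partial>M)"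
proof -
  have Y': "Y \<in> measurable M N1" using sub Y by (rule measurable_from_subalg)
  interpret D: sigma_finite_measure "distr M N2 \<xi>"
    using prob_space_distr[OF copy(1)] by (rule prob_space_imp_sigma_finite)
  have h': "h \<in> borel_measurable (N1 \<Otimes>\<^sub>M distr M N2 \<xi>)"
    using h by (simp cong: measurable_cong_sets sets_pair_measure_cong)
  have inner: "(\<integral>\<^sup>+s. h (y, s) \<partial>distr M N2 \<xi>) = (\<integral>\<^sup>+\<omega>'. h (y, \<xi> \<omega>') \<partial>M)" if "y \<in> space N1" for y
    using copy(1) measurable_compose[OF measurable_Pair1'[OF that] h]
    by (simp add: nn_integral_distr)
  have "(\<integral>\<^sup>+\<omega>. h (Y \<omega>, S \<omega>) \<partial>M) = (\<integral>\<^sup>+z. h z \<partial>distr M (N1 \<Otimes>\<^sub>M N2) (\<lambda>\<omega>. (Y \<omega>, S \<omega>)))"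
    using h by (intro nn_integral_distr[symmetric] measurable_Pair[OF Y' S]) simp
  also have "\<dots> = (\<integral>\<^sup>+z. h z \<partial>(distr M N1 Y \<Otimes>\<^sub>M distr M N2 \<xi>))"
    unfolding distr_pair_indep[OF sub Y S indep, symmetric] copy(2) ..
  also have "\<dots> = (\<integral>\<^sup>+y. (\<integral>\<^sup>+s. h (y, s) \<partial>distr M N2 \<xi>) \<partial>distr M N1 Y)"
    by (rule D.nn_integral_fst[symmetric]) (use h in \<open>simp cong: measurable_cong_sets sets_pair_measure_cong\<close>)
  also have "\<dots> = (\<integral>\<^sup>+\<omega>. (\<integral>\<^sup>+s. h (Y \<omega>, s) \<partial>distr M N2 \<xi>) \<partial>M)"
    using D.borel_measurable_nn_integral_fst[OF h'] by (intro nn_integral_distr Y') simp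
  also have "\<dots> = (\<integral>\<^sup>+\<omega>. (\<integral>\<^sup>+\<omega>'. h (Y \<omega>, \<xi> \<omega>') \<partial>M) \<partial>M)"
    by (intro nn_integral_cong inner measurable_space[OF Y'])
  finally show ?thesis .
qed

text \<open>The cross term vanishes because W has mean zero.\<close>

lemma (in prob_space) expected_square_noise:
  fixes W :: "'a \<Rightarrow> 'z::euclidean_space"
  assumes W: "integrable M W" "(\<integral>\<omega>. W \<omega> \<partial>M) = 0" "integrable M (\<lambda>\<omega>. (norm (W \<omega>))\<^sup>2)"
    and bound: "(\<integral>\<omega>. (norm (W \<omega>))\<^sup>2 \<partial>M) \<le> v"
  shows "(\<integral>\<^sup>+\<omega>. ennreal ((norm (a - t *\<^sub>R W \<omega>))\<^sup>2) \<partial>M) \<le> ennreal ((norm a)\<^sup>2 + t\<^sup>2 * v)"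
proof -
  have eq: "(norm (a - t *\<^sub>R W \<omega>))\<^sup>2 = (norm a)\<^sup>2 - 2 * t * (a \<bullet> W \<omega>) + t\<^sup>2 * (norm (W \<omega>))\<^sup>2" for \<omega>
    unfolding power2_norm_eq_inner
    by (simp add: inner_diff inner_commute power2_eq_square algebra_simps)
  have int: "integrable M (\<lambda>\<omega>. (norm (a - t *\<^sub>R W \<omega>))\<^sup>2)"
    unfolding eq using W by auto
  have "(\<integral>\<omega>. (norm (a - t *\<^sub>R W \<omega>))\<^sup>2 \<partial>M) = (norm a)\<^sup>2 + t\<^sup>2 * (\<integral>\<omega>. (norm (W \<omega>))\<^sup>2 \<partial>M)"
    unfolding eq using W by (simp add: prob_space)
  also have "\<dots> \<le> (norm a)\<^sup>2 + t\<^sup>2 * v" using bound by (intro add_left_mono mult_left_mono) auto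
  finally show ?thesis using int by (simp add: nn_integral_eq_integral ennreal_leI)
qed

text \<open>The position z at which the noise is evaluated is itself random, but it is F-measurable, so it can
  be held fixed while the independent sample is averaged out.\<close>

lemma (in prob_space) expected_square_noisy_step:
  fixes w :: "'z::euclidean_space \<Rightarrow> 's \<Rightarrow> 'z"
  assumes sub: "subalgebra M F" and a: "a \<in> borel_measurable F" and z: "z \<in> borel_measurable F"
    and S: "S \<in> measurable M N" and indep: "indep_set (sets F) (sets (vimage_algebra (space M) S N))"
    and copy: "\<xi> \<in> measurable M N" "distr M N S = distr M N \<xi>"
    and w: "(\<lambda>(z, s). w z s) \<in> borel_measurable (borel \<Otimes>\<^sub>M N)"
    and W: "\<And>z. integrable M (\<lambda>\<omega>. w z (\<xi> \<omega>))" "\<And>z. (\<integral>\<omega>. w z (\<xi> \<omega>) \<partial>M) = 0"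
      "\<And>z. integrable M (\<lambda>\<omega>. (norm (w z (\<xi> \<omega>)))\<^sup>2)"
      "\<And>z. (\<integral>\<omega>. (norm (w z (\<xi> \<omega>)))\<^sup>2 \<partial>M) \<le> v1 * (norm z)\<^sup>2 + v2"
  shows "(\<integral>\<^sup>+\<omega>. ennreal ((norm (a \<omega> - t *\<^sub>R w (z \<omega>) (S \<omega>)))\<^sup>2) \<partial>M)
    \<le> (\<integral>\<^sup>+\<omega>. ennreal ((norm (a \<omega>))\<^sup>2 + t\<^sup>2 * (v1 * (norm (z \<omega>))\<^sup>2 + v2)) \<partial>M)"
proof -
  define h where "h = (\<lambda>((a, z), s). ennreal ((norm (a - t *\<^sub>R w z s))\<^sup>2))"
  have w': "(\<lambda>q. w (snd (fst q)) (snd q)) \<in> borel_measurable ((borel \<Otimes>\<^sub>M borel) \<Otimes>\<^sub>M N)"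
  proof -
    have "(\<lambda>q. (snd (fst q), snd q)) \<in> measurable ((borel \<Otimes>\<^sub>M borel) \<Otimes>\<^sub>M N) (borel \<Otimes>\<^sub>M N)"
      by measurable
    from measurable_compose[OF this w] show ?thesis by (simp only: prod.case)
  qed
  have h: "h \<in> borel_measurable ((borel \<Otimes>\<^sub>M borel) \<Otimes>\<^sub>M N)"
  proof -
    have [measurable]: "(\<lambda>q. fst (fst q) - t *\<^sub>R w (snd (fst q)) (snd q))
        \<in> borel_measurable ((borel \<Otimes>\<^sub>M borel) \<Otimes>\<^sub>M N)"
      by (intro borel_measurable_diff borel_measurable_scaleR borel_measurable_const w'
          measurable_compose[OF measurable_fst measurable_fst])
    show ?thesis unfolding h_def case_prod_unfold by measurable
  qed
  have "(\<integral>\<^sup>+\<omega>. h ((a \<omega>, z \<omega>), S \<omega>) \<partial>M) = (\<integral>\<^sup>+\<omega>. (\<integral>\<^sup>+\<omega>'. h ((a \<omega>, z \<omega>), \<xi> \<omega>') \<partial>M) \<partial>M)"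
    by (rule nn_integral_indep_pair[OF sub measurable_Pair[OF a z] S indep copy h])
  also have "\<dots> \<le> (\<integral>\<^sup>+\<omega>. ennreal ((norm (a \<omega>))\<^sup>2 + t\<^sup>2 * (v1 * (norm (z \<omega>))\<^sup>2 + v2)) \<partial>M)"
    unfolding h_def prod.case by (intro nn_integral_mono expected_square_noise W)
  finally show ?thesis unfolding h_def prod.case .
qed

text \<open>T - 1 successive samples along the filtration F, indexed from 1 as in the inner loops: F j is the
  information available before the j-th sample is drawn.\<close>

definition fresh_samples :: "'w measure \<Rightarrow> 's measure \<Rightarrow> ('w \<Rightarrow> 's) \<Rightarrow> (nat \<Rightarrow> 'w measure)
    \<Rightarrow> (nat \<Rightarrow> 'w \<Rightarrow> 's) \<Rightarrow> nat \<Rightarrow> bool" where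
  "fresh_samples M N \<xi> F S T \<longleftrightarrow> (\<forall>j\<in>{1..T}. subalgebra M (F j)) \<and>
     (\<forall>j\<in>{1..<T}. sets (F j) \<subseteq> sets (F (Suc j)) \<and> S j \<in> measurable (F (Suc j)) N \<and>
        distr M N (S j) = distr M N \<xi> \<and>
        prob_space.indep_set M (sets (F j)) (sets (vimage_algebra (space M) (S j) N)))"

lemma fresh_samplesD:
  assumes "fresh_samples M N \<xi> F S T"
  shows "j \<in> {1..T} \<Longrightarrow> subalgebra M (F j)"
    "j \<in> {1..<T} \<Longrightarrow> sets (F j) \<subseteq> sets (F (Suc j))"
    "j \<in> {1..<T} \<Longrightarrow> S j \<in> measurable (F (Suc j)) N"
    "j \<in> {1..<T} \<Longrightarrow> distr M N (S j) = distr M N \<xi>"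
    "j \<in> {1..<T} \<Longrightarrow> prob_space.indep_set M (sets (F j)) (sets (vimage_algebra (space M) (S j) N))"
  using assms unfolding fresh_samples_def by blast+

text \<open>The sigma-algebra generated by u and the samples with index in J.\<close>

definition past :: "'w measure \<Rightarrow> ('w \<Rightarrow> 'u::topological_space) \<Rightarrow> ('i \<Rightarrow> 'w \<Rightarrow> 'd::topological_space)
    \<Rightarrow> 'i set \<Rightarrow> 'w measure" where
  "past M u S J = vimage_algebra (space M) (\<lambda>\<omega>. (u \<omega>, \<lambda>i\<in>J. S i \<omega>)) (borel \<Otimes>\<^sub>M Pi\<^sub>M J (\<lambda>_. borel))"

lemma space_past [simp]: "space (past M u S J) = space M"
  by (simp add: past_def)

lemma past_map_funcset:
  "(\<lambda>\<omega>. (u \<omega>, \<lambda>i\<in>J. S i \<omega>)) \<in> space M \<rightarrow> space (borel \<Otimes>\<^sub>M Pi\<^sub>M J (\<lambda>_. borel))"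
  by (auto simp: space_pair_measure space_PiM)

lemma measurable_past_map:
  "(\<lambda>\<omega>. (u \<omega>, \<lambda>i\<in>J. S i \<omega>)) \<in> measurable (past M u S J) (borel \<Otimes>\<^sub>M Pi\<^sub>M J (\<lambda>_. borel))"
  unfolding past_def by (rule measurable_vimage_algebra1[OF past_map_funcset])

lemma measurable_past_initial: "u \<in> borel_measurable (past M u S J)"
  using measurable_compose[OF measurable_past_map measurable_fst] by simp

lemma measurable_past_sample:
  assumes "i \<in> J"
  shows "S i \<in> borel_measurable (past M u S J)"
proof -
  have "(\<lambda>\<omega>. (\<lambda>i\<in>J. S i \<omega>) i) \<in> borel_measurable (past M u S J)"
    using measurable_compose[OF measurable_compose[OF measurable_past_map measurable_snd]
        measurable_component_singleton[OF assms]] by simp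
  then show ?thesis using assms by simp
qed

lemma sets_past_subset:
  assumes "space N = space M" "u \<in> borel_measurable N" "\<And>i. i \<in> J \<Longrightarrow> S i \<in> borel_measurable N"
  shows "sets (past M u S J) \<subseteq> sets N"
  unfolding past_def
proof (rule sets_image_in_sets)
  show "(\<lambda>\<omega>. (u \<omega>, \<lambda>i\<in>J. S i \<omega>)) \<in> measurable N (borel \<Otimes>\<^sub>M Pi\<^sub>M J (\<lambda>_. borel))"
    using assms by (intro measurable_Pair measurable_restrict)
qed (use assms in simp)

lemma sets_past_mono: "J \<subseteq> J' \<Longrightarrow> sets (past M u S J) \<subseteq> sets (past M u S J')"
  by (rule sets_past_subset) (auto intro: measurable_past_initial measurable_past_sample)

text \<open>Independence is checked on the intersection-stable generator of events that restrict u and the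
  samples in J separately: u is independent of the whole family, and the samples in J are
  independent of the one with index i.\<close>

lemma (in prob_space) indep_past_sample:
  fixes u :: "'a \<Rightarrow> 'u::topological_space" and S :: "'i \<Rightarrow> 'a \<Rightarrow> 'd::topological_space"
  assumes u: "u \<in> borel_measurable M" "indep_of_family M u S I"
    and S: "indep_vars (\<lambda>_. borel) S I"
    and J: "J \<subseteq> I" and i: "i \<in> I" "i \<notin> J"
  shows "indep_set (sets (past M u S J)) (sets (vimage_algebra (space M) (S i) borel))"
proof -
  define G where "G = vimage_algebra (space M) (\<lambda>\<omega>. \<lambda>i\<in>I. S i \<omega>) (Pi\<^sub>M I (\<lambda>_. borel :: 'd measure))"
  have Smeas: "S k \<in> borel_measurable M" if "k \<in> I" for k
    using S that by (auto simp: indep_vars_def)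
  have GS: "S k \<in> borel_measurable G" if "k \<in> I" for k
  proof -
    have "(\<lambda>\<omega>. \<lambda>i\<in>I. S i \<omega>) \<in> measurable G (Pi\<^sub>M I (\<lambda>_. borel))"
      unfolding G_def by (rule measurable_vimage_algebra1) (auto simp: space_PiM)
    from measurable_compose[OF this measurable_component_singleton[OF that]]
    show ?thesis using that by simp
  qed
  have spG: "space G = space M" by (simp add: G_def)
  have SJ: "(\<lambda>\<omega>. \<lambda>k\<in>J. S k \<omega>) \<in> measurable G (Pi\<^sub>M J (\<lambda>_. borel))"
    using GS J by (intro measurable_restrict) auto
  have SJM: "(\<lambda>\<omega>. \<lambda>k\<in>J. S k \<omega>) \<in> measurable M (Pi\<^sub>M J (\<lambda>_. borel))"
    using Smeas J by (intro measurable_restrict) auto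
  let ?A = "{(u -` U \<inter> space M) \<inter> ((\<lambda>\<omega>. \<lambda>k\<in>J. S k \<omega>) -` V \<inter> space M) | U V.
      U \<in> sets borel \<and> V \<in> sets (Pi\<^sub>M J (\<lambda>_. borel))}"
  let ?B = "{S i -` W \<inter> space M | W. W \<in> sets borel}"
  have split: "prob (((\<lambda>\<omega>. \<lambda>k\<in>J. S k \<omega>) -` V \<inter> space M) \<inter> (S i -` W \<inter> space M))
      = prob ((\<lambda>\<omega>. \<lambda>k\<in>J. S k \<omega>) -` V \<inter> space M) * prob (S i -` W \<inter> space M)"
    if V: "V \<in> sets (Pi\<^sub>M J (\<lambda>_. borel))" and W: "W \<in> sets borel" for V W
  proof -
    have iv: "indep_var (Pi\<^sub>M J (\<lambda>_. borel)) (\<lambda>\<omega>. \<lambda>k\<in>J. S k \<omega>) (Pi\<^sub>M {i} (\<lambda>_. borel)) (\<lambda>\<omega>. \<lambda>k\<in>{i}. S k \<omega>)"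
      using J i by (intro indep_var_restrict[OF S]) auto
    define X where "X = (\<lambda>f. f i) -` W \<inter> space (Pi\<^sub>M {i} (\<lambda>_. borel :: 'd measure))"
    have X: "X \<in> sets (Pi\<^sub>M {i} (\<lambda>_. borel))"
      unfolding X_def by (rule measurable_sets[OF measurable_component_singleton[of i "{i}"] W]) simp
    have XW: "(\<lambda>\<omega>. \<lambda>k\<in>{i}. S k \<omega>) -` X \<inter> space M = S i -` W \<inter> space M"
      by (auto simp: X_def space_PiM)
    have pair: "(\<lambda>x. (\<lambda>k\<in>J. S k x, \<lambda>k\<in>{i}. S k x)) -` (V \<times> X) \<inter> space M
        = ((\<lambda>\<omega>. \<lambda>k\<in>J. S k \<omega>) -` V \<inter> space M) \<inter> ((\<lambda>\<omega>. \<lambda>k\<in>{i}. S k \<omega>) -` X \<inter> space M)"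
      by auto
    show ?thesis using indep_varD[OF iv V X] unfolding pair XW .
  qed
  have indep: "indep_set ?A ?B"
    unfolding indep_sets2_eq
  proof (intro conjI ballI)
    show "?A \<subseteq> events" using measurable_sets[OF u(1)] measurable_sets[OF SJM] by blast
    show "?B \<subseteq> events" using measurable_sets[OF Smeas[OF i(1)]] by blast
    fix a b assume "a \<in> ?A" "b \<in> ?B"
    then obtain U V W where UVW: "U \<in> sets borel" "V \<in> sets (Pi\<^sub>M J (\<lambda>_. borel))" "W \<in> sets borel"
      and a: "a = (u -` U \<inter> space M) \<inter> ((\<lambda>\<omega>. \<lambda>k\<in>J. S k \<omega>) -` V \<inter> space M)"
      and b: "b = S i -` W \<inter> space M" by blast
    define E where "E = u -` U \<inter> space M"
    define E' where "E' = (\<lambda>\<omega>. \<lambda>k\<in>J. S k \<omega>) -` V \<inter> space M"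
    have E: "E \<in> sets (vimage_algebra (space M) u borel)"
      unfolding E_def using UVW(1) by (rule in_vimage_algebra)
    have E': "E' \<in> sets G" using measurable_sets[OF SJ UVW(2)] by (simp add: E'_def spG)
    have b': "b \<in> sets G" using measurable_sets[OF GS[OF i(1)] UVW(3)] by (simp add: b spG)
    have ind: "prob (E \<inter> X) = prob E * prob X" if "X \<in> sets G" for X
      using u(2) E that unfolding indep_of_family_def indep_sets2_eq G_def by blast
    have "prob (a \<inter> b) = prob (E \<inter> (E' \<inter> b))" by (simp add: a E_def E'_def Int_assoc)
    also have "\<dots> = prob E * (prob E' * prob b)"
      using ind[of "E' \<inter> b"] E' b' split[OF UVW(2,3)] by (simp add: E'_def b)
    also have "\<dots> = prob (E \<inter> E') * prob b" using ind[OF E'] by simp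
    finally show "prob (a \<inter> b) = prob a * prob b" by (simp add: a E_def E'_def)
  qed
  have "Int_stable ?A"
  proof (rule Int_stableI, safe)
    fix U U' :: "'u set" and V V'
    assume "U \<in> sets borel" "V \<in> sets (Pi\<^sub>M J (\<lambda>_. borel :: 'd measure))"
      "U' \<in> sets borel" "V' \<in> sets (Pi\<^sub>M J (\<lambda>_. borel :: 'd measure))"
    then show "\<exists>Ua Va. u -` U \<inter> space M \<inter> ((\<lambda>\<omega>. \<lambda>k\<in>J. S k \<omega>) -` V \<inter> space M) \<inter>
        (u -` U' \<inter> space M \<inter> ((\<lambda>\<omega>. \<lambda>k\<in>J. S k \<omega>) -` V' \<inter> space M)) =
        u -` Ua \<inter> space M \<inter> ((\<lambda>\<omega>. \<lambda>k\<in>J. S k \<omega>) -` Va \<inter> space M) \<and>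
        Ua \<in> sets borel \<and> Va \<in> sets (Pi\<^sub>M J (\<lambda>_. borel))"
      by (intro exI[of _ "U \<inter> U'"] exI[of _ "V \<inter> V'"]) auto
  qed
  moreover have "Int_stable ?B"
  proof (rule Int_stableI, safe)
    fix W W' :: "'d set" assume "W \<in> sets borel" "W' \<in> sets borel"
    then show "\<exists>Wa. S i -` W \<inter> space M \<inter> (S i -` W' \<inter> space M) = S i -` Wa \<inter> space M \<and> Wa \<in> sets borel"
      by (intro exI[of _ "W \<inter> W'"]) auto
  qed
  ultimately have "indep_set (sigma_sets (space M) ?A) (sigma_sets (space M) ?B)"
    by (rule indep_set_sigma_sets[OF indep])
  moreover have "sigma_sets (space M) ?A = sets (past M u S J)"
  proof -
    let ?f = "\<lambda>\<omega>. (u \<omega>, \<lambda>i\<in>J. S i \<omega>)"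
    let ?X = "{a \<times> b | a b. a \<in> sets (borel :: 'u measure) \<and> b \<in> sets (Pi\<^sub>M J (\<lambda>_. borel :: 'd measure))}"
    let ?\<Omega> = "space (borel :: 'u measure) \<times> space (Pi\<^sub>M J (\<lambda>_. borel :: 'd measure))"
    have X: "?X \<subseteq> Pow ?\<Omega>" by (rule pair_measure_closed)
    have f: "?f \<in> space M \<rightarrow> ?\<Omega>" using past_map_funcset by (simp only: space_pair_measure)
    have "sets (past M u S J) = sets (vimage_algebra (space M) ?f (sigma ?\<Omega> ?X))"
      unfolding past_def by (rule sets_vimage_algebra_cong) (simp only: sets_pair_measure sets_measure_of[OF X])
    also have "\<dots> = sigma_sets (space M) {?f -` A \<inter> space M | A. A \<in> ?X}"
      unfolding vimage_algebra_sigma[OF X f] by (rule sets_measure_of) auto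
    also have "{?f -` A \<inter> space M | A. A \<in> ?X} = ?A"
    proof -
      have "?f -` (a \<times> b) \<inter> space M = (u -` a \<inter> space M) \<inter> ((\<lambda>\<omega>. \<lambda>k\<in>J. S k \<omega>) -` b \<inter> space M)" for a b
        by auto
      then show ?thesis by blast
    qed
    finally show ?thesis by simp
  qed
  moreover have "sigma_sets (space M) ?B = sets (vimage_algebra (space M) (S i) borel)"
    by (simp add: sets_vimage_algebra)
  ultimately show ?thesis by simp
qed

section \<open>Stochastic approximation of the zero of a strongly monotone map\<close>

lemma measurable_mono_sets:
  assumes "f \<in> measurable F N" "space F = space F'" "sets F \<subseteq> sets F'"
  shows "f \<in> measurable F' N"
proof (rule measurableI)
  show "f \<omega> \<in> space N" if "\<omega> \<in> space F'" for \<omega>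
    using measurable_space[OF assms(1)] that by (simp only: assms(2))
  show "f -` A \<inter> space F' \<in> sets F'" if "A \<in> sets N" for A
    using measurable_sets[OF assms(1) that] assms(3) unfolding assms(2) by (rule subsetD[rotated])
qed

lemma dominated_integral:
  fixes f g :: "'w \<Rightarrow> real"
  assumes f: "f \<in> borel_measurable M" "\<And>\<omega>. f \<omega> \<ge> 0" and g: "integrable M g"
    and g0: "\<And>\<omega>. g \<omega> \<ge> 0"
    and le: "(\<integral>\<^sup>+\<omega>. ennreal (f \<omega>) \<partial>M) \<le> (\<integral>\<^sup>+\<omega>. ennreal (g \<omega>) \<partial>M)"
  shows "integrable M f" "(\<integral>\<omega>. f \<omega> \<partial>M) \<le> (\<integral>\<omega>. g \<omega> \<partial>M)"
proof -
  have eq: "(\<integral>\<^sup>+\<omega>. ennreal (g \<omega>) \<partial>M) = ennreal (\<integral>\<omega>. g \<omega> \<partial>M)"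
    by (rule nn_integral_eq_integral[OF g]) (simp add: g0)
  show int: "integrable M f"
  proof (rule integrableI_nonneg)
    show "(\<integral>\<^sup>+\<omega>. ennreal (f \<omega>) \<partial>M) < \<infinity>"
      using le unfolding eq by (rule le_less_trans) simp
  qed (use f in auto)
  have "(\<integral>\<^sup>+\<omega>. ennreal (f \<omega>) \<partial>M) = ennreal (\<integral>\<omega>. f \<omega> \<partial>M)"
    by (rule nn_integral_eq_integral[OF int]) (simp add: f(2))
  with le eq have "ennreal (\<integral>\<omega>. f \<omega> \<partial>M) \<le> ennreal (\<integral>\<omega>. g \<omega> \<partial>M)" by (simp only:)
  moreover have "0 \<le> (\<integral>\<omega>. g \<omega> \<partial>M)" by (simp add: g0)
  ultimately show "(\<integral>\<omega>. f \<omega> \<partial>M) \<le> (\<integral>\<omega>. g \<omega> \<partial>M)" by (simp only: ennreal_le_iff)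
qed

lemma integrable_nonneg_bound:
  fixes f g :: "'w \<Rightarrow> real"
  assumes "integrable M g" "f \<in> borel_measurable M" "\<And>\<omega>. 0 \<le> f \<omega>" "\<And>\<omega>. f \<omega> \<le> g \<omega>"
  shows "integrable M f"
  using assms(1,2)
proof (rule Bochner_Integration.integrable_bound)
  have "norm (f \<omega>) \<le> norm (g \<omega>)" for \<omega> using assms(3,4)[of \<omega>] by simp
  then show "AE \<omega> in M. norm (f \<omega>) \<le> norm (g \<omega>)" by simp
qed

text \<open>Conditionally on the past, a step maps the error d = z - X, where X is the zero of H for the random parameter p, to
  d - t (H p z - H p X) minus t times centred noise. The deterministic part contracts by the strong
  monotonicity, and the variance of the noise is at most a multiple of 1 + |d|^2 + |X|^2. Taking expectations
  gives the recursion of \<open>decreasing_step_recursion\<close>, and H is Lipschitz, so the residual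
  H p z is controlled by d. The constant C is independent of the starting point, of the parameter
  and of the number of samples, which is essential because all of them change from stage to stage.\<close>

lemma stochastic_approximation_residual:
  fixes H :: "'p::euclidean_space \<Rightarrow> 'z::euclidean_space \<Rightarrow> 'z" and w :: "'z \<Rightarrow> 's \<Rightarrow> 'z"
    and M :: "'w measure"
  assumes prob: "prob_space M" and c: "c > 0" and step: "2 * c * \<gamma> > 1"
    and mono: "\<And>p u v. c * (norm (u - v))\<^sup>2 \<le> (u - v) \<bullet> (H p u - H p v)"
    and lip: "\<And>p u v. norm (H p u - H p v) \<le> L * norm (u - v)"
    and lipp: "\<And>p p' u. norm (H p u - H p' u) \<le> Lp * norm (p - p')"
    and \<xi>: "\<xi> \<in> measurable M N"
    and w: "(\<lambda>(z, s). w z s) \<in> borel_measurable (borel \<Otimes>\<^sub>M N)"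
    and W: "\<And>z. integrable M (\<lambda>\<omega>. w z (\<xi> \<omega>))" "\<And>z. (\<integral>\<omega>. w z (\<xi> \<omega>) \<partial>M) = 0"
      "\<And>z. integrable M (\<lambda>\<omega>. (norm (w z (\<xi> \<omega>)))\<^sup>2)"
      "\<And>z. (\<integral>\<omega>. (norm (w z (\<xi> \<omega>)))\<^sup>2 \<partial>M) \<le> v1 * (norm z)\<^sup>2 + v2"
  obtains C where "C \<ge> 0" "\<And>F S p z T. T \<ge> 1 \<Longrightarrow> fresh_samples M N \<xi> F S T \<Longrightarrow>
     (\<And>j \<omega>. j \<in> {1..<T} \<Longrightarrow> \<omega> \<in> space M \<Longrightarrow>
        z (Suc j) \<omega> = z j \<omega> - (\<gamma> / real j) *\<^sub>R (H (p \<omega>) (z j \<omega>) + w (z j \<omega>) (S j \<omega>))) \<Longrightarrow>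
     p \<in> borel_measurable (F 1) \<Longrightarrow> z 1 \<in> borel_measurable (F 1) \<Longrightarrow>
     (\<And>\<omega>. \<omega> \<in> space M \<Longrightarrow> norm (z 1 \<omega>) \<le> norm (p \<omega>)) \<Longrightarrow>
     integrable M (\<lambda>\<omega>. (norm (p \<omega>))\<^sup>2) \<Longrightarrow>
     z T \<in> borel_measurable (F T) \<and>
     integrable M (\<lambda>\<omega>. (norm (z T \<omega>))\<^sup>2) \<and>
     (\<integral>\<omega>. (norm (z T \<omega>))\<^sup>2 \<partial>M) \<le> C * (1 + (\<integral>\<omega>. (norm (p \<omega>))\<^sup>2 \<partial>M)) \<and>
     integrable M (\<lambda>\<omega>. (norm (H (p \<omega>) (z T \<omega>)))\<^sup>2) \<and>
     (\<integral>\<omega>. (norm (H (p \<omega>) (z T \<omega>)))\<^sup>2 \<partial>M) \<le> C / real T * (1 + (\<integral>\<omega>. (norm (p \<omega>))\<^sup>2 \<partial>M))"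
proof -
  interpret prob_space M by (rule prob)
  have "\<forall>p. \<exists>z. H p z = 0" using strongly_monotone_has_zero[OF c mono lip] by blast
  then obtain \<zeta> where \<zeta>: "\<And>p. H p (\<zeta> p) = 0" by metis
  define K where "K = \<bar>Lp / c\<bar>"
  have \<zeta>_lip: "norm (\<zeta> p - \<zeta> p') \<le> K * norm (p - p')" for p p'
  proof -
    have "norm (\<zeta> p - \<zeta> p') \<le> Lp / c * norm (p - p')"
      by (rule strongly_monotone_zero_lipschitz[OF c mono lipp \<zeta>])
    also have "\<dots> \<le> K * norm (p - p')" unfolding K_def by (intro mult_right_mono abs_ge_self) simp
    finally show ?thesis .
  qed
  have K0: "K \<ge> 0" by (simp add: K_def)
  have \<zeta>_cont: "continuous_on UNIV \<zeta>"
    by (rule lipschitz_on_continuous_on[of K]) (auto simp: lipschitz_on_def dist_norm \<zeta>_lip K0)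
  then have \<zeta>_meas: "\<zeta> \<in> borel_measurable borel" by (rule borel_measurable_continuous_onI)
  define K1 where "K1 = 2 * K\<^sup>2 + 2 * (norm (\<zeta> 0))\<^sup>2"
  have K1: "K1 \<ge> 0" by (simp add: K1_def)
  have \<zeta>_growth: "(norm (\<zeta> p))\<^sup>2 \<le> K1 * (1 + (norm p)\<^sup>2)" for p
  proof -
    have "(norm (\<zeta> p))\<^sup>2 \<le> 2 * (norm (\<zeta> p - \<zeta> 0))\<^sup>2 + 2 * (norm (\<zeta> 0))\<^sup>2"
      using norm_sum_sq_le[of "\<zeta> p - \<zeta> 0" "\<zeta> 0"] by simp
    also have "\<dots> \<le> 2 * (K\<^sup>2 * (norm p)\<^sup>2) + 2 * (norm (\<zeta> 0))\<^sup>2"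
      using power_mono[OF \<zeta>_lip[of p 0], of 2] by (simp add: power_mult_distrib)
    also have "\<dots> \<le> K1 * (1 + (norm p)\<^sup>2)"
      by (simp add: K1_def algebra_simps)
    finally show ?thesis .
  qed
  have H_cont: "continuous_on UNIV (\<lambda>q. H (fst q) (snd q))"
  proof (rule lipschitz_on_continuous_on[of "\<bar>Lp\<bar> + \<bar>L\<bar>"])
    have "norm (H p z - H p' z') \<le> (\<bar>Lp\<bar> + \<bar>L\<bar>) * norm ((p, z) - (p', z'))" for p p' z z'
    proof -
      have "norm (H p z - H p' z') \<le> norm (H p z - H p' z) + norm (H p' z - H p' z')"
        using norm_triangle_ineq[of "H p z - H p' z" "H p' z - H p' z'"] by simp
      also have "\<dots> \<le> \<bar>Lp\<bar> * norm (p - p') + \<bar>L\<bar> * norm (z - z')"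
        using lipp[of p z p'] lip[of p' z z']
          mult_right_mono[OF abs_ge_self, of "norm (p - p')" Lp]
          mult_right_mono[OF abs_ge_self, of "norm (z - z')" L] by simp
      also have "\<dots> \<le> \<bar>Lp\<bar> * norm ((p, z) - (p', z')) + \<bar>L\<bar> * norm ((p, z) - (p', z'))"
        using norm_fst_le[of "p - p'" "z - z'"] norm_snd_le[of "z - z'" "p - p'"]
        by (intro add_mono mult_left_mono) auto
      finally show ?thesis by (simp add: algebra_simps)
    qed
    then show "(\<bar>Lp\<bar> + \<bar>L\<bar>)-lipschitz_on UNIV (\<lambda>q. H (fst q) (snd q))"
      by (auto simp: lipschitz_on_def dist_norm)
  qed
  define m where "m = L\<^sup>2 + 2 * \<bar>v1\<bar>"
  have m: "m \<ge> 0" by (simp add: m_def)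
  obtain C0 where C0: "C0 \<ge> 0" and rec: "\<And>D b T. D \<ge> 0 \<Longrightarrow> (\<And>j. (b j :: real) \<ge> 0) \<Longrightarrow> T \<ge> 1 \<Longrightarrow>
     (\<And>j. 1 \<le> j \<Longrightarrow> j < T \<Longrightarrow>
        b (Suc j) \<le> (1 - 2 * (\<gamma> / real j) * c + (\<gamma> / real j)\<^sup>2 * m) * b j + (\<gamma> / real j)\<^sup>2 * D) \<Longrightarrow>
     b T \<le> C0 * (b 1 + D) / real T"
    by (fact decreasing_step_recursion[OF step m])
  define V where "V = 2 + 2 * K1 + 2 * \<bar>v1\<bar> * K1 + \<bar>v2\<bar>"
  have V: "V \<ge> 0" using K1 by (simp add: V_def)
  define C where "C = L\<^sup>2 * (C0 * V) + (2 * (C0 * V) + 2 * K1)"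
  have C: "C \<ge> 0" "L\<^sup>2 * (C0 * V) \<le> C" "2 * (C0 * V) + 2 * K1 \<le> C"
    using C0 V K1 by (auto simp: C_def)
  have "z T \<in> borel_measurable (F T) \<and>
     integrable M (\<lambda>\<omega>. (norm (z T \<omega>))\<^sup>2) \<and>
     (\<integral>\<omega>. (norm (z T \<omega>))\<^sup>2 \<partial>M) \<le> C * (1 + (\<integral>\<omega>. (norm (p \<omega>))\<^sup>2 \<partial>M)) \<and>
     integrable M (\<lambda>\<omega>. (norm (H (p \<omega>) (z T \<omega>)))\<^sup>2) \<and>
     (\<integral>\<omega>. (norm (H (p \<omega>) (z T \<omega>)))\<^sup>2 \<partial>M) \<le> C / real T * (1 + (\<integral>\<omega>. (norm (p \<omega>))\<^sup>2 \<partial>M))"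
    if T: "T \<ge> 1" and fresh: "fresh_samples M N \<xi> F S T"
     and update: "\<And>j \<omega>. j \<in> {1..<T} \<Longrightarrow> \<omega> \<in> space M \<Longrightarrow>
        z (Suc j) \<omega> = z j \<omega> - (\<gamma> / real j) *\<^sub>R (H (p \<omega>) (z j \<omega>) + w (z j \<omega>) (S j \<omega>))"
     and p1: "p \<in> borel_measurable (F 1)" and z1: "z 1 \<in> borel_measurable (F 1)"
     and z1p: "\<And>\<omega>. \<omega> \<in> space M \<Longrightarrow> norm (z 1 \<omega>) \<le> norm (p \<omega>)"
     and pint: "integrable M (\<lambda>\<omega>. (norm (p \<omega>))\<^sup>2)"
    for F :: "nat \<Rightarrow> 'w measure" and S :: "nat \<Rightarrow> 'w \<Rightarrow> 's" and p :: "'w \<Rightarrow> 'p"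
      and z :: "nat \<Rightarrow> 'w \<Rightarrow> 'z" and T
  proof -
    note sub = fresh_samplesD(1)[OF fresh] and mono_F = fresh_samplesD(2)[OF fresh]
      and S = fresh_samplesD(3-5)[OF fresh]
    have sp: "space (F j) = space M" if "1 \<le> j" "j \<le> T" for j
      using sub[of j] that by (auto simp: subalgebra_def)
    define X where "X \<omega> = \<zeta> (p \<omega>)" for \<omega>
    define d where "d j \<omega> = z j \<omega> - X \<omega>" for j \<omega>
    have p_meas: "p \<in> borel_measurable (F j)" if "1 \<le> j" "j \<le> T" for j
      using that
    proof (induction j rule: nat_induct_at_least)
      case base
      then show ?case using p1 by simp
    next
      case (Suc n)
      then have n: "n \<in> {1..<T}" and pn: "p \<in> borel_measurable (F n)" by auto
      from n show ?case
        by (intro measurable_mono_sets[OF pn] mono_F) (simp add: sp)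
    qed
    have X_meas: "X \<in> borel_measurable (F j)" if "1 \<le> j" "j \<le> T" for j
      unfolding X_def using measurable_compose[OF p_meas[OF that] \<zeta>_meas] .
    have toM: "f \<in> borel_measurable M" if "f \<in> borel_measurable (F j)" "1 \<le> j" "j \<le> T"
      for f :: "'w \<Rightarrow> 'b::topological_space" and j
      using that by (intro measurable_from_subalg[OF sub[of j]]) auto
    have XM: "X \<in> borel_measurable M" using toM[OF X_meas[of 1]] T by simp
    have pM: "p \<in> borel_measurable M" using toM[OF p_meas[of 1]] T by simp
    have HM: "(\<lambda>\<omega>. H (p \<omega>) (f \<omega>)) \<in> borel_measurable G"
      if "p \<in> borel_measurable G" "f \<in> borel_measurable G" for f G
      by (rule borel_measurable_continuous_Pair[OF that H_cont])
    define U where "U = (\<integral>\<omega>. (norm (p \<omega>))\<^sup>2 \<partial>M)"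
    define Z where "Z = (\<integral>\<omega>. (norm (z 1 \<omega>))\<^sup>2 \<partial>M)"
    have z1p2: "(norm (z 1 \<omega>))\<^sup>2 \<le> (norm (p \<omega>))\<^sup>2" if "\<omega> \<in> space M" for \<omega>
      using z1p[OF that] by (rule power_mono) simp
    have zint: "integrable M (\<lambda>\<omega>. (norm (z 1 \<omega>))\<^sup>2)"
    proof (rule Bochner_Integration.integrable_bound[OF pint])
      show "(\<lambda>\<omega>. (norm (z 1 \<omega>))\<^sup>2) \<in> borel_measurable M"
        using toM[OF z1] T by simp
      show "AE \<omega> in M. norm ((norm (z 1 \<omega>))\<^sup>2) \<le> norm ((norm (p \<omega>))\<^sup>2)"
        by (rule AE_I2) (use z1p2 in simp)
    qed
    have nn: "U \<ge> 0" "Z \<ge> 0" by (simp_all add: U_def Z_def)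
    have ZU: "Z \<le> U" unfolding Z_def U_def using zint pint z1p2 by (rule integral_mono)
    have XX: "(\<lambda>\<omega>. (norm (X \<omega>))\<^sup>2) \<in> borel_measurable M" using XM by measurable
    have Xint: "integrable M (\<lambda>\<omega>. (norm (X \<omega>))\<^sup>2)"
    proof (rule integrable_nonneg_bound[OF _ XX])
      show "integrable M (\<lambda>\<omega>. K1 * (1 + (norm (p \<omega>))\<^sup>2))" using pint by simp
      show "(norm (X \<omega>))\<^sup>2 \<le> K1 * (1 + (norm (p \<omega>))\<^sup>2)" for \<omega> unfolding X_def by (rule \<zeta>_growth)
    qed simp
    have Xbd: "(\<integral>\<omega>. (norm (X \<omega>))\<^sup>2 \<partial>M) \<le> K1 * (1 + U)"
    proof -
      have "(\<integral>\<omega>. (norm (X \<omega>))\<^sup>2 \<partial>M) \<le> (\<integral>\<omega>. K1 * (1 + (norm (p \<omega>))\<^sup>2) \<partial>M)"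
        using Xint pint by (intro integral_mono) (auto simp: X_def \<zeta>_growth)
      also have "\<dots> = K1 * (1 + U)" using pint by (simp add: U_def prob_space)
      finally show ?thesis .
    qed
    define D where "D = 2 * \<bar>v1\<bar> * (\<integral>\<omega>. (norm (X \<omega>))\<^sup>2 \<partial>M) + \<bar>v2\<bar>"
    have D: "D \<ge> 0" by (simp add: D_def)
    define t where "t j = \<gamma> / real j" for j
    have iter: "z j \<in> borel_measurable (F j) \<and> integrable M (\<lambda>\<omega>. (norm (d j \<omega>))\<^sup>2)
        \<and> (1 < j \<longrightarrow> (\<integral>\<omega>. (norm (d j \<omega>))\<^sup>2 \<partial>M) \<le> (1 - 2 * t (j - 1) * c + (t (j - 1))\<^sup>2 * m)
            * (\<integral>\<omega>. (norm (d (j - 1) \<omega>))\<^sup>2 \<partial>M) + (t (j - 1))\<^sup>2 * D)"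
      if "1 \<le> j" "j \<le> T" for j
      using that
    proof (induction j rule: nat_induct_at_least)
      case base
      have "integrable M (\<lambda>\<omega>. (norm (d 1 \<omega>))\<^sup>2)"
      proof (rule integrable_nonneg_bound)
        show "integrable M (\<lambda>\<omega>. 2 * (norm (z 1 \<omega>))\<^sup>2 + 2 * (norm (X \<omega>))\<^sup>2)" using zint Xint by auto
        show "(\<lambda>\<omega>. (norm (d 1 \<omega>))\<^sup>2) \<in> borel_measurable M"
          unfolding d_def using XM toM[OF z1] T by simp
      qed (auto simp: d_def norm_diff_sq_le)
      then show ?case using z1 by simp
    next
      case (Suc n)
      then have n: "1 \<le> n" "n < T" "n \<in> {1..<T}" and zn: "z n \<in> borel_measurable (F n)"
        and dn: "integrable M (\<lambda>\<omega>. (norm (d n \<omega>))\<^sup>2)" by auto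
      have St: "S n \<in> measurable (F (Suc n)) N" "distr M N (S n) = distr M N \<xi>"
        "indep_set (sets (F n)) (sets (vimage_algebra (space M) (S n) N))"
        "\<And>\<omega>. \<omega> \<in> space M \<Longrightarrow> z (Suc n) \<omega> = z n \<omega> - t n *\<^sub>R (H (p \<omega>) (z n \<omega>) + w (z n \<omega>) (S n \<omega>))"
        "sets (F n) \<subseteq> sets (F (Suc n))"
        using S[OF n(3)] update[OF n(3)] mono_F[OF n(3)] by (simp_all only: t_def)
      have subn: "subalgebra M (F n)" and subn': "subalgebra M (F (Suc n))" using sub[of n] sub[of "Suc n"] n by auto
      have SM: "S n \<in> measurable M N" using subn' St(1) by (rule measurable_from_subalg)
      have zn': "z n \<in> borel_measurable (F (Suc n))"
        using n by (intro measurable_mono_sets[OF zn _ St(5)]) (simp add: sp)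
      have z': "z (Suc n) \<in> borel_measurable (F (Suc n))"
      proof -
        have "(\<lambda>\<omega>. w (z n \<omega>) (S n \<omega>)) \<in> borel_measurable (F (Suc n))"
          using measurable_compose[OF measurable_Pair[OF zn' St(1)] w] by (simp only: prod.case)
        moreover have "(\<lambda>\<omega>. H (p \<omega>) (z n \<omega>)) \<in> borel_measurable (F (Suc n))"
          using n by (intro HM p_meas zn') auto
        ultimately have "(\<lambda>\<omega>. z n \<omega> - t n *\<^sub>R (H (p \<omega>) (z n \<omega>) + w (z n \<omega>) (S n \<omega>)))
            \<in> borel_measurable (F (Suc n))" using zn'
          by (intro borel_measurable_diff borel_measurable_scaleR borel_measurable_const borel_measurable_add)
        then show ?thesis
          by (rule measurable_cong[THEN iffD1, rotated]) (use St(4) sp[of "Suc n"] n in auto)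
      qed
      define a where "a \<omega> = d n \<omega> - t n *\<^sub>R H (p \<omega>) (z n \<omega>)" for \<omega>
      have a_meas: "a \<in> borel_measurable (F n)"
        unfolding a_def d_def using n zn
        by (intro borel_measurable_diff borel_measurable_scaleR borel_measurable_const X_meas HM p_meas) auto
      have t0: "\<gamma> > 0"
      proof (rule ccontr)
        assume "\<not> \<gamma> > 0"
        then have "c * \<gamma> \<le> 0" using c by (simp add: mult_nonneg_nonpos)
        moreover have "2 * (c * \<gamma>) > 1" using step by (simp only: mult.assoc)
        ultimately show False by linarith
      qed
      then have tn: "t n \<ge> 0" by (simp add: t_def)
      \<comment> \<open>A pointwise bound for the second moment of the new error, averaged over the current sample only.\<close>
      define g where "g \<omega> = (1 - 2 * t n * c + (t n)\<^sup>2 * m) * (norm (d n \<omega>))\<^sup>2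
          + (t n)\<^sup>2 * (2 * \<bar>v1\<bar> * (norm (X \<omega>))\<^sup>2 + \<bar>v2\<bar>)" for \<omega>
      have a_le: "(norm (a \<omega>))\<^sup>2 \<le> (1 - 2 * t n * c + (t n)\<^sup>2 * L\<^sup>2) * (norm (d n \<omega>))\<^sup>2" for \<omega>
        using strongly_monotone_step[OF mono lip tn, of "z n \<omega>" "X \<omega>" "p \<omega>"]
        by (simp add: a_def d_def X_def \<zeta>)
      have v_le: "v1 * (norm (z n \<omega>))\<^sup>2 + v2
          \<le> 2 * \<bar>v1\<bar> * (norm (d n \<omega>))\<^sup>2 + (2 * \<bar>v1\<bar> * (norm (X \<omega>))\<^sup>2 + \<bar>v2\<bar>)" for \<omega>
      proof -
        have "v1 * (norm (z n \<omega>))\<^sup>2 \<le> \<bar>v1\<bar> * (norm (z n \<omega>))\<^sup>2" by (intro mult_right_mono) auto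
        also have "\<dots> \<le> \<bar>v1\<bar> * (2 * (norm (d n \<omega>))\<^sup>2 + 2 * (norm (X \<omega>))\<^sup>2)"
          using norm_sum_sq_le[of "d n \<omega>" "X \<omega>"] by (intro mult_left_mono) (auto simp: d_def)
        finally show ?thesis by (simp add: algebra_simps)
      qed
      have g_ge: "(norm (a \<omega>))\<^sup>2 + (t n)\<^sup>2 * (v1 * (norm (z n \<omega>))\<^sup>2 + v2) \<le> g \<omega>" for \<omega>
        using a_le[of \<omega>] mult_left_mono[OF v_le[of \<omega>], of "(t n)\<^sup>2"]
        by (simp add: g_def m_def algebra_simps)
      have g0: "g \<omega> \<ge> 0" for \<omega>
      proof -
        have "0 \<le> (norm (a \<omega>))\<^sup>2" by simp
        also note a_le
        also have "(1 - 2 * t n * c + (t n)\<^sup>2 * L\<^sup>2) * (norm (d n \<omega>))\<^sup>2 \<le> g \<omega>"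
          unfolding g_def m_def by (simp add: algebra_simps)
        finally show ?thesis .
      qed
      have gint: "integrable M g" unfolding g_def using dn Xint by auto
      have "(\<integral>\<^sup>+\<omega>. ennreal ((norm (d (Suc n) \<omega>))\<^sup>2) \<partial>M)
          = (\<integral>\<^sup>+\<omega>. ennreal ((norm (a \<omega> - t n *\<^sub>R w (z n \<omega>) (S n \<omega>)))\<^sup>2) \<partial>M)"
        by (intro nn_integral_cong) (simp add: St(4) a_def d_def algebra_simps)
      also have "\<dots> \<le> (\<integral>\<^sup>+\<omega>. ennreal ((norm (a \<omega>))\<^sup>2 + (t n)\<^sup>2 * (v1 * (norm (z n \<omega>))\<^sup>2 + v2)) \<partial>M)"
        by (rule expected_square_noisy_step[OF subn a_meas zn SM St(3) \<xi> St(2) w W])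
      also have "\<dots> \<le> (\<integral>\<^sup>+\<omega>. ennreal (g \<omega>) \<partial>M)"
        by (intro nn_integral_mono ennreal_leI g_ge)
      finally have le: "(\<integral>\<^sup>+\<omega>. ennreal ((norm (d (Suc n) \<omega>))\<^sup>2) \<partial>M) \<le> (\<integral>\<^sup>+\<omega>. ennreal (g \<omega>) \<partial>M)" .
      have dM: "(\<lambda>\<omega>. (norm (d (Suc n) \<omega>))\<^sup>2) \<in> borel_measurable M"
        unfolding d_def using XM toM[OF z'] n by simp
      have "(\<integral>\<omega>. g \<omega> \<partial>M) = (1 - 2 * t n * c + (t n)\<^sup>2 * m) * (\<integral>\<omega>. (norm (d n \<omega>))\<^sup>2 \<partial>M) + (t n)\<^sup>2 * D"
        unfolding g_def D_def using dn Xint by (simp add: prob_space)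
      then show ?case
        using dominated_integral[OF dM _ gint g0 le] z' by simp
    qed
    have bT: "(\<integral>\<omega>. (norm (d T \<omega>))\<^sup>2 \<partial>M) \<le> C0 * ((\<integral>\<omega>. (norm (d 1 \<omega>))\<^sup>2 \<partial>M) + D) / real T"
    proof (rule rec[OF D _ T])
      fix j :: nat assume "1 \<le> j" "j < T"
      then show "(\<integral>\<omega>. (norm (d (Suc j) \<omega>))\<^sup>2 \<partial>M) \<le> (1 - 2 * (\<gamma> / real j) * c + (\<gamma> / real j)\<^sup>2 * m)
          * (\<integral>\<omega>. (norm (d j \<omega>))\<^sup>2 \<partial>M) + (\<gamma> / real j)\<^sup>2 * D"
        using iter[of "Suc j"] by (simp add: t_def)
    qed simp
    have b1: "(\<integral>\<omega>. (norm (d 1 \<omega>))\<^sup>2 \<partial>M) \<le> 2 * Z + 2 * (K1 * (1 + U))"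
    proof -
      have "(\<integral>\<omega>. (norm (d 1 \<omega>))\<^sup>2 \<partial>M) \<le> (\<integral>\<omega>. 2 * (norm (z 1 \<omega>))\<^sup>2 + 2 * (norm (X \<omega>))\<^sup>2 \<partial>M)"
        using iter[of 1] T zint Xint by (intro integral_mono) (auto simp: d_def norm_diff_sq_le)
      also have "\<dots> = 2 * Z + 2 * (\<integral>\<omega>. (norm (X \<omega>))\<^sup>2 \<partial>M)" using zint Xint by (simp add: Z_def)
      finally show ?thesis using Xbd by simp
    qed
    define E where "E = 1 + U"
    have E: "E \<ge> 1" using nn by (simp add: E_def)
    have "(\<integral>\<omega>. (norm (d 1 \<omega>))\<^sup>2 \<partial>M) + D \<le> V * E"
    proof -
      have "K1 * (1 + U) \<le> K1 * E" using K1 nn by (intro mult_left_mono) (auto simp: E_def)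
      moreover have "2 * \<bar>v1\<bar> * (\<integral>\<omega>. (norm (X \<omega>))\<^sup>2 \<partial>M) \<le> 2 * \<bar>v1\<bar> * (K1 * E)"
        using Xbd \<open>K1 * (1 + U) \<le> K1 * E\<close> by (intro mult_left_mono) auto
      moreover have "\<bar>v2\<bar> * 1 \<le> \<bar>v2\<bar> * E" using E by (intro mult_left_mono) auto
      moreover have "Z \<le> E" using nn ZU by (simp add: E_def)
      ultimately show ?thesis using b1 unfolding D_def V_def distrib_right by linarith
    qed
    then have "C0 * ((\<integral>\<omega>. (norm (d 1 \<omega>))\<^sup>2 \<partial>M) + D) / real T \<le> C0 * (V * E) / real T"
      using C0 by (intro divide_right_mono mult_left_mono) auto
    with bT have bT': "(\<integral>\<omega>. (norm (d T \<omega>))\<^sup>2 \<partial>M) \<le> C0 * V * E / real T" by (simp add: mult.assoc)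
    have zT: "z T \<in> borel_measurable (F T)" and dT: "integrable M (\<lambda>\<omega>. (norm (d T \<omega>))\<^sup>2)"
      using iter[of T] T by auto
    have zTM: "z T \<in> borel_measurable M" using toM[OF zT] T by simp
    have zT_le: "(norm (z T \<omega>))\<^sup>2 \<le> 2 * (norm (d T \<omega>))\<^sup>2 + 2 * (norm (X \<omega>))\<^sup>2" for \<omega>
      using norm_sum_sq_le[of "d T \<omega>" "X \<omega>"] by (simp add: d_def)
    have zTint: "integrable M (\<lambda>\<omega>. (norm (z T \<omega>))\<^sup>2)"
      by (rule integrable_nonneg_bound[OF _ _ _ zT_le]) (use dT Xint zTM in auto)
    have "(\<integral>\<omega>. (norm (z T \<omega>))\<^sup>2 \<partial>M) \<le> (\<integral>\<omega>. 2 * (norm (d T \<omega>))\<^sup>2 + 2 * (norm (X \<omega>))\<^sup>2 \<partial>M)"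
      using zTint dT Xint by (intro integral_mono zT_le) auto
    also have "\<dots> = 2 * (\<integral>\<omega>. (norm (d T \<omega>))\<^sup>2 \<partial>M) + 2 * (\<integral>\<omega>. (norm (X \<omega>))\<^sup>2 \<partial>M)"
      using dT Xint by simp
    also have "\<dots> \<le> 2 * (C0 * V * E) + 2 * (K1 * E)"
    proof -
      have "C0 * V * E / real T \<le> C0 * V * E / 1"
        using T C0 V E by (intro divide_left_mono) auto
      moreover have "K1 * (1 + U) \<le> K1 * E" using K1 nn by (intro mult_left_mono) (auto simp: E_def)
      ultimately show ?thesis using bT' Xbd by simp
    qed
    also have "\<dots> = (2 * (C0 * V) + 2 * K1) * E" by (simp add: algebra_simps)
    also have "\<dots> \<le> C * E" using C E by (intro mult_right_mono) auto
    finally have zbd: "(\<integral>\<omega>. (norm (z T \<omega>))\<^sup>2 \<partial>M) \<le> C * E" .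
    have H_le: "(norm (H (p \<omega>) (z T \<omega>)))\<^sup>2 \<le> L\<^sup>2 * (norm (d T \<omega>))\<^sup>2" for \<omega>
      using power_mono[OF lip[of "p \<omega>" "z T \<omega>" "X \<omega>"], of 2]
      by (simp add: power_mult_distrib X_def \<zeta> d_def)
    have Hint: "integrable M (\<lambda>\<omega>. (norm (H (p \<omega>) (z T \<omega>)))\<^sup>2)"
      by (rule integrable_nonneg_bound[OF _ _ _ H_le]) (use dT HM[OF pM zTM] in auto)
    have "(\<integral>\<omega>. (norm (H (p \<omega>) (z T \<omega>)))\<^sup>2 \<partial>M) \<le> (\<integral>\<omega>. L\<^sup>2 * (norm (d T \<omega>))\<^sup>2 \<partial>M)"
      using Hint dT by (intro integral_mono H_le) auto
    also have "\<dots> = L\<^sup>2 * (\<integral>\<omega>. (norm (d T \<omega>))\<^sup>2 \<partial>M)" by simp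
    also have "\<dots> \<le> L\<^sup>2 * (C0 * V * E / real T)" by (intro mult_left_mono bT') simp
    also have "\<dots> = L\<^sup>2 * (C0 * V) * (E / real T)" by simp
    also have "\<dots> \<le> C * (E / real T)" using C E by (intro mult_right_mono) auto
    finally have Hbd: "(\<integral>\<omega>. (norm (H (p \<omega>) (z T \<omega>)))\<^sup>2 \<partial>M) \<le> C / real T * E" by simp
    show ?thesis using zT zTint zbd Hint Hbd unfolding E_def U_def by blast
  qed
  then show ?thesis by (rule that[OF C(1)])
qed

section \<open>The block subproblems\<close>

text \<open>The gradient in the first block of the proximally regularized augmented Lagrangian, as a map of v
  with parameter (x, y, l), where x is the centre of the proximal term. Exchanging A with B gives the second block.\<close>

definition block_residual ::
  "real \<Rightarrow> real^'n^'p \<Rightarrow> real^'m^'p \<Rightarrow> real^'p \<Rightarrow> (real^'n \<Rightarrow> real^'n) \<Rightarrow> real^'n^'n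
    \<Rightarrow> (real^'n) \<times> (real^'m) \<times> (real^'p) \<Rightarrow> real^'n \<Rightarrow> real^'n" where
  "block_residual \<rho> A B b F P = (\<lambda>(x, y, l) v.
     F v - transpose A *v l + \<rho> *\<^sub>R (transpose A *v (A *v v + B *v y - b)) + P *v (v - x))"

lemma aug_lagrangian_swap: "aug_lagrangian \<rho> A B b f g x y l = aug_lagrangian \<rho> B A b g f y x l"
  by (simp add: aug_lagrangian_def add.commute)

lemma GDERIV_aug_lagrangian:
  assumes "GDERIV F v :> D"
  shows "GDERIV (\<lambda>v. aug_lagrangian \<rho> A B b F g v y l) v :>
    D - transpose A *v l + \<rho> *\<^sub>R (transpose A *v (A *v v + B *v y - b))"
proof -
  have lin: "((*v) A has_derivative (*v) A) (at v)"
    by (rule bounded_linear_imp_has_derivative) (rule matrix_vector_mul_bounded_linear)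
  have "((\<lambda>v. F v + g y - l \<bullet> (A *v v + B *v y - b)
        + \<rho> / 2 * ((A *v v + B *v y - b) \<bullet> (A *v v + B *v y - b))) has_derivative
      (\<lambda>h. h \<bullet> D + 0 - l \<bullet> (A *v h) + \<rho> / 2 * (((A *v v + B *v y - b) \<bullet> (A *v h)) + (A *v h) \<bullet> (A *v v + B *v y - b)))) (at v)"
    using assms lin unfolding gderiv_def
    by (auto intro!: derivative_eq_intros)
  moreover have "(\<lambda>h. h \<bullet> D + 0 - l \<bullet> (A *v h) + \<rho> / 2 * (((A *v v + B *v y - b) \<bullet> (A *v h)) + (A *v h) \<bullet> (A *v v + B *v y - b)))
      = (\<lambda>h. h \<bullet> (D - transpose A *v l + \<rho> *\<^sub>R (transpose A *v (A *v v + B *v y - b))))"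
    by (simp add: fun_eq_iff inner_add_right inner_diff_right inner_transpose inner_commute)
  ultimately show ?thesis unfolding gderiv_def aug_lagrangian_def power2_norm_eq_inner by simp
qed

lemma GDERIV_half_wnorm2:
  fixes P :: "real^'n^'n"
  assumes "transpose P = P"
  shows "GDERIV (\<lambda>v. 1 / 2 * wnorm2 ((*v) P) (v - z)) v :> P *v (v - z)"
proof -
  have lin: "((\<lambda>v. P *v (v - z)) has_derivative (*v) P) (at v)"
  proof -
    have "((*v) P has_derivative (*v) P) (at v)"
      by (rule bounded_linear_imp_has_derivative) (rule matrix_vector_mul_bounded_linear)
    from has_derivative_diff[OF this has_derivative_const[of "P *v z"]]
    show ?thesis by (simp add: matrix_vector_mult_diff_distrib)
  qed
  have "((\<lambda>v. 1 / 2 * ((v - z) \<bullet> (P *v (v - z)))) has_derivative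
     (\<lambda>h. 1 / 2 * ((v - z) \<bullet> (P *v h) + h \<bullet> (P *v (v - z))))) (at v)"
    using lin by (auto intro!: derivative_eq_intros)
  moreover have "(v - z) \<bullet> (P *v h) = h \<bullet> (P *v (v - z))" for h
    using inner_transpose(1)[of "v - z" P h] assms by (simp add: inner_commute)
  ultimately show ?thesis unfolding gderiv_def wnorm2_def by simp
qed

lemma gradient_regularized_aug_lagrangian:
  fixes f :: "real^'n \<Rightarrow> real"
  assumes "f differentiable (at v)" "transpose P = P"
  shows "GDERIV (\<lambda>v. aug_lagrangian \<rho> A B b f g v y l + 1 / 2 * wnorm2 ((*v) P) (v - x)) v :>
    block_residual \<rho> A B b (gradient f) P (x, y, l) v"
  unfolding block_residual_def prod.case
  by (intro GDERIV_add GDERIV_aug_lagrangian GDERIV_gradient GDERIV_half_wnorm2 assms)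

text \<open>The parameter enters the residual only through a linear map.\<close>

lemma block_residual_parameter_lipschitz:
  fixes A :: "real^'n^'p" and B :: "real^'m^'p"
  obtains K where "\<And>p p' u. norm (block_residual \<rho> A B b F P p u - block_residual \<rho> A B b F P p' u) \<le> K * norm (p - p')"
proof -
  define A' where "A' = transpose A"
  define T :: "(real^'n) \<times> (real^'m) \<times> (real^'p) \<Rightarrow> real^'n" where
    "T = (\<lambda>(x, y, l). \<rho> *\<^sub>R (A' *v (B *v y)) - A' *v l - P *v x)"
  have "linear T"
    by (rule linearI)
      (auto simp: T_def matrix_vector_right_distrib matrix_vector_mult_scaleR algebra_simps)
  then obtain K where K: "\<And>q. norm (T q) \<le> norm q * K"
    using bounded_linear.pos_bounded[of T] by (auto simp: linear_conv_bounded_linear)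
  have "block_residual \<rho> A B b F P p u - block_residual \<rho> A B b F P p' u = T (p - p')" for p p' u
    by (cases p; cases p')
      (simp add: T_def block_residual_def A'_def[symmetric] matrix_vector_right_distrib matrix_vector_mult_diff_distrib algebra_simps)
  then show ?thesis using K that[of K] by (simp add: mult.commute)
qed

lemma borel_measurable_grad_noise:
  assumes meas: "\<And>z. F z \<in> borel_measurable N"
    and diff: "\<And>s z. s \<in> space N \<Longrightarrow> (\<lambda>z. F z s) differentiable (at z)"
    and f: "L-lipschitz_on UNIV (gradient f)"
  shows "(\<lambda>(z, s). grad_noise F f z s) \<in> borel_measurable (borel \<Otimes>\<^sub>M N)"
proof -
  have "gradient f \<in> borel_measurable borel"
    using f by (intro borel_measurable_continuous_onI lipschitz_on_continuous_on)
  then have "(\<lambda>p. gradient f (fst p)) \<in> borel_measurable (borel \<Otimes>\<^sub>M N)"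
    by (rule measurable_compose[OF measurable_fst])
  with borel_measurable_sampled_gradient[OF meas diff] show ?thesis
    unfolding grad_noise_def case_prod_unfold by (rule borel_measurable_diff)
qed

text \<open>The inner loop for one block, seen as stochastic approximation: the sampled gradient of the
  regularized augmented Lagrangian is the block residual plus the gradient noise.\<close>

lemma block_stage:
  fixes f :: "real^'n \<Rightarrow> real" and A :: "real^'n^'p" and B :: "real^'m^'p" and M :: "'w measure"
    and ft :: "real^'n \<Rightarrow> 'd \<Rightarrow> real" and N :: "'d measure"
  assumes prob: "prob_space M" and \<xi>: "\<xi> \<in> measurable M N"
    and meas: "\<And>z. ft z \<in> borel_measurable N"
    and diff: "\<forall>s\<in>space N. \<forall>z. (\<lambda>z. ft z s) differentiable (at z)"
    and f: "\<And>z. f differentiable (at z)" "Lf-lipschitz_on UNIV (gradient f)"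
    and P: "transpose P = P"
    and sc: "\<And>y l z. strongly_convex c
          (\<lambda>v. aug_lagrangian \<rho> A B b f g v y l + 1 / 2 * wnorm2 ((*v) P) (v - z))"
    and L: "\<And>y l z. L-lipschitz_on UNIV
          (gradient (\<lambda>v. aug_lagrangian \<rho> A B b f g v y l + 1 / 2 * wnorm2 ((*v) P) (v - z)))"
    and step: "2 * c * \<gamma> > 1" and moment: "moment_condition M \<xi> ft f v1 v2"
  obtains C where "C \<ge> 0" "\<And>F S x y l z T. T \<ge> 1 \<Longrightarrow> fresh_samples M N \<xi> F S T \<Longrightarrow>
     (\<And>j \<omega>. j \<in> {1..<T} \<Longrightarrow> \<omega> \<in> space M \<Longrightarrow> z (Suc j) \<omega> = z j \<omega> - (\<gamma> / real j) *\<^sub>R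
         (gradient (\<lambda>v. aug_lagrangian \<rho> A B b (\<lambda>u. ft u (S j \<omega>)) g v (y \<omega>) (l \<omega>)) (z j \<omega>)
           + P *v (z j \<omega> - x \<omega>))) \<Longrightarrow>
     (\<lambda>\<omega>. (x \<omega>, y \<omega>, l \<omega>)) \<in> borel_measurable (F 1) \<Longrightarrow>
     (\<And>\<omega>. \<omega> \<in> space M \<Longrightarrow> z 1 \<omega> = x \<omega>) \<Longrightarrow>
     integrable M (\<lambda>\<omega>. (norm (x \<omega>, y \<omega>, l \<omega>))\<^sup>2) \<Longrightarrow>
     z T \<in> borel_measurable (F T) \<and>
     integrable M (\<lambda>\<omega>. (norm (z T \<omega>))\<^sup>2) \<and>
     (\<integral>\<omega>. (norm (z T \<omega>))\<^sup>2 \<partial>M) \<le> C * (1 + (\<integral>\<omega>. (norm (x \<omega>, y \<omega>, l \<omega>))\<^sup>2 \<partial>M)) \<and>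
     integrable M (\<lambda>\<omega>. (norm (block_residual \<rho> A B b (gradient f) P (x \<omega>, y \<omega>, l \<omega>) (z T \<omega>)))\<^sup>2) \<and>
     (\<integral>\<omega>. (norm (block_residual \<rho> A B b (gradient f) P (x \<omega>, y \<omega>, l \<omega>) (z T \<omega>)))\<^sup>2 \<partial>M)
       \<le> C / real T * (1 + (\<integral>\<omega>. (norm (x \<omega>, y \<omega>, l \<omega>))\<^sup>2 \<partial>M))"
proof -
  let ?H = "block_residual \<rho> A B b (gradient f) P"
  let ?\<Phi> = "\<lambda>x y l v. aug_lagrangian \<rho> A B b f g v y l + 1 / 2 * wnorm2 ((*v) P) (v - x)"
  have der: "GDERIV (?\<Phi> x y l) v :> ?H (x, y, l) v" for x y l v
    by (rule gradient_regularized_aug_lagrangian[OF f(1) P])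
  have grad: "gradient (?\<Phi> x y l) = ?H (x, y, l)" for x y l
    using gradient_eqI[OF der] by blast
  have \<Phi>_diff: "?\<Phi> x y l differentiable (at v)" for x y l v
    using der unfolding gderiv_def differentiable_def by blast
  have c: "c > 0" using sc by (auto simp: strongly_convex_def)
  have mono: "c * (norm (u - v))\<^sup>2 \<le> (u - v) \<bullet> (?H p u - ?H p v)" for p u v
  proof -
    obtain x y l where p: "p = (x, y, l)" by (cases p)
    show ?thesis
      using strongly_convex_gradient_monotone[OF sc \<Phi>_diff, of u v y l x] unfolding grad p .
  qed
  have lip: "norm (?H p u - ?H p v) \<le> L * norm (u - v)" for p u v
  proof -
    obtain x y l where p: "p = (x, y, l)" by (cases p)
    show ?thesis
      using lipschitz_onD[OF L[of y l x] UNIV_I UNIV_I, of u v] unfolding grad p dist_norm .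
  qed
  obtain Lp where lipp: "\<And>p p' u. norm (?H p u - ?H p' u) \<le> Lp * norm (p - p')"
    using block_residual_parameter_lipschitz by blast
  have noise_meas: "(\<lambda>(z, s). grad_noise ft f z s) \<in> borel_measurable (borel \<Otimes>\<^sub>M N)"
    using meas _ f(2) by (rule borel_measurable_grad_noise) (use diff in blast)
  have W: "integrable M (\<lambda>\<omega>. grad_noise ft f z (\<xi> \<omega>))" "(\<integral>\<omega>. grad_noise ft f z (\<xi> \<omega>) \<partial>M) = 0"
      "integrable M (\<lambda>\<omega>. (norm (grad_noise ft f z (\<xi> \<omega>)))\<^sup>2)"
      "(\<integral>\<omega>. (norm (grad_noise ft f z (\<xi> \<omega>)))\<^sup>2 \<partial>M) \<le> v1 * (norm z)\<^sup>2 + v2" for z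
    using moment by (auto simp: moment_condition_def)
  obtain C where C: "C \<ge> 0" and main: "\<And>F S p z T. T \<ge> 1 \<Longrightarrow> fresh_samples M N \<xi> F S T \<Longrightarrow>
     (\<And>j \<omega>. j \<in> {1..<T} \<Longrightarrow> \<omega> \<in> space M \<Longrightarrow>
        z (Suc j) \<omega> = z j \<omega> - (\<gamma> / real j) *\<^sub>R (?H (p \<omega>) (z j \<omega>) + grad_noise ft f (z j \<omega>) (S j \<omega>))) \<Longrightarrow>
     p \<in> borel_measurable (F 1) \<Longrightarrow> z 1 \<in> borel_measurable (F 1) \<Longrightarrow>
     (\<And>\<omega>. \<omega> \<in> space M \<Longrightarrow> norm (z 1 \<omega>) \<le> norm (p \<omega>)) \<Longrightarrow>
     integrable M (\<lambda>\<omega>. (norm (p \<omega>))\<^sup>2) \<Longrightarrow>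
     z T \<in> borel_measurable (F T) \<and>
     integrable M (\<lambda>\<omega>. (norm (z T \<omega>))\<^sup>2) \<and>
     (\<integral>\<omega>. (norm (z T \<omega>))\<^sup>2 \<partial>M) \<le> C * (1 + (\<integral>\<omega>. (norm (p \<omega>))\<^sup>2 \<partial>M)) \<and>
     integrable M (\<lambda>\<omega>. (norm (?H (p \<omega>) (z T \<omega>)))\<^sup>2) \<and>
     (\<integral>\<omega>. (norm (?H (p \<omega>) (z T \<omega>)))\<^sup>2 \<partial>M) \<le> C / real T * (1 + (\<integral>\<omega>. (norm (p \<omega>))\<^sup>2 \<partial>M))"
    by (fact stochastic_approximation_residual[OF prob c step mono lip lipp \<xi> noise_meas W])
  show ?thesis
  proof (rule that[OF C])
    fix F S x y l z and T :: nat
    assume T: "T \<ge> 1" and fresh: "fresh_samples M N \<xi> F S T"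
      and upd: "\<And>j \<omega>. j \<in> {1..<T} \<Longrightarrow> \<omega> \<in> space M \<Longrightarrow> z (Suc j) \<omega> = z j \<omega> - (\<gamma> / real j) *\<^sub>R
         (gradient (\<lambda>v. aug_lagrangian \<rho> A B b (\<lambda>u. ft u (S j \<omega>)) g v (y \<omega>) (l \<omega>)) (z j \<omega>)
           + P *v (z j \<omega> - x \<omega>))"
      and p: "(\<lambda>\<omega>. (x \<omega>, y \<omega>, l \<omega>)) \<in> borel_measurable (F 1)"
      and z1: "\<And>\<omega>. \<omega> \<in> space M \<Longrightarrow> z 1 \<omega> = x \<omega>"
      and pint: "integrable M (\<lambda>\<omega>. (norm (x \<omega>, y \<omega>, l \<omega>))\<^sup>2)"
    note sub = fresh_samplesD(1)[OF fresh] and S = fresh_samplesD(3)[OF fresh]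
    let ?p = "\<lambda>\<omega>. (x \<omega>, y \<omega>, l \<omega>)"
    have upd': "z (Suc j) \<omega> = z j \<omega> - (\<gamma> / real j) *\<^sub>R (?H (?p \<omega>) (z j \<omega>) + grad_noise ft f (z j \<omega>) (S j \<omega>))"
      if j: "j \<in> {1..<T}" and \<omega>: "\<omega> \<in> space M" for j \<omega>
    proof -
      have "subalgebra M (F (Suc j))" using sub[of "Suc j"] j by auto
      then have "S j \<omega> \<in> space N"
        using measurable_space[OF S[OF j]] \<omega> by (auto simp: subalgebra_def)
      with diff have "(\<lambda>u. ft u (S j \<omega>)) differentiable (at (z j \<omega>))" by blast
      then have grad_eq: "gradient (\<lambda>v. aug_lagrangian \<rho> A B b (\<lambda>u. ft u (S j \<omega>)) g v (y \<omega>) (l \<omega>)) (z j \<omega>)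
        = gradient (\<lambda>u. ft u (S j \<omega>)) (z j \<omega>) - transpose A *v l \<omega>
          + \<rho> *\<^sub>R (transpose A *v (A *v z j \<omega> + B *v y \<omega> - b))"
        by (intro gradient_eqI GDERIV_aug_lagrangian GDERIV_gradient)
      show ?thesis
        unfolding upd[OF j \<omega>] grad_eq block_residual_def prod.case grad_noise_def
        by (rule arg_cong[where f = "\<lambda>q. z j \<omega> - (\<gamma> / real j) *\<^sub>R q"]) (simp add: algebra_simps)
    qed
    have sp1: "space (F 1) = space M" using sub[of 1] T by (auto simp: subalgebra_def)
    have "x \<in> borel_measurable (F 1)"
      using measurable_compose[OF p borel_measurable_continuous_onI[OF continuous_on_fst[OF continuous_on_id]]] by simp
    then have z1_meas: "z 1 \<in> borel_measurable (F 1)"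
      by (rule measurable_cong[THEN iffD1, rotated]) (simp only: sp1 z1)
    have z1p: "norm (z 1 \<omega>) \<le> norm (?p \<omega>)" if "\<omega> \<in> space M" for \<omega>
      using norm_fst_le[of "x \<omega>" "(y \<omega>, l \<omega>)"] by (simp only: z1[OF that])
    show "z T \<in> borel_measurable (F T) \<and>
     integrable M (\<lambda>\<omega>. (norm (z T \<omega>))\<^sup>2) \<and>
     (\<integral>\<omega>. (norm (z T \<omega>))\<^sup>2 \<partial>M) \<le> C * (1 + (\<integral>\<omega>. (norm (?p \<omega>))\<^sup>2 \<partial>M)) \<and>
     integrable M (\<lambda>\<omega>. (norm (?H (?p \<omega>) (z T \<omega>)))\<^sup>2) \<and>
     (\<integral>\<omega>. (norm (?H (?p \<omega>) (z T \<omega>)))\<^sup>2 \<partial>M)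
       \<le> C / real T * (1 + (\<integral>\<omega>. (norm (?p \<omega>))\<^sup>2 \<partial>M))"
      by (rule main[OF T fresh upd' p z1_meas z1p pint])
  qed
qed

section \<open>Almost sure convergence\<close>

lemma range_restricted_sample:
  assumes "S \<in> borel_measurable M" "S ` space M \<subseteq> \<Xi>"
  shows "S \<in> measurable M (restrict_space borel \<Xi>)"
  using assms by (intro measurable_restrict_space2) auto

text \<open>The range \<open>\<Xi>\<close> is an arbitrary set, and the sampled objectives are measurable only on
  it. Laws are therefore compared on the trace sigma-algebra: for variables with values in
  \<open>\<Xi>\<close>, a Borel set and its trace have the same preimage.\<close>

lemma distr_restrict_space_eq:
  assumes S: "S \<in> borel_measurable M" "S ` space M \<subseteq> \<Xi>" and X: "X \<in> borel_measurable M" "X ` space M \<subseteq> \<Xi>"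
    and eq: "distr M borel S = distr M borel X"
  shows "distr M (restrict_space borel \<Xi>) S = distr M (restrict_space borel \<Xi>) X"
proof (rule measure_eqI)
  fix A assume "A \<in> sets (distr M (restrict_space borel \<Xi>) S)"
  then have A: "A \<in> sets (restrict_space borel \<Xi>)" by simp
  then obtain B where B: "B \<in> sets borel" "A = \<Xi> \<inter> B" by (auto simp: sets_restrict_space)
  have "S -` A \<inter> space M = S -` B \<inter> space M" "X -` A \<inter> space M = X -` B \<inter> space M"
    using S(2) X(2) B(2) by auto
  moreover have "emeasure M (S -` B \<inter> space M) = emeasure M (X -` B \<inter> space M)"
    using arg_cong[OF eq, of "\<lambda>D. emeasure D B"] B(1) S(1) X(1) by (simp add: emeasure_distr)
  ultimately show "emeasure (distr M (restrict_space borel \<Xi>) S) A = emeasure (distr M (restrict_space borel \<Xi>) X) A"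
    using A range_restricted_sample[OF S] range_restricted_sample[OF X] by (simp add: emeasure_distr)
qed simp

lemma (in prob_space) fresh_samples_past:
  fixes S :: "'i \<Rightarrow> 'a \<Rightarrow> 'd::topological_space"
  assumes u: "u \<in> borel_measurable M" "indep_of_family M u S I"
    and iid: "iid_copies M \<xi> \<Xi> S I" and \<xi>: "\<xi> \<in> borel_measurable M" "\<xi> ` space M \<subseteq> \<Xi>"
    and J: "\<And>j. j \<in> {1..T} \<Longrightarrow> J j \<subseteq> I" "\<And>j. j \<in> {1..<T} \<Longrightarrow> J j \<subseteq> J (Suc j)"
    and i: "\<And>j. j \<in> {1..<T} \<Longrightarrow> i j \<in> J (Suc j) - J j"
  shows "fresh_samples M (restrict_space borel \<Xi>) \<xi> (\<lambda>j. past M u S (J j)) (\<lambda>j. S (i j)) T"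
  unfolding fresh_samples_def
proof (intro conjI ballI)
  have S: "indep_vars (\<lambda>_. borel) S I" "\<And>k. k \<in> I \<Longrightarrow> S k \<in> borel_measurable M"
    "\<And>k. k \<in> I \<Longrightarrow> S k ` space M \<subseteq> \<Xi>" "\<And>k. k \<in> I \<Longrightarrow> distr M borel (S k) = distr M borel \<xi>"
    using iid by (auto simp: iid_copies_def indep_vars_def)
  fix j assume "j \<in> {1..T}"
  then show "subalgebra M (past M u S (J j))"
    unfolding subalgebra_def using J(1)[of j] by (intro conjI sets_past_subset u(1) S(2)) auto
next
  have S: "indep_vars (\<lambda>_. borel) S I" "\<And>k. k \<in> I \<Longrightarrow> S k \<in> borel_measurable M"
    "\<And>k. k \<in> I \<Longrightarrow> S k ` space M \<subseteq> \<Xi>" "\<And>k. k \<in> I \<Longrightarrow> distr M borel (S k) = distr M borel \<xi>"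
    using iid by (auto simp: iid_copies_def indep_vars_def)
  fix j assume j: "j \<in> {1..<T}"
  have iI: "i j \<in> I" using i[OF j] J(1)[of "Suc j"] j by auto
  show "sets (past M u S (J j)) \<subseteq> sets (past M u S (J (Suc j)))"
    by (rule sets_past_mono) (rule J(2)[OF j])
  show "S (i j) \<in> measurable (past M u S (J (Suc j))) (restrict_space borel \<Xi>)"
    using i[OF j] S(3)[OF iI] by (intro range_restricted_sample measurable_past_sample) auto
  show "distr M (restrict_space borel \<Xi>) (S (i j)) = distr M (restrict_space borel \<Xi>) \<xi>"
    by (rule distr_restrict_space_eq[OF S(2)[OF iI] S(3)[OF iI] \<xi> S(4)[OF iI]])
  have sub: "sets (vimage_algebra (space M) (S (i j)) (restrict_space borel \<Xi>))
      \<subseteq> sets (vimage_algebra (space M) (S (i j)) borel)"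
  proof (rule sets_image_in_sets)
    have "S (i j) \<in> borel_measurable (vimage_algebra (space M) (S (i j)) borel)"
      by (rule measurable_vimage_algebra1) simp
    then show "S (i j) \<in> measurable (vimage_algebra (space M) (S (i j)) borel) (restrict_space borel \<Xi>)"
      using S(3)[OF iI] by (intro range_restricted_sample) simp_all
  qed simp
  have "indep_set (sets (past M u S (J j))) (sets (vimage_algebra (space M) (S (i j)) borel))"
    using i[OF j] J(1)[of j] j by (intro indep_past_sample[OF u S(1) _ iI]) auto
  then show "indep_set (sets (past M u S (J j))) (sets (vimage_algebra (space M) (S (i j)) (restrict_space borel \<Xi>)))"
    using sub unfolding indep_sets2_eq by blast
qed

text \<open>By monotone convergence the sum of the a(k) has a finite integral, so the series converges almost
  everywhere.\<close>

lemma AE_tendsto_zero_of_summable_integrals: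
  fixes a :: "nat \<Rightarrow> 'w \<Rightarrow> real"
  assumes int: "\<And>k. integrable M (a k)" and nonneg: "\<And>k \<omega>. 0 \<le> a k \<omega>"
    and sum: "summable (\<lambda>k. \<integral>\<omega>. a k \<omega> \<partial>M)"
  shows "AE \<omega> in M. (\<lambda>k. a k \<omega>) \<longlonglongrightarrow> 0"
proof -
  have meas: "(\<lambda>\<omega>. ennreal (a k \<omega>)) \<in> borel_measurable M" for k using int[of k] by measurable
  have "(\<integral>\<^sup>+\<omega>. (\<Sum>k. ennreal (a k \<omega>)) \<partial>M) = (\<Sum>k. \<integral>\<^sup>+\<omega>. ennreal (a k \<omega>) \<partial>M)"
    using meas by (rule nn_integral_suminf)
  also have "\<dots> = (\<Sum>k. ennreal (\<integral>\<omega>. a k \<omega> \<partial>M))"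
    by (intro arg_cong[where f = suminf] ext nn_integral_eq_integral int) (simp add: nonneg)
  also have "\<dots> = ennreal (\<Sum>k. \<integral>\<omega>. a k \<omega> \<partial>M)"
    using sum by (intro suminf_ennreal2) (simp_all add: nonneg)
  finally have "(\<integral>\<^sup>+\<omega>. (\<Sum>k. ennreal (a k \<omega>)) \<partial>M) \<noteq> \<infinity>" by simp
  then have "AE \<omega> in M. (\<Sum>k. ennreal (a k \<omega>)) \<noteq> \<infinity>"
    using meas by (intro nn_integral_PInf_AE borel_measurable_suminf_order) auto
  then show ?thesis
  proof eventually_elim
    fix \<omega> assume "(\<Sum>k. ennreal (a k \<omega>)) \<noteq> \<infinity>"
    then have "summable (\<lambda>k. a k \<omega>)" by (intro summable_suminf_not_top) (simp_all add: nonneg)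
    then show "(\<lambda>k. a k \<omega>) \<longlonglongrightarrow> 0" by (rule summable_LIMSEQ_zero)
  qed
qed

lemma kkt_point_gradients:
  fixes f :: "real^'n \<Rightarrow> real" and g :: "real^'m \<Rightarrow> real"
  assumes "kkt_point A B b f g (x, y, l)" "\<And>v. f differentiable (at v)" "\<And>v. g differentiable (at v)"
  shows "gradient f x = transpose A *v l" "gradient g y = transpose B *v l" "A *v x + B *v y = b"
  using assms unfolding kkt_point_def prod.case by (blast intro: subdifferential_gradient)+

lemma transpose_P_hat_symmetric:
  fixes A :: "real^'n^'p"
  assumes "transpose (P_hat \<rho> A P) = P_hat \<rho> A P"
  shows "transpose P = P"
proof -
  have "transpose (transpose A ** A) = transpose A ** A" by (simp add: matrix_transpose_mul)
  then show ?thesis using assms unfolding P_hat_def by (simp add: vec_eq_iff transpose_def)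
qed

text \<open>Adding \<open>(2 - \<gamma>) \<rho>\<close> A^T A to both sides turns the condition on P into a comparison of
  \<open>(2 - \<gamma>)\<close> times P + rho A^T A with rho A^T A; in the remaining case P = 0,
  \<open>\<gamma> = 1\<close> the two sides are equal. As P + rho A^T A is positive definite and
  rho A^T A is positive semidefinite, \<open>\<gamma> < 2\<close>.\<close>

lemma relaxation_condition:
  fixes A :: "real^'n^'p"
  assumes \<rho>: "\<rho> > 0" and pd: "positive_definite (P_hat \<rho> A P)"
    and cond: "P \<noteq> 0 \<Longrightarrow> loewner_greater ((2 - \<gamma>) *\<^sub>R P) (((\<gamma> - 1) * \<rho>) *\<^sub>R (transpose A ** A))"
      "P = 0 \<Longrightarrow> \<gamma> = 1"
  shows "\<gamma> < 2" and "\<rho> * (norm (A *v z))\<^sup>2 \<le> (2 - \<gamma>) * (z \<bullet> (P_hat \<rho> A P *v z))"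
proof -
  have hat: "z \<bullet> (P_hat \<rho> A P *v z) = z \<bullet> (P *v z) + \<rho> * (norm (A *v z))\<^sup>2" for z
    by (simp add: P_hat_mult inner_add_right inner_transpose power2_norm_eq_inner)
  have strict: "\<rho> * (norm (A *v z))\<^sup>2 < (2 - \<gamma>) * (z \<bullet> (P_hat \<rho> A P *v z))" if "P \<noteq> 0" "z \<noteq> 0" for z
  proof -
    have "0 < z \<bullet> (((2 - \<gamma>) *\<^sub>R P - ((\<gamma> - 1) * \<rho>) *\<^sub>R (transpose A ** A)) *v z)"
      using cond(1)[OF that(1)] that(2) unfolding loewner_greater_def positive_definite_def by blast
    also have "\<dots> = (2 - \<gamma>) * (z \<bullet> (P *v z)) - (\<gamma> - 1) * \<rho> * (norm (A *v z))\<^sup>2"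
      by (simp add: matrix_vector_mult_diff_rdistrib scaleR_matrix_vector_assoc[symmetric] inner_diff_right
          matrix_vector_mul_assoc[symmetric] inner_transpose power2_norm_eq_inner)
    finally show ?thesis unfolding hat by (simp add: algebra_simps)
  qed
  show "\<gamma> < 2"
  proof (cases "P = 0")
    case False
    obtain e :: "real^'n" where e: "e \<noteq> 0" using nonempty_Basis nonzero_Basis by blast
    have "0 \<le> \<rho> * (norm (A *v e))\<^sup>2" using \<rho> by simp
    also note strict[OF False e]
    finally have "0 < (2 - \<gamma>) * (e \<bullet> (P_hat \<rho> A P *v e))" .
    moreover have "0 < e \<bullet> (P_hat \<rho> A P *v e)" using pd e by (simp add: positive_definite_def)
    ultimately show ?thesis by (simp add: zero_less_mult_iff)
  qed (simp add: cond(2))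
  show "\<rho> * (norm (A *v z))\<^sup>2 \<le> (2 - \<gamma>) * (z \<bullet> (P_hat \<rho> A P *v z))"
  proof (cases "P = 0 \<or> z = 0")
    case True
    then show ?thesis using cond(2) unfolding hat by auto
  next
    case False
    then show ?thesis using strict[of z] by simp
  qed
qed

lemma G_op_positive:
  assumes pos: "\<rho> > 0" "\<gamma> > 0" and pd: "positive_definite (P_hat \<rho> A P)" "positive_definite Q" and z: "z \<noteq> 0"
  shows "z \<bullet> G_op \<rho> \<gamma> A P Q z > 0"
proof -
  obtain x y l where z': "z = (x, y, l)" by (cases z)
  have nonneg: "0 \<le> v \<bullet> (D *v v)" if "positive_definite D" for D :: "real^'k^'k" and v
    using that by (cases "v = 0") (auto simp: positive_definite_def less_imp_le)
  have ge: "0 \<le> x \<bullet> (P_hat \<rho> A P *v x)" "0 \<le> y \<bullet> (Q *v y)" "0 \<le> (l \<bullet> l) / (\<rho> * \<gamma>)"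
    using pd pos by (simp_all add: nonneg)
  have "x \<noteq> 0 \<or> y \<noteq> 0 \<or> l \<noteq> 0" using z by (auto simp: z' zero_prod_def)
  then have "0 < x \<bullet> (P_hat \<rho> A P *v x) \<or> 0 < y \<bullet> (Q *v y) \<or> 0 < (l \<bullet> l) / (\<rho> * \<gamma>)"
    using pd pos unfolding positive_definite_def by auto
  then have "0 < wnorm2 (G_op \<rho> \<gamma> A P Q) z" unfolding z' wnorm2_G_op using ge by linarith
  then show ?thesis by (simp only: wnorm2_def)
qed

lemma norm_triple_sq: "(norm (x, y, l))\<^sup>2 = (norm x)\<^sup>2 + (norm y)\<^sup>2 + (norm l)\<^sup>2"
  by (simp add: norm_Pair)

text \<open>The samples drawn before the j-th y-sample of stage k: every stage draws its y-samples first.\<close>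

definition before_y :: "nat \<Rightarrow> nat \<Rightarrow> (nat \<times> nat + nat \<times> nat) set" where
  "before_y k j = {i. case i of Inl (k', j') \<Rightarrow> k' < k \<or> k' = k \<and> j' < j | Inr (k', j') \<Rightarrow> k' < k}"

definition before_x :: "nat \<Rightarrow> nat \<Rightarrow> (nat \<times> nat + nat \<times> nat) set" where
  "before_x k j = {i. case i of Inl (k', j') \<Rightarrow> k' \<le> k | Inr (k', j') \<Rightarrow> k' < k \<or> k' = k \<and> j' < j}"

lemma before_y_simps [simp]:
  "Inl (k', j') \<in> before_y k j \<longleftrightarrow> k' < k \<or> k' = k \<and> j' < j" "Inr (k', j') \<in> before_y k j \<longleftrightarrow> k' < k"
  by (simp_all add: before_y_def)

lemma before_x_simps [simp]:
  "Inl (k', j') \<in> before_x k j \<longleftrightarrow> k' \<le> k" "Inr (k', j') \<in> before_x k j \<longleftrightarrow> k' < k \<or> k' = k \<and> j' < j"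
  by (simp_all add: before_x_def)

lemma sample_index_simps [simp]:
  "Inl (k, j) \<in> sample_index Ty Tx \<longleftrightarrow> 1 \<le> j \<and> j < Ty (Suc k)"
  "Inr (k, j) \<in> sample_index Ty Tx \<longleftrightarrow> 1 \<le> j \<and> j < Tx (Suc k)"
  by (auto simp: sample_index_def)

lemma before_y_mono: "before_y k j \<subseteq> before_y k (Suc j)"
  by (auto simp: before_y_def split: sum.splits)

lemma before_x_mono: "before_x k j \<subseteq> before_x k (Suc j)"
  by (auto simp: before_x_def split: sum.splits)

lemma before_y_before_x: "before_y k j \<subseteq> before_x k j'"
  by (auto simp: before_x_def before_y_def split: sum.splits)

lemma before_x_before_y: "before_x k j \<subseteq> before_y (Suc k) j'"
  by (auto simp: before_x_def before_y_def split: sum.splits)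

theorem theorem4:
  fixes M :: "'w measure"
    and \<xi> :: "'w \<Rightarrow> real^'d" and \<Xi> :: "(real^'d) set"
    and ft :: "real^'n \<Rightarrow> real^'d \<Rightarrow> real" and gt :: "real^'m \<Rightarrow> real^'d \<Rightarrow> real"
    and f :: "real^'n \<Rightarrow> real" and g :: "real^'m \<Rightarrow> real"
    and A :: "real^'n^'p" and B :: "real^'m^'p" and b :: "real^'p"
    and P :: "real^'n^'n" and Q :: "real^'m^'m"
    and \<rho> \<gamma> \<gamma>x \<gamma>y \<mu>f \<sigma>g Lf Lg v1x v2x v1y v2y cx Lx cy Ly R :: real
    and Tx Ty :: "nat \<Rightarrow> nat"
    and \<xi>x \<xi>y :: "nat \<Rightarrow> nat \<Rightarrow> 'w \<Rightarrow> real^'d"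
    and x :: "nat \<Rightarrow> 'w \<Rightarrow> real^'n" and y :: "nat \<Rightarrow> 'w \<Rightarrow> real^'m" and lam :: "nat \<Rightarrow> 'w \<Rightarrow> real^'p"
    and xi :: "nat \<Rightarrow> nat \<Rightarrow> 'w \<Rightarrow> real^'n" and yi :: "nat \<Rightarrow> nat \<Rightarrow> 'w \<Rightarrow> real^'m"
    and ustar :: "(real^'n) \<times> (real^'m) \<times> (real^'p)"
  assumes prob: "prob_space M"
    and xi_rv: "\<xi> \<in> borel_measurable M" "\<xi> ` space M \<subseteq> \<Xi>"
    and ft_meas: "\<And>z. ft z \<in> borel_measurable (restrict_space borel \<Xi>)"
    and gt_meas: "\<And>z. gt z \<in> borel_measurable (restrict_space borel \<Xi>)"
    and ft_convex: "\<And>s. s \<in> \<Xi> \<Longrightarrow> convex_on UNIV (\<lambda>z. ft z s)"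
    and gt_convex: "\<And>s. s \<in> \<Xi> \<Longrightarrow> convex_on UNIV (\<lambda>z. gt z s)"
    and ft_diff: "\<And>s z. s \<in> \<Xi> \<Longrightarrow> (\<lambda>z. ft z s) differentiable (at z)"
    and gt_diff: "\<And>s z. s \<in> \<Xi> \<Longrightarrow> (\<lambda>z. gt z s) differentiable (at z)"
    and f_def: "\<And>z. integrable M (\<lambda>\<omega>. ft z (\<xi> \<omega>))" "\<And>z. f z = (\<integral>\<omega>. ft z (\<xi> \<omega>) \<partial>M)"
    and g_def: "\<And>z. integrable M (\<lambda>\<omega>. gt z (\<xi> \<omega>))" "\<And>z. g z = (\<integral>\<omega>. gt z (\<xi> \<omega>) \<partial>M)"
    and params_pos: "\<rho> > 0" "\<gamma> > 0" "\<gamma>x > 0" "\<gamma>y > 0"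
    and T_pos: "\<And>k. Tx (Suc k) > 0" "\<And>k. Ty (Suc k) > 0"
    and samples: "iid_copies M \<xi> \<Xi> (sample_family \<xi>y \<xi>x) (sample_index Ty Tx)"
    and u0_rv: "(\<lambda>\<omega>. (x 0 \<omega>, y 0 \<omega>, lam 0 \<omega>)) \<in> borel_measurable M"
    and u0_indep: "indep_of_family M (\<lambda>\<omega>. (x 0 \<omega>, y 0 \<omega>, lam 0 \<omega>))
                     (sample_family \<xi>y \<xi>x) (sample_index Ty Tx)"
    and algorithm: "\<And>\<omega>. \<omega> \<in> space M \<Longrightarrow>
          si_admm_path A B b P Q f g ft gt \<rho> \<gamma> \<gamma>x \<gamma>y Tx Ty
            (\<lambda>k j. \<xi>x k j \<omega>) (\<lambda>k j. \<xi>y k j \<omega>) (\<lambda>k j. yi k j \<omega>) (\<lambda>k j. xi k j \<omega>)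
            (\<lambda>k. x k \<omega>) (\<lambda>k. y k \<omega>) (\<lambda>k. lam k \<omega>)"
    and cy: "\<And>x' l z. strongly_convex cy
          (\<lambda>v. aug_lagrangian \<rho> A B b f g x' v l + 1 / 2 * wnorm2 ((*v) Q) (v - z))"
    and Ly: "\<And>x' l z. Ly-lipschitz_on UNIV
          (gradient (\<lambda>v. aug_lagrangian \<rho> A B b f g x' v l + 1 / 2 * wnorm2 ((*v) Q) (v - z)))"
    and cx: "\<And>y' l z. strongly_convex cx
          (\<lambda>v. aug_lagrangian \<rho> A B b f g v y' l + 1 / 2 * wnorm2 ((*v) P) (v - z))"
    and Lx: "\<And>y' l z. Lx-lipschitz_on UNIV
          (gradient (\<lambda>v. aug_lagrangian \<rho> A B b f g v y' l + 1 / 2 * wnorm2 ((*v) P) (v - z)))"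
    and steps: "2 * cx * \<gamma>x > 1" "2 * cy * \<gamma>y > 1"
    and R_pos: "R > 0"
    and kkt: "kkt_point A B b f g ustar"
    and posdef: "positive_definite (P_hat \<rho> A P)" "positive_definite Q"
    and f_reg: "strongly_convex \<mu>f f" "continuously_differentiable f"
               "Lf-lipschitz_on UNIV (gradient f)"
    and g_reg: "strongly_convex \<sigma>g g" "continuously_differentiable g"
               "Lg-lipschitz_on UNIV (gradient g)"
    and full_row_rank: "rank (hcat A B) = CARD('p)"
    and moment_x: "moment_condition M \<xi> ft f v1x v2x"
    and moment_y: "moment_condition M \<xi> gt g v1y v2y"
    and P_cond: "P \<noteq> 0 \<Longrightarrow> loewner_greater ((2 - \<gamma>) *\<^sub>R P) (((\<gamma> - 1) * \<rho>) *\<^sub>R (transpose A ** A))"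
                "P = 0 \<Longrightarrow> \<gamma> = 1"
    and Ty_ge: "\<And>k. int (Ty (Suc k)) \<ge> K_const \<gamma>y cy (M_const Ly v1y R)"
    and Tx_ge: "\<And>k. int (Tx (Suc k)) \<ge> K_const \<gamma>x cx (M_const Lx v1x R)"
    and Ty_sum: "summable (\<lambda>k. 1 / real (Ty (Suc k)))"
    and Tx_sum: "summable (\<lambda>k. 1 / real (Tx (Suc k)))"
    and u0_moment: "integrable M
          (\<lambda>\<omega>. wnorm2 (G_op \<rho> \<gamma> A P Q) ((x 0 \<omega>, y 0 \<omega>, lam 0 \<omega>) - ustar))"
  shows "(\<exists>!u. kkt_point A B b f g u) \<and>
    (AE \<omega> in M. (\<lambda>k. wnorm2 (G_op \<rho> \<gamma> A P Q) ((x k \<omega>, y k \<omega>, lam k \<omega>) - ustar)) \<longlonglongrightarrow> 0)"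
proof -
  interpret prob_space M by (rule prob)
  obtain xs ys ls where us: "ustar = (xs, ys, ls)" by (cases ustar)
  let ?G = "G_op \<rho> \<gamma> A P Q"
  have df: "f differentiable (at v)" for v using f_reg(2) by (simp add: continuously_differentiable_def)
  have dg: "g differentiable (at v)" for v using g_reg(2) by (simp add: continuously_differentiable_def)
  have symP: "transpose P = P" using posdef(1) transpose_P_hat_symmetric unfolding positive_definite_def by blast
  have symQ: "transpose Q = Q" using posdef(2) unfolding positive_definite_def by blast
  have pos\<mu>: "\<mu>f > 0" "\<sigma>g > 0" using f_reg(1) g_reg(1) by (auto simp: strongly_convex_def)
  have Lipf: "norm (gradient f u - gradient f v) \<le> Lf * norm (u - v)" for u v
    using lipschitz_onD[OF f_reg(3) UNIV_I UNIV_I, of u v] unfolding dist_norm .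
  have Lipg: "norm (gradient g u - gradient g v) \<le> Lg * norm (u - v)" for u v
    using lipschitz_onD[OF g_reg(3) UNIV_I UNIV_I, of u v] unfolding dist_norm .
  note opt = kkt_point_gradients[OF kkt[unfolded us] df dg]
  have relax1: "\<gamma> < 2"
    using params_pos(1) posdef(1) P_cond by (rule relaxation_condition(1))
  have relax2: "\<rho> * (norm (A *v z))\<^sup>2 \<le> (2 - \<gamma>) * (z \<bullet> (P_hat \<rho> A P *v z))" for z
    using params_pos(1) posdef(1) P_cond by (rule relaxation_condition(2))
  obtain q C where q: "0 \<le> q" "q < 1" and C: "C \<ge> 0" and contract: "\<And>x y l x' y' l' r ex ey.
     r = A *v x' + B *v y' - b \<Longrightarrow>
     ex = gradient f x' - transpose A *v l + \<rho> *\<^sub>R (transpose A *v r) + P *v (x' - x) \<Longrightarrow>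
     ey = gradient g y' - transpose B *v l + \<rho> *\<^sub>R (transpose B *v (A *v x + B *v y' - b)) + Q *v (y' - y) \<Longrightarrow>
     l' = l - (\<gamma> * \<rho>) *\<^sub>R r \<Longrightarrow>
     wnorm2 ?G ((x', y', l') - (xs, ys, ls))
       \<le> q * wnorm2 ?G ((x, y, l) - (xs, ys, ls)) + C * ((norm ex)\<^sup>2 + (norm ey)\<^sup>2)"
    by (fact admm_inexact_step_contraction[OF params_pos(1,2) relax1 pos\<mu> posdef relax2
        strongly_convex_gradient_monotone[OF f_reg(1) df] Lipf
        strongly_convex_gradient_monotone[OF g_reg(1) dg] Lipg full_row_rank opt])
  obtain m where m: "m > 0" "\<And>z. m * (norm z)\<^sup>2 \<le> z \<bullet> ?G z"
    using positive_form_lower_bound[OF linear_G_op G_op_positive[OF params_pos(1,2) posdef]] by blast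
  obtain KG where KG: "KG > 0" "\<And>z. z \<bullet> ?G z \<le> KG * (norm z)\<^sup>2"
    using linear_form_upper_bound[OF linear_G_op] by blast
  have G_meas: "?G \<in> borel_measurable borel"
    by (intro borel_measurable_continuous_onI linear_continuous_on)
      (use linear_G_op in \<open>simp add: linear_conv_bounded_linear\<close>)

  \<comment> \<open>A KKT point is reproduced by a step without residuals, so the contraction applies with the same
    point before and after the step.\<close>
  have unique: "\<exists>!u. kkt_point A B b f g u"
  proof (rule ex1I)
    show "kkt_point A B b f g ustar" by (rule kkt)
    fix u assume u: "kkt_point A B b f g u"
    obtain x y l where u': "u = (x, y, l)" by (cases u)
    note o = kkt_point_gradients[OF u[unfolded u'] df dg]
    have r: "0 = A *v x + B *v y - b" by (simp add: o(3))
    have "wnorm2 ?G ((x, y, l) - (xs, ys, ls)) \<le> q * wnorm2 ?G ((x, y, l) - (xs, ys, ls)) + C * ((norm (0 :: real^'n))\<^sup>2 + (norm (0 :: real^'m))\<^sup>2)"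
      by (rule contract[OF r]) (simp_all add: o r[symmetric])
    then have "(1 - q) * wnorm2 ?G (u - ustar) \<le> 0" by (simp add: us u' algebra_simps)
    then have "wnorm2 ?G (u - ustar) \<le> 0" using q by (simp add: mult_le_0_iff)
    then have "m * (norm (u - ustar))\<^sup>2 \<le> 0" using m(2)[of "u - ustar"] by (simp add: wnorm2_def)
    then show "u = ustar" using m(1) by (simp add: mult_le_0_iff)
  qed

  define N where "N = restrict_space (borel :: (real^'d) measure) \<Xi>"
  have spN: "space N = \<Xi>" by (simp add: N_def space_restrict_space)
  have \<xi>N: "\<xi> \<in> measurable M N" unfolding N_def by (rule range_restricted_sample[OF xi_rv])
  have ftN: "ft z \<in> borel_measurable N" and gtN: "gt z' \<in> borel_measurable N" for z z'
    using ft_meas gt_meas by (simp_all add: N_def)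
  have ft_diffN: "\<forall>s\<in>space N. \<forall>z. (\<lambda>z. ft z s) differentiable (at z)"
    and gt_diffN: "\<forall>s\<in>space N. \<forall>z. (\<lambda>z. gt z s) differentiable (at z)"
    using ft_diff gt_diff by (simp_all add: spN)
  obtain Cx where Cx: "Cx \<ge> 0" and X: "\<And>F S x y l z T. T \<ge> 1 \<Longrightarrow> fresh_samples M N \<xi> F S T \<Longrightarrow>
     (\<And>j \<omega>. j \<in> {1..<T} \<Longrightarrow> \<omega> \<in> space M \<Longrightarrow> z (Suc j) \<omega> = z j \<omega> - (\<gamma>x / real j) *\<^sub>R
         (gradient (\<lambda>v. aug_lagrangian \<rho> A B b (\<lambda>u. ft u (S j \<omega>)) g v (y \<omega>) (l \<omega>)) (z j \<omega>)
           + P *v (z j \<omega> - x \<omega>))) \<Longrightarrow>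
     (\<lambda>\<omega>. (x \<omega>, y \<omega>, l \<omega>)) \<in> borel_measurable (F 1) \<Longrightarrow>
     (\<And>\<omega>. \<omega> \<in> space M \<Longrightarrow> z 1 \<omega> = x \<omega>) \<Longrightarrow>
     integrable M (\<lambda>\<omega>. (norm (x \<omega>, y \<omega>, l \<omega>))\<^sup>2) \<Longrightarrow>
     z T \<in> borel_measurable (F T) \<and>
     integrable M (\<lambda>\<omega>. (norm (z T \<omega>))\<^sup>2) \<and>
     (\<integral>\<omega>. (norm (z T \<omega>))\<^sup>2 \<partial>M) \<le> Cx * (1 + (\<integral>\<omega>. (norm (x \<omega>, y \<omega>, l \<omega>))\<^sup>2 \<partial>M)) \<and>
     integrable M (\<lambda>\<omega>. (norm (block_residual \<rho> A B b (gradient f) P (x \<omega>, y \<omega>, l \<omega>) (z T \<omega>)))\<^sup>2) \<and>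
     (\<integral>\<omega>. (norm (block_residual \<rho> A B b (gradient f) P (x \<omega>, y \<omega>, l \<omega>) (z T \<omega>)))\<^sup>2 \<partial>M)
       \<le> Cx / real T * (1 + (\<integral>\<omega>. (norm (x \<omega>, y \<omega>, l \<omega>))\<^sup>2 \<partial>M))"
    by (fact block_stage[OF prob \<xi>N ftN ft_diffN df f_reg(3) symP cx Lx steps(1) moment_x])
  have cy': "strongly_convex cy (\<lambda>v. aug_lagrangian \<rho> B A b g f v x' l + 1 / 2 * wnorm2 ((*v) Q) (v - z))" for x' l z
    using cy by (simp only: aug_lagrangian_swap[of \<rho> B A])
  have Ly': "Ly-lipschitz_on UNIV (gradient (\<lambda>v. aug_lagrangian \<rho> B A b g f v x' l + 1 / 2 * wnorm2 ((*v) Q) (v - z)))" for x' l z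
    using Ly by (simp only: aug_lagrangian_swap[of \<rho> B A])
  obtain Cy where Cy: "Cy \<ge> 0" and Y: "\<And>F S x y l z T. T \<ge> 1 \<Longrightarrow> fresh_samples M N \<xi> F S T \<Longrightarrow>
     (\<And>j \<omega>. j \<in> {1..<T} \<Longrightarrow> \<omega> \<in> space M \<Longrightarrow> z (Suc j) \<omega> = z j \<omega> - (\<gamma>y / real j) *\<^sub>R
         (gradient (\<lambda>v. aug_lagrangian \<rho> B A b (\<lambda>u. gt u (S j \<omega>)) f v (y \<omega>) (l \<omega>)) (z j \<omega>)
           + Q *v (z j \<omega> - x \<omega>))) \<Longrightarrow>
     (\<lambda>\<omega>. (x \<omega>, y \<omega>, l \<omega>)) \<in> borel_measurable (F 1) \<Longrightarrow>
     (\<And>\<omega>. \<omega> \<in> space M \<Longrightarrow> z 1 \<omega> = x \<omega>) \<Longrightarrow>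
     integrable M (\<lambda>\<omega>. (norm (x \<omega>, y \<omega>, l \<omega>))\<^sup>2) \<Longrightarrow>
     z T \<in> borel_measurable (F T) \<and>
     integrable M (\<lambda>\<omega>. (norm (z T \<omega>))\<^sup>2) \<and>
     (\<integral>\<omega>. (norm (z T \<omega>))\<^sup>2 \<partial>M) \<le> Cy * (1 + (\<integral>\<omega>. (norm (x \<omega>, y \<omega>, l \<omega>))\<^sup>2 \<partial>M)) \<and>
     integrable M (\<lambda>\<omega>. (norm (block_residual \<rho> B A b (gradient g) Q (x \<omega>, y \<omega>, l \<omega>) (z T \<omega>)))\<^sup>2) \<and>
     (\<integral>\<omega>. (norm (block_residual \<rho> B A b (gradient g) Q (x \<omega>, y \<omega>, l \<omega>) (z T \<omega>)))\<^sup>2 \<partial>M)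
       \<le> Cy / real T * (1 + (\<integral>\<omega>. (norm (x \<omega>, y \<omega>, l \<omega>))\<^sup>2 \<partial>M))"
    by (fact block_stage[OF prob \<xi>N gtN gt_diffN dg g_reg(3) symQ cy' Ly' steps(2) moment_y])

  define u where "u k \<omega> = (x k \<omega>, y k \<omega>, lam k \<omega>)" for k \<omega>
  define a where "a k \<omega> = wnorm2 ?G (u k \<omega> - ustar)" for k \<omega>
  define S where "S = sample_family \<xi>y \<xi>x"
  define I where "I = sample_index Ty Tx"
  \<comment> \<open>What is known before the j-th y-sample, respectively x-sample, of stage k is drawn.\<close>
  define Fy where "Fy k j = past M (u 0) S (I \<inter> before_y k j)" for k j
  define Fx where "Fx k j = past M (u 0) S (I \<inter> before_x k j)" for k j
  have u0: "u 0 \<in> borel_measurable M" "indep_of_family M (u 0) S I"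
    using u0_rv u0_indep unfolding u_def[abs_def] S_def I_def by simp_all
  have iid: "iid_copies M \<xi> \<Xi> S I" using samples by (simp only: S_def I_def)
  have Sy: "S (Inl (k, j)) = \<xi>y k j" and Sx: "S (Inr (k, j)) = \<xi>x k j" for k j
    by (simp_all add: S_def sample_family_def)
  have freshy: "fresh_samples M N \<xi> (Fy k) (\<lambda>j. \<xi>y k j) (Ty (Suc k))" for k
    unfolding N_def Fy_def Sy[symmetric]
    by (rule fresh_samples_past[OF u0 iid xi_rv]) (use before_y_mono[of k] in \<open>auto simp: I_def\<close>)
  have freshx: "fresh_samples M N \<xi> (Fx k) (\<lambda>j. \<xi>x k j) (Tx (Suc k))" for k
    unfolding N_def Fx_def Sx[symmetric]
    by (rule fresh_samples_past[OF u0 iid xi_rv]) (use before_x_mono[of k] in \<open>auto simp: I_def\<close>)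
  have S_meas: "S i \<in> borel_measurable M" if "i \<in> I" for i
    using iid that by (auto simp: iid_copies_def indep_vars_def)
  have subM: "sets (Fy k j) \<subseteq> sets M" "sets (Fx k j) \<subseteq> sets M" for k j
    unfolding Fy_def Fx_def by (intro sets_past_subset u0(1) S_meas; simp)+
  have spF: "space (Fy k j) = space M" "space (Fx k j) = space M" for k j by (simp_all add: Fy_def Fx_def)
  have Fyx: "sets (Fy k j) \<subseteq> sets (Fx k j')" for k j j'
    unfolding Fy_def Fx_def using before_y_before_x by (intro sets_past_mono) blast
  have Fxy: "sets (Fx k j) \<subseteq> sets (Fy (Suc k) j')" for k j j'
    unfolding Fy_def Fx_def using before_x_before_y by (intro sets_past_mono) blast

  have path: "yi k 1 \<omega> = y k \<omega>" "y (Suc k) \<omega> = yi k (Ty (Suc k)) \<omega>"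
    "xi k 1 \<omega> = x k \<omega>" "x (Suc k) \<omega> = xi k (Tx (Suc k)) \<omega>"
    "lam (Suc k) \<omega> = lam k \<omega> - (\<gamma> * \<rho>) *\<^sub>R (A *v x (Suc k) \<omega> + B *v y (Suc k) \<omega> - b)"
    and y_update: "j \<in> {1..<Ty (Suc k)} \<Longrightarrow> yi k (Suc j) \<omega> = yi k j \<omega> - (\<gamma>y / real j) *\<^sub>R
         (gradient (\<lambda>v. aug_lagrangian \<rho> B A b (\<lambda>w. gt w (\<xi>y k j \<omega>)) f v (x k \<omega>) (lam k \<omega>)) (yi k j \<omega>)
           + Q *v (yi k j \<omega> - y k \<omega>))"
    and x_update: "j \<in> {1..<Tx (Suc k)} \<Longrightarrow> xi k (Suc j) \<omega> = xi k j \<omega> - (\<gamma>x / real j) *\<^sub>R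
         (gradient (\<lambda>v. aug_lagrangian \<rho> A B b (\<lambda>w. ft w (\<xi>x k j \<omega>)) g v (y (Suc k) \<omega>) (lam k \<omega>)) (xi k j \<omega>)
           + P *v (xi k j \<omega> - x k \<omega>))"
    if "\<omega> \<in> space M" for k j \<omega>
    using algorithm[OF that] unfolding si_admm_path_def aug_lagrangian_swap[of \<rho> B A] by simp_all

  define ex where "ex k \<omega> = block_residual \<rho> A B b (gradient f) P (x k \<omega>, y (Suc k) \<omega>, lam k \<omega>) (x (Suc k) \<omega>)" for k \<omega>
  define ey where "ey k \<omega> = block_residual \<rho> B A b (gradient g) Q (y k \<omega>, x k \<omega>, lam k \<omega>) (y (Suc k) \<omega>)" for k \<omega>
  define U where "U k = (\<integral>\<omega>. (norm (u k \<omega>))\<^sup>2 \<partial>M)" for k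
  have U0: "U k \<ge> 0" for k by (simp add: U_def)

  have comp: "x k \<in> borel_measurable F" "y k \<in> borel_measurable F" "lam k \<in> borel_measurable F"
    if "u k \<in> borel_measurable F" for k F
  proof -
    have "(\<lambda>\<omega>. fst (u k \<omega>)) \<in> borel_measurable F" "(\<lambda>\<omega>. fst (snd (u k \<omega>))) \<in> borel_measurable F"
      "(\<lambda>\<omega>. snd (snd (u k \<omega>))) \<in> borel_measurable F"
      by (rule measurable_compose[OF that borel_measurable_continuous_onI]; intro continuous_intros)+
    then show "x k \<in> borel_measurable F" "y k \<in> borel_measurable F" "lam k \<in> borel_measurable F"
      by (simp_all add: u_def)
  qed
  \<comment> \<open>The y-stage starts from the parameter u(k); its output belongs to what is known before the x-stage.\<close>
  have y_stage: "y (Suc k) \<in> borel_measurable (Fx k 1)" "integrable M (\<lambda>\<omega>. (norm (y (Suc k) \<omega>))\<^sup>2)"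
      "(\<integral>\<omega>. (norm (y (Suc k) \<omega>))\<^sup>2 \<partial>M) \<le> Cy * (1 + U k)" "integrable M (\<lambda>\<omega>. (norm (ey k \<omega>))\<^sup>2)"
      "(\<integral>\<omega>. (norm (ey k \<omega>))\<^sup>2 \<partial>M) \<le> Cy / real (Ty (Suc k)) * (1 + U k)"
    if meas: "u k \<in> borel_measurable (Fy k 1)" and int: "integrable M (\<lambda>\<omega>. (norm (u k \<omega>))\<^sup>2)" for k
  proof -
    have eqn: "(norm (y k \<omega>, x k \<omega>, lam k \<omega>))\<^sup>2 = (norm (u k \<omega>))\<^sup>2" for \<omega>
      by (simp add: u_def norm_triple_sq)
    have p: "(\<lambda>\<omega>. (y k \<omega>, x k \<omega>, lam k \<omega>)) \<in> borel_measurable (Fy k 1)"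
      by (intro borel_measurable_Pair comp[OF meas])
    have pint: "integrable M (\<lambda>\<omega>. (norm (y k \<omega>, x k \<omega>, lam k \<omega>))\<^sup>2)" unfolding eqn by (rule int)
    have T: "Ty (Suc k) \<ge> 1" using T_pos(2)[of k] by simp
    note * = Y[of "Ty (Suc k)" "Fy k" "\<lambda>j. \<xi>y k j" "\<lambda>j \<omega>. yi k j \<omega>" "x k" "lam k" "y k",
        OF T freshy y_update p path(1) pint, unfolded eqn U_def[symmetric]]
    have yT: "(\<lambda>\<omega>. yi k (Ty (Suc k)) \<omega>) \<in> borel_measurable (Fy k (Ty (Suc k)))" using * by blast
    have "y (Suc k) \<in> borel_measurable (Fy k (Ty (Suc k)))"
      by (rule measurable_cong[THEN iffD1, OF _ yT]) (simp only: spF path(2))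
    then show "y (Suc k) \<in> borel_measurable (Fx k 1)"
      by (rule measurable_mono_sets) (simp_all add: spF Fyx)
    have cong: "integrable M (\<lambda>\<omega>. h \<omega> (yi k (Ty (Suc k)) \<omega>)) = integrable M (\<lambda>\<omega>. h \<omega> (y (Suc k) \<omega>))"
      "(\<integral>\<omega>. h \<omega> (yi k (Ty (Suc k)) \<omega>) \<partial>M) = (\<integral>\<omega>. h \<omega> (y (Suc k) \<omega>) \<partial>M)"
      for h :: "'w \<Rightarrow> real^'m \<Rightarrow> real"
      by (rule Bochner_Integration.integrable_cong Bochner_Integration.integral_cong; simp only: path(2))+
    show "integrable M (\<lambda>\<omega>. (norm (y (Suc k) \<omega>))\<^sup>2)" "(\<integral>\<omega>. (norm (y (Suc k) \<omega>))\<^sup>2 \<partial>M) \<le> Cy * (1 + U k)"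
      "integrable M (\<lambda>\<omega>. (norm (ey k \<omega>))\<^sup>2)"
      "(\<integral>\<omega>. (norm (ey k \<omega>))\<^sup>2 \<partial>M) \<le> Cy / real (Ty (Suc k)) * (1 + U k)"
      using * cong[of "\<lambda>_ v. (norm v)\<^sup>2"]
        cong[of "\<lambda>\<omega> v. (norm (block_residual \<rho> B A b (gradient g) Q (y k \<omega>, x k \<omega>, lam k \<omega>) v))\<^sup>2"]
      unfolding ey_def by simp_all
  qed
  \<comment> \<open>The x-stage has the new y in its parameter, hence the additional factor 1 + Cy.\<close>
  have x_stage: "x (Suc k) \<in> borel_measurable (Fx k (Tx (Suc k)))" "integrable M (\<lambda>\<omega>. (norm (x (Suc k) \<omega>))\<^sup>2)"
      "integrable M (\<lambda>\<omega>. (norm (ex k \<omega>))\<^sup>2)"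
      "(\<integral>\<omega>. (norm (ex k \<omega>))\<^sup>2 \<partial>M) \<le> Cx / real (Tx (Suc k)) * ((1 + Cy) * (1 + U k))"
    if meas: "u k \<in> borel_measurable (Fy k 1)" and int: "integrable M (\<lambda>\<omega>. (norm (u k \<omega>))\<^sup>2)" for k
  proof -
    note y = y_stage[OF meas int]
    have measx: "u k \<in> borel_measurable (Fx k 1)"
      by (rule measurable_mono_sets[OF meas]) (simp_all add: spF Fyx)
    have p: "(\<lambda>\<omega>. (x k \<omega>, y (Suc k) \<omega>, lam k \<omega>)) \<in> borel_measurable (Fx k 1)"
      by (intro borel_measurable_Pair comp[OF measx] y(1))
    have pM: "(\<lambda>\<omega>. (x k \<omega>, y (Suc k) \<omega>, lam k \<omega>)) \<in> borel_measurable M"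
      by (rule measurable_mono_sets[OF p]) (simp_all add: spF subM)
    have le: "(norm (x k \<omega>, y (Suc k) \<omega>, lam k \<omega>))\<^sup>2 \<le> (norm (u k \<omega>))\<^sup>2 + (norm (y (Suc k) \<omega>))\<^sup>2" for \<omega>
      by (simp add: u_def norm_triple_sq)
    have dom: "integrable M (\<lambda>\<omega>. (norm (u k \<omega>))\<^sup>2 + (norm (y (Suc k) \<omega>))\<^sup>2)" using int y(2) by simp
    have pint: "integrable M (\<lambda>\<omega>. (norm (x k \<omega>, y (Suc k) \<omega>, lam k \<omega>))\<^sup>2)"
      by (rule integrable_nonneg_bound[OF dom _ _ le]) (use pM in simp_all)
    have "(\<integral>\<omega>. (norm (x k \<omega>, y (Suc k) \<omega>, lam k \<omega>))\<^sup>2 \<partial>M)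
        \<le> (\<integral>\<omega>. (norm (u k \<omega>))\<^sup>2 + (norm (y (Suc k) \<omega>))\<^sup>2 \<partial>M)"
      by (rule integral_mono[OF pint dom le])
    also have "\<dots> = U k + (\<integral>\<omega>. (norm (y (Suc k) \<omega>))\<^sup>2 \<partial>M)" using int y(2) by (simp add: U_def)
    finally have Up: "1 + (\<integral>\<omega>. (norm (x k \<omega>, y (Suc k) \<omega>, lam k \<omega>))\<^sup>2 \<partial>M) \<le> (1 + Cy) * (1 + U k)"
      using y(3) by (simp add: algebra_simps)
    have T: "Tx (Suc k) \<ge> 1" using T_pos(1)[of k] by simp
    note * = X[of "Tx (Suc k)" "Fx k" "\<lambda>j. \<xi>x k j" "\<lambda>j \<omega>. xi k j \<omega>" "y (Suc k)" "lam k" "x k",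
        OF T freshx x_update p path(3) pint]
    have xT: "(\<lambda>\<omega>. xi k (Tx (Suc k)) \<omega>) \<in> borel_measurable (Fx k (Tx (Suc k)))" using * by blast
    show "x (Suc k) \<in> borel_measurable (Fx k (Tx (Suc k)))"
      by (rule measurable_cong[THEN iffD1, OF _ xT]) (simp only: spF path(4))
    have cong: "integrable M (\<lambda>\<omega>. h \<omega> (xi k (Tx (Suc k)) \<omega>)) = integrable M (\<lambda>\<omega>. h \<omega> (x (Suc k) \<omega>))"
      "(\<integral>\<omega>. h \<omega> (xi k (Tx (Suc k)) \<omega>) \<partial>M) = (\<integral>\<omega>. h \<omega> (x (Suc k) \<omega>) \<partial>M)"
      for h :: "'w \<Rightarrow> real^'n \<Rightarrow> real"
      by (rule Bochner_Integration.integrable_cong Bochner_Integration.integral_cong; simp only: path(4))+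
    show "integrable M (\<lambda>\<omega>. (norm (x (Suc k) \<omega>))\<^sup>2)" "integrable M (\<lambda>\<omega>. (norm (ex k \<omega>))\<^sup>2)"
      using * cong[of "\<lambda>_ v. (norm v)\<^sup>2"]
        cong[of "\<lambda>\<omega> v. (norm (block_residual \<rho> A B b (gradient f) P (x k \<omega>, y (Suc k) \<omega>, lam k \<omega>) v))\<^sup>2"]
      unfolding ex_def by simp_all
    have "(\<integral>\<omega>. (norm (ex k \<omega>))\<^sup>2 \<partial>M)
        \<le> Cx / real (Tx (Suc k)) * (1 + (\<integral>\<omega>. (norm (x k \<omega>, y (Suc k) \<omega>, lam k \<omega>))\<^sup>2 \<partial>M))"
      using * cong(2)[of "\<lambda>\<omega> v. (norm (block_residual \<rho> A B b (gradient f) P (x k \<omega>, y (Suc k) \<omega>, lam k \<omega>) v))\<^sup>2"]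
      unfolding ex_def by simp
    also have "\<dots> \<le> Cx / real (Tx (Suc k)) * ((1 + Cy) * (1 + U k))"
      using Cx by (intro mult_left_mono Up) simp
    finally show "(\<integral>\<omega>. (norm (ex k \<omega>))\<^sup>2 \<partial>M) \<le> Cx / real (Tx (Suc k)) * ((1 + Cy) * (1 + U k))" .
  qed

  have a_meas: "a k \<in> borel_measurable M" if "u k \<in> borel_measurable M" for k
  proof -
    have d: "(\<lambda>\<omega>. u k \<omega> - ustar) \<in> borel_measurable M" using that by simp
    show ?thesis unfolding a_def[abs_def] wnorm2_def
      by (intro borel_measurable_inner d measurable_compose[OF d G_meas])
  qed
  have a_nonneg: "0 \<le> a k \<omega>" for k \<omega>
    using m(2)[of "u k \<omega> - ustar"] m(1) unfolding a_def wnorm2_def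
    by (meson less_imp_le mult_nonneg_nonneg order_trans zero_le_power2)
  have u_le_a: "(norm (u k \<omega>))\<^sup>2 \<le> 2 / m * a k \<omega> + 2 * (norm ustar)\<^sup>2" for k \<omega>
  proof -
    have "(norm (u k \<omega> - ustar))\<^sup>2 \<le> a k \<omega> / m"
      using m(2)[of "u k \<omega> - ustar"] m(1) by (simp add: a_def wnorm2_def field_simps)
    then show ?thesis using norm_sum_sq_le[of "u k \<omega> - ustar" ustar] by simp
  qed
  have a_le_u: "a k \<omega> \<le> 2 * KG * (norm (u k \<omega>))\<^sup>2 + 2 * KG * (norm ustar)\<^sup>2" for k \<omega>
  proof -
    have "a k \<omega> \<le> KG * (norm (u k \<omega> - ustar))\<^sup>2" unfolding a_def wnorm2_def by (rule KG(2))
    also have "\<dots> \<le> KG * (2 * (norm (u k \<omega>))\<^sup>2 + 2 * (norm ustar)\<^sup>2)"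
      using KG(1) by (intro mult_left_mono norm_diff_sq_le) simp
    finally show ?thesis by (simp add: algebra_simps)
  qed
  have yM: "v \<in> borel_measurable M" if "v \<in> borel_measurable (Fy k j)" for v :: "'w \<Rightarrow> 'e::topological_space" and k j
    by (rule measurable_mono_sets[OF that]) (simp_all add: spF subM)
  have mul_meas: "(\<lambda>\<omega>. D *v v \<omega>) \<in> borel_measurable F" if "v \<in> borel_measurable F"
    for D :: "real^'i^'j" and v :: "'w \<Rightarrow> real^'i" and F
    by (rule measurable_compose[OF that borel_measurable_continuous_onI])
      (rule linear_continuous_on[OF matrix_vector_mul_bounded_linear])

  have inv: "u k \<in> borel_measurable (Fy k 1) \<and> integrable M (\<lambda>\<omega>. (norm (u k \<omega>))\<^sup>2)" for k
  proof (induction k)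
    case 0
    have "integrable M (\<lambda>\<omega>. 2 / m * a 0 \<omega> + 2 * (norm ustar)\<^sup>2)"
      using u0_moment by (simp add: a_def u_def)
    then have "integrable M (\<lambda>\<omega>. (norm (u 0 \<omega>))\<^sup>2)"
      by (rule integrable_nonneg_bound) (use u0(1) u_le_a in simp_all)
    then show ?case by (simp add: Fy_def measurable_past_initial)
  next
    case (Suc k)
    then have k: "u k \<in> borel_measurable (Fy k 1)" "integrable M (\<lambda>\<omega>. (norm (u k \<omega>))\<^sup>2)" by auto
    note y = y_stage[OF k] and x = x_stage[OF k]
    let ?F = "Fy (Suc k) 1"
    have x': "x (Suc k) \<in> borel_measurable ?F"
      by (rule measurable_mono_sets[OF x(1)]) (simp_all add: spF Fxy)
    have y': "y (Suc k) \<in> borel_measurable ?F"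
      by (rule measurable_mono_sets[OF y(1)]) (simp_all add: spF Fxy)
    have "u k \<in> borel_measurable ?F"
      by (rule measurable_mono_sets[OF k(1)]) (use order_trans[OF Fyx Fxy] in \<open>simp_all add: spF\<close>)
    then have lk: "lam k \<in> borel_measurable ?F" by (rule comp)
    have "(\<lambda>\<omega>. lam k \<omega> - (\<gamma> * \<rho>) *\<^sub>R (A *v x (Suc k) \<omega> + B *v y (Suc k) \<omega> - b)) \<in> borel_measurable ?F"
      by (intro borel_measurable_diff borel_measurable_scaleR borel_measurable_add borel_measurable_const
          mul_meas lk x' y')
    then have l': "lam (Suc k) \<in> borel_measurable ?F"
      by (rule measurable_cong[THEN iffD1, rotated]) (simp only: spF path(5))
    have meas: "u (Suc k) \<in> borel_measurable ?F"
      unfolding u_def[abs_def] by (intro borel_measurable_Pair x' y' l')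
    obtain KA where KA: "KA > 0" "\<And>z. (norm (A *v z))\<^sup>2 \<le> KA * (norm z)\<^sup>2" using matrix_norm_bound by blast
    obtain KB where KB: "KB > 0" "\<And>z. (norm (B *v z))\<^sup>2 \<le> KB * (norm z)\<^sup>2" using matrix_norm_bound by blast
    define h where "h \<omega> = (norm (x (Suc k) \<omega>))\<^sup>2 + (norm (y (Suc k) \<omega>))\<^sup>2 + (2 * (norm (u k \<omega>))\<^sup>2
        + 2 * ((\<gamma> * \<rho>)\<^sup>2 * (4 * (KA * (norm (x (Suc k) \<omega>))\<^sup>2) + 4 * (KB * (norm (y (Suc k) \<omega>))\<^sup>2) + 2 * (norm b)\<^sup>2)))" for \<omega>
    have hint: "integrable M h" unfolding h_def using k(2) x(2) y(2) by simp
    have "(norm (u (Suc k) \<omega>))\<^sup>2 \<le> h \<omega>" if "\<omega> \<in> space M" for \<omega>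
    proof -
      let ?r = "A *v x (Suc k) \<omega> + B *v y (Suc k) \<omega> - b"
      have "(norm ?r)\<^sup>2 \<le> 4 * (KA * (norm (x (Suc k) \<omega>))\<^sup>2) + 4 * (KB * (norm (y (Suc k) \<omega>))\<^sup>2) + 2 * (norm b)\<^sup>2"
        using norm_diff_sq_le[of "A *v x (Suc k) \<omega> + B *v y (Suc k) \<omega>" b]
          norm_sum_sq_le[of "A *v x (Suc k) \<omega>" "B *v y (Suc k) \<omega>"]
          KA(2)[of "x (Suc k) \<omega>"] KB(2)[of "y (Suc k) \<omega>"] by linarith
      from mult_left_mono[OF this zero_le_power2[of "\<gamma> * \<rho>"]]
      have "(norm ((\<gamma> * \<rho>) *\<^sub>R ?r))\<^sup>2 \<le> (\<gamma> * \<rho>)\<^sup>2 * (4 * (KA * (norm (x (Suc k) \<omega>))\<^sup>2) + 4 * (KB * (norm (y (Suc k) \<omega>))\<^sup>2) + 2 * (norm b)\<^sup>2)"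
        by (simp only: norm_scaleR power_mult_distrib power2_abs)
      moreover have "(norm (lam (Suc k) \<omega>))\<^sup>2 \<le> 2 * (norm (lam k \<omega>))\<^sup>2 + 2 * (norm ((\<gamma> * \<rho>) *\<^sub>R ?r))\<^sup>2"
        unfolding path(5)[OF that] by (rule norm_diff_sq_le)
      moreover have "(norm (lam k \<omega>))\<^sup>2 \<le> (norm (u k \<omega>))\<^sup>2" by (simp add: u_def norm_triple_sq)
      ultimately show ?thesis unfolding h_def u_def[of "Suc k"] norm_triple_sq by linarith
    qed
    then have "AE \<omega> in M. norm ((norm (u (Suc k) \<omega>))\<^sup>2) \<le> norm (h \<omega>)"
      by (intro AE_I2) force
    then have "integrable M (\<lambda>\<omega>. (norm (u (Suc k) \<omega>))\<^sup>2)"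
      using yM[OF meas] by (intro Bochner_Integration.integrable_bound[OF hint]) simp_all
    with meas show ?case by blast
  qed
  have uM: "u k \<in> borel_measurable M" and u_int: "integrable M (\<lambda>\<omega>. (norm (u k \<omega>))\<^sup>2)" for k
    using inv[of k] yM by blast+
  have a_int: "integrable M (a k)" for k
  proof -
    have "integrable M (\<lambda>\<omega>. 2 * KG * (norm (u k \<omega>))\<^sup>2 + 2 * KG * (norm ustar)\<^sup>2)" using u_int by simp
    then show ?thesis by (rule integrable_nonneg_bound) (use a_meas uM a_nonneg a_le_u in simp_all)
  qed
  define d where "d k = (\<integral>\<omega>. a k \<omega> \<partial>M)" for k
  have d0: "d k \<ge> 0" for k by (simp add: d_def a_nonneg)
  define K where "K = 1 + 2 / m + 2 * (norm ustar)\<^sup>2"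
  have K: "K \<ge> 0" using m(1) by (simp add: K_def)
  have U_le: "1 + U k \<le> K * (1 + d k)" for k
  proof -
    have "U k \<le> (\<integral>\<omega>. 2 / m * a k \<omega> + 2 * (norm ustar)\<^sup>2 \<partial>M)"
      unfolding U_def using u_int a_int u_le_a by (intro integral_mono) simp_all
    also have "\<dots> = 2 / m * d k + 2 * (norm ustar)\<^sup>2" using a_int by (simp add: d_def prob_space)
    finally have "1 + U k \<le> 1 + 2 / m * d k + 2 * (norm ustar)\<^sup>2" by simp
    also have "\<dots> \<le> K * (1 + d k)"
      using d0[of k] m(1) by (simp add: K_def distrib_left distrib_right)
    finally show ?thesis .
  qed
  define W where "W = C * (Cx * (1 + Cy) + Cy) * K"
  have W: "W \<ge> 0" using C Cx Cy K by (simp add: W_def)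
  define e where "e k = W * (1 / real (Tx (Suc k)) + 1 / real (Ty (Suc k)))" for k
  have rec: "d (Suc k) \<le> q * d k + e k * (1 + d k)" for k
  proof -
    have k: "u k \<in> borel_measurable (Fy k 1)" "integrable M (\<lambda>\<omega>. (norm (u k \<omega>))\<^sup>2)" using inv by auto
    note y = y_stage[OF k] and x = x_stage[OF k]
    let ?tx = "1 / real (Tx (Suc k))" and ?ty = "1 / real (Ty (Suc k))"
    have step: "a (Suc k) \<omega> \<le> q * a k \<omega> + C * ((norm (ex k \<omega>))\<^sup>2 + (norm (ey k \<omega>))\<^sup>2)" if "\<omega> \<in> space M" for \<omega>
      unfolding a_def u_def us
      by (rule contract[OF refl])
        (simp_all only: ex_def ey_def block_residual_def prod.case path(5)[OF that] add.commute[of "A *v x k \<omega>"])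
    have "d (Suc k) \<le> (\<integral>\<omega>. q * a k \<omega> + C * ((norm (ex k \<omega>))\<^sup>2 + (norm (ey k \<omega>))\<^sup>2) \<partial>M)"
      unfolding d_def using a_int x(3) y(4) step by (intro integral_mono) simp_all
    also have "\<dots> = q * d k + C * ((\<integral>\<omega>. (norm (ex k \<omega>))\<^sup>2 \<partial>M) + (\<integral>\<omega>. (norm (ey k \<omega>))\<^sup>2 \<partial>M))"
      using a_int x(3) y(4) by (simp add: d_def)
    also have "\<dots> \<le> q * d k + C * (Cx * ?tx * ((1 + Cy) * (1 + U k)) + Cy * ?ty * (1 + U k))"
      using C x(4) y(5) by (intro add_left_mono mult_left_mono add_mono) simp_all
    also have "\<dots> \<le> q * d k + C * ((Cx * (1 + Cy) + Cy) * (?tx + ?ty) * (1 + U k))"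
    proof -
      have "Cx * s * ((1 + Cy) * v) + Cy * t * v \<le> (Cx * (1 + Cy) + Cy) * (s + t) * v"
        if "0 \<le> s" "0 \<le> t" "0 \<le> v" for s t v
      proof -
        have "0 \<le> (Cx * (1 + Cy) * t + Cy * s) * v" using Cx Cy that by simp
        then show ?thesis by (simp add: algebra_simps)
      qed
      then have "Cx * ?tx * ((1 + Cy) * (1 + U k)) + Cy * ?ty * (1 + U k)
          \<le> (Cx * (1 + Cy) + Cy) * (?tx + ?ty) * (1 + U k)"
        by this (simp_all add: U0)
      then show ?thesis using C by (intro add_left_mono mult_left_mono)
    qed
    also have "\<dots> \<le> q * d k + C * ((Cx * (1 + Cy) + Cy) * (?tx + ?ty) * (K * (1 + d k)))"
      using C Cx Cy by (intro add_left_mono mult_left_mono U_le) simp_all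
    also have "\<dots> = q * d k + e k * (1 + d k)" by (simp only: e_def W_def mult_ac)
    finally show ?thesis .
  qed
  have "summable d"
  proof (rule summable_perturbed_contraction[where d = d and e = e, OF d0 _ _ q(2) rec])
    show "0 \<le> e k" for k using W by (simp add: e_def)
    show "summable e" unfolding e_def[abs_def] by (intro summable_mult summable_add Tx_sum Ty_sum)
  qed
  then have "AE \<omega> in M. (\<lambda>k. a k \<omega>) \<longlonglongrightarrow> 0"
    unfolding d_def[abs_def] by (rule AE_tendsto_zero_of_summable_integrals[OF a_int a_nonneg])
  with unique show ?thesis unfolding a_def u_def by blast
qed

end
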